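(* Let $A$ be a game and let $\sigma : S \to A$ be a pre-strategy. The following are equivalent: (i) $\sigma$ is a strategy, i.e. $\gamma_A \odot \sigma \cong \sigma$, where $\gamma_A$ is the copycat pre-strategy on $A$; (ii) both $\sigma : (\mathcal{C}(S), \supseteq^-) \to (\mathcal{C}(A), \supseteq^-)$ and $\sigma : (\mathcal{C}(S), \subseteq^+) \to (\mathcal{C}(A), \subseteq^+)$ (the direct-image map $x \mapsto \sigma x$) are discrete fibrations; (iii) $\sigma : (\mathcal{C}(S), \sqsubseteq_S) \to (\mathcal{C}(A), \sqsubseteq_A)$ is a discrete fibration; (iv) $\sigma$ is courteous and receptive.
   Context: **Event structures.** An event structure (es) is a triple $(E,\leq_E,\mathrm{Con}_E)$ where $E$ is a set of events, $\leq_E$ is a partial order on $E$ (causality) and $\mathrm{Con}_E$ is a non-empty set of finite subsets of $E$ (the consistent sets) such that: $[e]=\{e'\mid e'\leq_E e\}$ is finite for all $e\in E$; $\{e\}\in \mathrm{Con}_E$ for all $e$; $\mathrm{Con}_E$ is closed under subsets; and if $e'\leq_E e\in X\in \mathrm{Con}_E$ then $X\cup\{e'\}\in \mathrm{Con}_E$. $\mathcal{C}(E)$ is the set of (finite) configurations: finite consistent down-closed subsets of $E$, ordered by inclusion. We say that $e$ is an immediate cause of $e'$ (immediate causality) when $e<e'$ with nothing strictly in between. We write $x \overset{e}{\longrightarrow\!\!\subset}$ ("$x$ extends by $e$") when $e\notin x$ and $x\cup\{e\}\in\mathcal{C}(E)$. A map of es $f:E\to F$ is a total function such that $fx\in\mathcal{C}(F)$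 for all $x\in\mathcal{C}(E)$ and $f$ is injective on each configuration. **Polarities, games, pre-strategies.** An event structure with polarities (esp) is an es $A$ with a function $\mathrm{pol}_A:A\to\{-,+\}$; a game is an esp. $A^\perp$ is $A$ with polarities reversed. Maps of esps are maps of es preserving polarity. For configurations, $x\subseteq^- y$ (resp. $x\subseteq^+y$) means $x\subseteq y$ and all events of $y\setminus x$ are negative (resp. positive). The parallel composition $E\parallel F$ has events $\{0\}\times E\cup\{1\}\times F$, causality and polarity componentwise (no causality across components), a set being consistent iff both its components are; its configurations are written $x\parallel y$ with $x \in \mathcal{C}(E)$, $y \in \mathcal{C}(F)$. $1$ is the empty game. A pre-strategy on $A$ is a map of esps $\sigma:S\to A$. Pre-strategies $\sigma:S\to A$, $\tau:T\to A$ are isomorphic, $\sigma\cong\tau$, if there is an isomorphism of esps $\phi:S\cong T$ with $\tau\circ\phi=\sigma$. **Interaction and composition.** A bijection $\varphi:q\simeq q'$ between finite partial orders is secured if the reflexive transitive closure of the relation $(a,b)\vartriangleleft(a',b')$ iff $a<_q a'$ or $b<_{q'}b'$ on its graph is a partial order. For maps of es $\sigma:S\to A$, $\tau:T\to A$, the es $S\wedge T$ is: let $\mathcal{B}$ be the set of (graphs of) secured bijections $x\simeq\sigma x=\tau y\simeq y$ induced by $\sigma,\tau$ with $x\in\mathcal{C}(S)$, $y\in\mathcal{C}(T)$, $\sigma x=\tau y$; events are the elements of $\mathcal{B}$ having a greatest element (for the partial order on the graph given by the reflexive transitive closure of $\vartriangleleft$, with $x$ ordered by $\leq_S$ and $y$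 by $\leq_T$); causality is inclusion; a finite set is consistent iff its union is in $\mathcal{B}$. $\sigma\wedge\tau:S\wedge T\to A$ sends an event with greatest element $(s,t)$ to $\sigma s=\tau t$. For pre-strategies $\sigma:S\to A^\perp\parallel B$ and $\tau:T\to B^\perp\parallel C$, ignoring polarities, $\tau\circledast\sigma:T\circledast S\to A\parallel B\parallel C$ is $(\sigma\parallel \mathrm{id}_C)\wedge(\mathrm{id}_A\parallel\tau)$. $T\odot S$ is the restriction of $T\circledast S$ (causality and consistency inherited) to the visible events, i.e. those mapped to $A$ or $C$; $\tau\odot\sigma:T\odot S\to A^\perp\parallel C$ is the restriction of $\tau\circledast\sigma$, with polarities on $T\odot S$ making it polarity preserving. A pre-strategy $\sigma:S\to A$ is regarded as $S\to 1^\perp\parallel A$, so $\gamma_A\odot\sigma$ is a pre-strategy on $A$. **Copycat.** For a game $A$, $\Gamma_A$ has the events and polarities of $A^\perp\parallel A$, causality the transitive closure of $\leq_{A^\perp\parallel A}\cup\{((1-i,a),(i,a))\mid (i,a)\text{ positive in }A^\perp\parallel A\}$, and $X$ consistent iff its down-closure in $\Gamma_A$ is consistent in $A^\perp\parallel A$. $\gamma_A:\Gamma_A\to A^\perp\parallel A$ is the identity function. **Conditions.** $\sigma:S\to A$ is courteous if for all $s,s'\in S$ such that $s$ is an immediate cause of $s'$ in $S$ and $(\mathrm{pol}(s),\mathrm{pol}(s'))\neq(-,+)$, $\sigma s$ is an immediate cause of $\sigma s'$ in $A$. It is receptive if for each $x\in\mathcal{C}(S)$ such that $\sigma x$ extends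 by a negative $a\in A$ there is a unique $s\in S$ such that $x$ extends by $s$ and $\sigma s=a$. The Scott order on $\mathcal{C}(A)$ ($A$ an esp): $x\sqsubseteq_A y$ iff there is $z\in\mathcal{C}(A)$ with $x\supseteq^- z\subseteq^+ y$ (where $x\supseteq^-z$ means $z\subseteq^- x$). A monotone map $f:(X,\leq_X)\to(Y,\leq_Y)$ of partial orders is a discrete fibration if for all $x\in X$, $y\in Y$ with $y\leq_Y f x$ there is a unique $x'\leq_X x$ with $fx'=y$. *)

theory Defs
  imports Main
begin

section \<open>Event structures\<close>

record 'e es =
  events :: "'e set"
  leq :: "('e \<times> 'e) set"
  Con :: "'e set set"

definition event_structure :: "('e, 'z) es_scheme \<Rightarrow> bool" where
  "event_structure E \<longleftrightarrow>
     partial_order_on (events E) (leq E) \<and>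
     Con E \<noteq> {} \<and>
     (\<forall>X\<in>Con E. finite X \<and> X \<subseteq> events E) \<and>
     (\<forall>e\<in>events E. finite {e'. (e', e) \<in> leq E}) \<and>
     (\<forall>e\<in>events E. {e} \<in> Con E) \<and>
     (\<forall>X\<in>Con E. \<forall>Y. Y \<subseteq> X \<longrightarrow> Y \<in> Con E) \<and>
     (\<forall>X\<in>Con E. \<forall>e\<in>X. \<forall>e'. (e', e) \<in> leq E \<longrightarrow> insert e' X \<in> Con E)"

definition lt :: "('e, 'z) es_scheme \<Rightarrow> 'e \<Rightarrow> 'e \<Rightarrow> bool" where
  "lt E e e' \<longleftrightarrow> (e, e') \<in> leq E \<and> e \<noteq> e'"

definition immediate_cause :: "('e, 'z) es_scheme \<Rightarrow> 'e \<Rightarrow> 'e \<Rightarrow> bool" where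
  "immediate_cause E e e' \<longleftrightarrow> lt E e e' \<and> \<not> (\<exists>e''. lt E e e'' \<and> lt E e'' e')"

definition configs :: "('e, 'z) es_scheme \<Rightarrow> 'e set set" where
  "configs E = {x. finite x \<and> x \<subseteq> events E \<and> x \<in> Con E \<and>
     (\<forall>e\<in>x. \<forall>e'. (e', e) \<in> leq E \<longrightarrow> e' \<in> x)}"

definition extends_by :: "('e, 'z) es_scheme \<Rightarrow> 'e set \<Rightarrow> 'e \<Rightarrow> bool" where
  "extends_by E x e \<longleftrightarrow> e \<notin> x \<and> x \<union> {e} \<in> configs E"

text \<open>A map is a HOL function, of which only the values on the events of the source matter.\<close>

definition es_map :: "('e, 'z) es_scheme \<Rightarrow> ('f, 'y) es_scheme \<Rightarrow> ('e \<Rightarrow> 'f) \<Rightarrow> bool" where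
  "es_map E F f \<longleftrightarrow> f ` events E \<subseteq> events F \<and>
     (\<forall>x\<in>configs E. f ` x \<in> configs F \<and> inj_on f x)"


section \<open>Event structures with polarities\<close>

datatype polarity = Neg | Pos

primrec opposite :: "polarity \<Rightarrow> polarity" where
  "opposite Neg = Pos"
| "opposite Pos = Neg"

record 'e esp = "'e es" +
  pol :: "'e \<Rightarrow> polarity"

definition esp_map :: "'e esp \<Rightarrow> 'f esp \<Rightarrow> ('e \<Rightarrow> 'f) \<Rightarrow> bool" where
  "esp_map E F f \<longleftrightarrow> es_map E F f \<and> (\<forall>e\<in>events E. pol F (f e) = pol E e)"

definition esp_iso :: "'e esp \<Rightarrow> 'f esp \<Rightarrow> ('e \<Rightarrow> 'f) \<Rightarrow> bool" where
  "esp_iso E F f \<longleftrightarrow> esp_map E F f \<and>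
     (\<exists>g. esp_map F E g \<and> (\<forall>e\<in>events E. g (f e) = e) \<and> (\<forall>e\<in>events F. f (g e) = e))"

definition dual :: "'e esp \<Rightarrow> 'e esp" where
  "dual A = A\<lparr>pol := \<lambda>e. opposite (pol A e)\<rparr>"

definition par :: "'a esp \<Rightarrow> 'b esp \<Rightarrow> ('a + 'b) esp" (infixr "\<parallel>" 65) where
  "A \<parallel> B = \<lparr>
     events = events A <+> events B,
     leq = map_prod Inl Inl ` leq A \<union> map_prod Inr Inr ` leq B,
     Con = {Inl ` X \<union> Inr ` Y | X Y. X \<in> Con A \<and> Y \<in> Con B},
     pol = case_sum (pol A) (pol B)\<rparr>"

definition empty_game :: "unit esp" where
  "empty_game = \<lparr>events = {}, leq = {}, Con = {{}}, pol = \<lambda>_. Neg\<rparr>"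

definition pre_strategy :: "'a esp \<Rightarrow> 's esp \<Rightarrow> ('s \<Rightarrow> 'a) \<Rightarrow> bool" where
  "pre_strategy A S \<sigma> \<longleftrightarrow> event_structure S \<and> esp_map S A \<sigma>"

definition pre_strategy_iso ::
    "'s esp \<Rightarrow> ('s \<Rightarrow> 'a) \<Rightarrow> 't esp \<Rightarrow> ('t \<Rightarrow> 'a) \<Rightarrow> bool" where
  "pre_strategy_iso S \<sigma> T \<tau> \<longleftrightarrow>
     (\<exists>\<phi>. esp_iso S T \<phi> \<and> (\<forall>s\<in>events S. \<tau> (\<phi> s) = \<sigma> s))"


section \<open>Interaction and composition\<close>

text \<open>
  The reflexive transitive closure, on the graph \<open>\<theta>\<close> of a bijection, of the relation generated by
  the strict causal orders of both sides.
\<close>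

definition graph_order ::
    "('s, 'z) es_scheme \<Rightarrow> ('t, 'y) es_scheme \<Rightarrow> ('s \<times> 't) set \<Rightarrow> (('s \<times> 't) \<times> ('s \<times> 't)) set"
where
  "graph_order S T \<theta> = Id_on \<theta> \<union>
     {(p, p'). p \<in> \<theta> \<and> p' \<in> \<theta> \<and> (lt S (fst p) (fst p') \<or> lt T (snd p) (snd p'))}\<^sup>+"

definition secured ::
    "('s, 'z) es_scheme \<Rightarrow> ('t, 'y) es_scheme \<Rightarrow> ('s \<times> 't) set \<Rightarrow> bool" where
  "secured S T \<theta> \<longleftrightarrow> partial_order_on \<theta> (graph_order S T \<theta>)"

text \<open>
  For \<open>\<sigma> ` x = \<tau> ` y\<close> the induced bijection between \<open>x\<close> and \<open>y\<close> relates \<open>s\<close> and \<open>t\<close>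
  iff \<open>\<sigma> s = \<tau> t\<close>.
\<close>

definition induced_graph ::
    "('s \<Rightarrow> 'a) \<Rightarrow> ('t \<Rightarrow> 'a) \<Rightarrow> 's set \<Rightarrow> 't set \<Rightarrow> ('s \<times> 't) set" where
  "induced_graph \<sigma> \<tau> x y = {(s, t). s \<in> x \<and> t \<in> y \<and> \<sigma> s = \<tau> t}"

definition secured_bijections ::
    "('s, 'z) es_scheme \<Rightarrow> ('s \<Rightarrow> 'a) \<Rightarrow> ('t, 'y) es_scheme \<Rightarrow> ('t \<Rightarrow> 'a) \<Rightarrow> ('s \<times> 't) set set"
where
  "secured_bijections S \<sigma> T \<tau> =
     {induced_graph \<sigma> \<tau> x y | x y. x \<in> configs S \<and> y \<in> configs T \<and> \<sigma> ` x = \<tau> ` y \<and>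
        secured S T (induced_graph \<sigma> \<tau> x y)}"

definition is_greatest ::
    "('s, 'z) es_scheme \<Rightarrow> ('t, 'y) es_scheme \<Rightarrow> ('s \<times> 't) set \<Rightarrow> 's \<times> 't \<Rightarrow> bool" where
  "is_greatest S T \<theta> p \<longleftrightarrow> p \<in> \<theta> \<and> (\<forall>p'\<in>\<theta>. (p', p) \<in> graph_order S T \<theta>)"

definition wedge ::
    "('s, 'z) es_scheme \<Rightarrow> ('s \<Rightarrow> 'a) \<Rightarrow> ('t, 'y) es_scheme \<Rightarrow> ('t \<Rightarrow> 'a) \<Rightarrow> ('s \<times> 't) set es"
where
  "wedge S \<sigma> T \<tau> =
    (let B = secured_bijections S \<sigma> T \<tau>;
         Ev = {\<theta>\<in>B. \<exists>p. is_greatest S T \<theta> p}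
     in \<lparr>events = Ev,
         leq = {(\<theta>, \<theta>'). \<theta> \<in> Ev \<and> \<theta>' \<in> Ev \<and> \<theta> \<subseteq> \<theta>'},
         Con = {X. finite X \<and> X \<subseteq> Ev \<and> \<Union>X \<in> B}\<rparr>)"

definition wedge_map ::
    "('s, 'z) es_scheme \<Rightarrow> ('s \<Rightarrow> 'a) \<Rightarrow> ('t, 'y) es_scheme \<Rightarrow> ('t \<Rightarrow> 'a) \<Rightarrow> ('s \<times> 't) set \<Rightarrow> 'a"
where
  "wedge_map S \<sigma> T \<tau> \<theta> = \<sigma> (fst (THE p. is_greatest S T \<theta> p))"

text \<open>
  The threefold parallel composition of \<open>A\<close>, \<open>B\<close> and \<open>C\<close> is bracketed to the right; \<open>assoc_sum\<close>
  rebrackets the target of \<open>\<sigma> \<parallel> id\<^sub>C\<close>.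
\<close>

fun assoc_sum :: "('a + 'b) + 'c \<Rightarrow> 'a + ('b + 'c)" where
  "assoc_sum (Inl (Inl a)) = Inl a"
| "assoc_sum (Inl (Inr b)) = Inr (Inl b)"
| "assoc_sum (Inr c) = Inr (Inr c)"

definition interaction ::
    "'a esp \<Rightarrow> 'c esp \<Rightarrow> 's esp \<Rightarrow> ('s \<Rightarrow> 'a + 'b) \<Rightarrow> 't esp \<Rightarrow> ('t \<Rightarrow> 'b + 'c) \<Rightarrow>
     (('s + 'c) \<times> ('a + 't)) set es"
where
  "interaction A C S \<sigma> T \<tau> =
     wedge (S \<parallel> C) (assoc_sum \<circ> map_sum \<sigma> id) (A \<parallel> T) (map_sum id \<tau>)"

definition interaction_map ::
    "'a esp \<Rightarrow> 'c esp \<Rightarrow> 's esp \<Rightarrow> ('s \<Rightarrow> 'a + 'b) \<Rightarrow> 't esp \<Rightarrow> ('t \<Rightarrow> 'b + 'c) \<Rightarrow>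
     (('s + 'c) \<times> ('a + 't)) set \<Rightarrow> 'a + ('b + 'c)"
where
  "interaction_map A C S \<sigma> T \<tau> =
     wedge_map (S \<parallel> C) (assoc_sum \<circ> map_sum \<sigma> id) (A \<parallel> T) (map_sum id \<tau>)"

fun visible :: "'a + ('b + 'c) \<Rightarrow> bool" where
  "visible (Inl a) = True"
| "visible (Inr (Inl b)) = False"
| "visible (Inr (Inr c)) = True"

fun hide :: "'a + ('b + 'c) \<Rightarrow> 'a + 'c" where
  "hide (Inl a) = Inl a"
| "hide (Inr (Inl b)) = undefined"
| "hide (Inr (Inr c)) = Inr c"

definition composite_map ::
    "'a esp \<Rightarrow> 'c esp \<Rightarrow> 's esp \<Rightarrow> ('s \<Rightarrow> 'a + 'b) \<Rightarrow> 't esp \<Rightarrow> ('t \<Rightarrow> 'b + 'c) \<Rightarrow>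
     (('s + 'c) \<times> ('a + 't)) set \<Rightarrow> 'a + 'c"
where
  "composite_map A C S \<sigma> T \<tau> p = hide (interaction_map A C S \<sigma> T \<tau> p)"

definition composite ::
    "'a esp \<Rightarrow> 'c esp \<Rightarrow> 's esp \<Rightarrow> ('s \<Rightarrow> 'a + 'b) \<Rightarrow> 't esp \<Rightarrow> ('t \<Rightarrow> 'b + 'c) \<Rightarrow>
     (('s + 'c) \<times> ('a + 't)) set esp"
where
  "composite A C S \<sigma> T \<tau> =
    (let I = interaction A C S \<sigma> T \<tau>;
         V = {p\<in>events I. visible (interaction_map A C S \<sigma> T \<tau> p)}
     in \<lparr>events = V,
         leq = leq I \<inter> V \<times> V,
         Con = {X\<in>Con I. X \<subseteq> V},
         pol = \<lambda>p. pol (dual A \<parallel> C) (composite_map A C S \<sigma> T \<tau> p)\<rparr>)"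


section \<open>Copycat and strategies\<close>

fun swap_side :: "'a + 'a \<Rightarrow> 'a + 'a" where
  "swap_side (Inl a) = Inr a"
| "swap_side (Inr a) = Inl a"

definition copycat_leq :: "'a esp \<Rightarrow> (('a + 'a) \<times> ('a + 'a)) set" where
  "copycat_leq A =
     (leq (dual A \<parallel> A) \<union>
      {(swap_side c, c) | c. c \<in> events (dual A \<parallel> A) \<and> pol (dual A \<parallel> A) c = Pos})\<^sup>+"

definition copycat :: "'a esp \<Rightarrow> ('a + 'a) esp" where
  "copycat A = \<lparr>
     events = events (dual A \<parallel> A),
     leq = copycat_leq A,
     Con = {X. X \<subseteq> events (dual A \<parallel> A) \<and>
               {c'. \<exists>c\<in>X. (c', c) \<in> copycat_leq A} \<in> Con (dual A \<parallel> A)},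
     pol = pol (dual A \<parallel> A)\<rparr>"

definition copycat_map :: "'a + 'a \<Rightarrow> 'a + 'a" where
  "copycat_map = id"

text \<open>
  A pre-strategy \<open>\<sigma>\<close> on \<open>A\<close> is identified with \<open>Inr \<circ> \<sigma>\<close>, with target \<open>1\<^sup>\<bottom> \<parallel> A\<close> for the empty
  game \<open>1\<close>; isomorphism with the composite is expressed over that target.
\<close>

definition strategy :: "'a esp \<Rightarrow> 's esp \<Rightarrow> ('s \<Rightarrow> 'a) \<Rightarrow> bool" where
  "strategy A S \<sigma> \<longleftrightarrow>
     pre_strategy_iso
       (composite empty_game A S (Inr \<circ> \<sigma>) (copycat A) copycat_map)
       (composite_map empty_game A S (Inr \<circ> \<sigma>) (copycat A) copycat_map)
       S (Inr \<circ> \<sigma>)"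


section \<open>Courtesy, receptivity, and discrete fibrations\<close>

definition courteous :: "'a esp \<Rightarrow> 's esp \<Rightarrow> ('s \<Rightarrow> 'a) \<Rightarrow> bool" where
  "courteous A S \<sigma> \<longleftrightarrow>
     (\<forall>s\<in>events S. \<forall>s'\<in>events S.
        immediate_cause S s s' \<and> (pol S s, pol S s') \<noteq> (Neg, Pos) \<longrightarrow>
        immediate_cause A (\<sigma> s) (\<sigma> s'))"

definition receptive :: "'a esp \<Rightarrow> 's esp \<Rightarrow> ('s \<Rightarrow> 'a) \<Rightarrow> bool" where
  "receptive A S \<sigma> \<longleftrightarrow>
     (\<forall>x\<in>configs S. \<forall>a\<in>events A. pol A a = Neg \<and> extends_by A (\<sigma> ` x) a \<longrightarrow>
        (\<exists>!s. s \<in> events S \<and> extends_by S x s \<and> \<sigma> s = a))"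

text \<open>The relations \<open>x \<subseteq>\<^sup>p y\<close> on configurations, for \<open>p\<close> a polarity.\<close>

definition sub_pol :: "polarity \<Rightarrow> 'e esp \<Rightarrow> ('e set \<times> 'e set) set" where
  "sub_pol p A = {(x, y). x \<in> configs A \<and> y \<in> configs A \<and> x \<subseteq> y \<and> (\<forall>e\<in>y - x. pol A e = p)}"

definition scott_order :: "'e esp \<Rightarrow> ('e set \<times> 'e set) set" where
  "scott_order A = {(x, y). \<exists>z\<in>configs A. (z, x) \<in> sub_pol Neg A \<and> (z, y) \<in> sub_pol Pos A}"

definition discrete_fibration ::
    "'x set \<Rightarrow> ('x \<times> 'x) set \<Rightarrow> 'y set \<Rightarrow> ('y \<times> 'y) set \<Rightarrow> ('x \<Rightarrow> 'y) \<Rightarrow> bool" where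
  "discrete_fibration X r Y r' f \<longleftrightarrow>
     partial_order_on X r \<and> partial_order_on Y r' \<and> f ` X \<subseteq> Y \<and>
     monotone_on X (\<lambda>x x'. (x, x') \<in> r) (\<lambda>y y'. (y, y') \<in> r') f \<and>
     (\<forall>x\<in>X. \<forall>y\<in>Y. (y, f x) \<in> r' \<longrightarrow> (\<exists>!x'. x' \<in> X \<and> (x', x) \<in> r \<and> f x' = y))"

end

theory Submission
  imports Defs
begin

text \<open>
  Conditions (ii), (iii) and (iv) are compared directly, by adding one negative event at a time and
  by closing sets of events under immediate causes.  For (i), every pair of configurations \<open>x\<close> of
  \<open>S\<close> and \<open>y\<close> of \<open>A\<close> with \<open>y \<sqsubseteq> \<sigma> x\<close> is a secured interaction of \<open>\<sigma>\<close> with copycat, so after hiding the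
  configurations of the composite are the pairs \<open>(x, y)\<close> in which each event of \<open>x\<close> is below a
  positive \<open>s \<in> x\<close> with \<open>\<sigma> s \<in> y\<close>, and the composite map sends \<open>(x, y)\<close> to \<open>y\<close>.  In this description
  both lifting properties of the composite are immediate, hence a strategy has them.  Conversely,
  under the lifting properties \<open>u\<close> corresponds to \<open>(x, \<sigma> u)\<close> with \<open>x\<close> the down-closure of the positive
  events of \<open>u\<close>, and an order isomorphism of configurations over \<open>A\<close> comes from an isomorphism of
  event structures because maps into \<open>A\<close> are injective on configurations.
\<close>

section \<open>Configurations\<close>

text \<open>The common currency is the pair \<open>neg_lifting\<close> and
  \<open>pos_lifting\<close>, which mentions only configurations of \<open>S\<close> and
  \<open>A\<close>; each of the four conditions is shown equivalent to it. The obstacle is (i):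
  events of the composite are sets of pairs with a greatest element, so maps to and from
  \<open>S\<close> are awkward to define on events. They are obtained instead from a relation
  between configurations, an event being located by the least configuration that contains it
  (\<open>has_principals\<close>). Interaction with copycat cannot deadlock: a negative event
  appears on the visible side just before its hidden copy and a positive one just after, so
  everything can be scheduled along the causality of \<open>S\<close>. This is the origin of
  \<open>rank\<close> and of its factor 3. Hiding makes different pairs yield the same
  configuration; \<open>reach\<close> selects the smallest first component. From lifting back to
  (i), the delicate point is that the pairs reflect inclusion of the configurations
  \<open>u\<close>. Uniqueness of negative extensions settles it, once courtesy, itself derived from
  lifting, has produced a second extension to compare with.\<close>

lemma leq_refl: "event_structure E \<Longrightarrow> e \<in> events E \<Longrightarrow> (e, e) \<in> leq E"
  by (auto simp: event_structure_def partial_order_on_def preorder_on_def refl_on_def)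

lemma leq_antisym: "event_structure E \<Longrightarrow> (e, e') \<in> leq E \<Longrightarrow> (e', e) \<in> leq E \<Longrightarrow> e = e'"
  by (auto simp: event_structure_def partial_order_on_def dest: antisymD)

lemma leq_trans:
  "event_structure E \<Longrightarrow> (e, e') \<in> leq E \<Longrightarrow> (e', e'') \<in> leq E \<Longrightarrow> (e, e'') \<in> leq E"
  by (auto simp: event_structure_def partial_order_on_def preorder_on_def dest: transD)

lemma leq_events:
  assumes "event_structure E" "(e, e') \<in> leq E"
  shows "e \<in> events E" "e' \<in> events E"
  using assms by (auto simp: event_structure_def partial_order_on_def preorder_on_def)

lemma lt_events:
  assumes "event_structure E" "lt E e e'"
  shows "e \<in> events E" "e' \<in> events E"
  using assms leq_events by (auto simp: lt_def)

lemma Con_subset: "event_structure E \<Longrightarrow> X \<in> Con E \<Longrightarrow> Y \<subseteq> X \<Longrightarrow> Y \<in> Con E"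
  by (simp add: event_structure_def)

lemma configsD:
  assumes "x \<in> configs E"
  shows "finite x" "x \<subseteq> events E" "x \<in> Con E" "e \<in> x \<Longrightarrow> (e', e) \<in> leq E \<Longrightarrow> e' \<in> x"
  using assms by (auto simp: configs_def)

lemma configs_subset:
  assumes "\<And>X Y. X \<in> Con E \<Longrightarrow> Y \<subseteq> X \<Longrightarrow> Y \<in> Con E"
    and "x \<in> configs E" "u \<subseteq> x" "\<And>e e'. e \<in> u \<Longrightarrow> (e', e) \<in> leq E \<Longrightarrow> e' \<in> u"
  shows "u \<in> configs E"
  using assms(2-4) assms(1)[of x u] finite_subset[of u x] by (auto simp: configs_def)

text \<open>The axiom on consistency adds one cause of a member at a time, so the finite set of
  causes is assembled by induction, with \<open>e\<close> kept in the set to justify every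
  insertion.\<close>

lemma principal_config:
  assumes E: "event_structure E" and e: "e \<in> events E"
  shows "{e'. (e', e) \<in> leq E} \<in> configs E"
proof -
  have fin: "finite {e'. (e', e) \<in> leq E}"
    using assms by (simp add: event_structure_def)
  have "insert e Y \<in> Con E" if "finite Y" "Y \<subseteq> {e'. (e', e) \<in> leq E}" for Y
    using that
  proof (induction Y)
    case empty
    then show ?case using assms by (simp add: event_structure_def)
  next
    case (insert e' Y)
    then have "insert e Y \<in> Con E" "(e', e) \<in> leq E" by auto
    then have "insert e' (insert e Y) \<in> Con E"
      using E unfolding event_structure_def by blast
    then show ?case by (simp add: insert_commute)
  qed
  from this[OF fin] have "{e'. (e', e) \<in> leq E} \<in> Con E"
    using leq_refl[OF E e] by (simp add: insert_absorb)
  then show ?thesis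
    using fin leq_events(1)[OF E] leq_trans[OF E] by (auto simp: configs_def)
qed

text \<open>Makes the number of causes a strictly monotone measure. Extremal choices for this
  measure stand in for well-founded induction on causality, and it also ranks the events of
  \<open>y\<close> outside the image of \<open>x\<close>.\<close>

lemma card_principal_less:
  assumes E: "event_structure E" and "lt E d c"
  shows "card {e. (e, d) \<in> leq E} < card {e. (e, c) \<in> leq E}"
proof (rule psubset_card_mono)
  have dc: "(d, c) \<in> leq E" "d \<noteq> c" using assms(2) by (auto simp: lt_def)
  then show "finite {e. (e, c) \<in> leq E}"
    using configsD(1)[OF principal_config[OF E leq_events(2)[OF E]]] by blast
  show "{e. (e, d) \<in> leq E} \<subset> {e. (e, c) \<in> leq E}"
    using dc leq_trans[OF E] leq_antisym[OF E] leq_refl[OF E leq_events(2)[OF E dc(1)]] by blast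
qed

text \<open>Take \<open>c\<close> with the fewest causes among the events strictly above
  \<open>a\<close> and weakly below \<open>b\<close>; anything strictly between \<open>a\<close> and
  \<open>c\<close> would have fewer.\<close>

lemma ex_immediate_cause:
  assumes E: "event_structure E" and "lt E a b"
  obtains c where "immediate_cause E a c" "(c, b) \<in> leq E"
proof -
  have "lt E a b \<and> (b, b) \<in> leq E" using assms(2) leq_refl[OF E lt_events(2)[OF assms]] by simp
  then obtain c where c: "lt E a c" "(c, b) \<in> leq E" and
    min: "\<And>d. lt E a d \<Longrightarrow> (d, b) \<in> leq E \<Longrightarrow>
      card {e. (e, c) \<in> leq E} \<le> card {e. (e, d) \<in> leq E}"
    using ex_has_least_nat[of "\<lambda>d. lt E a d \<and> (d, b) \<in> leq E" b "\<lambda>d. card {e. (e, d) \<in> leq E}"]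
    by blast
  have "\<not> (lt E a d \<and> lt E d c)" for d
  proof
    assume d: "lt E a d \<and> lt E d c"
    then have "(d, b) \<in> leq E" using c leq_trans[OF E] by (auto simp: lt_def)
    then show False using min[of d] d card_principal_less[OF E, of d c] by auto
  qed
  with c show thesis by (intro that[of c]) (auto simp: immediate_cause_def)
qed

text \<open>Courtesy constrains immediate causes only, so down-closure has to be testable on them.
  Of the causes of \<open>e\<close> missing from \<open>u\<close>, let \<open>d\<close> have the
  most causes; an immediate successor of \<open>d\<close> towards \<open>e\<close> has more, so it
  lies in \<open>u\<close>, and then so does \<open>d\<close>.\<close>

lemma configs_immediateI:
  assumes E: "event_structure E" and x: "x \<in> configs E" and u: "u \<subseteq> x"
    and imm: "\<And>e e'. e \<in> u \<Longrightarrow> immediate_cause E e' e \<Longrightarrow> e' \<in> u"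
  shows "u \<in> configs E"
proof (rule configs_subset[OF Con_subset[OF E] x u])
  fix e e'
  assume e: "e \<in> u" "(e', e) \<in> leq E"
  show "e' \<in> u"
  proof (rule ccontr)
    assume e': "e' \<notin> u"
    let ?m = "\<lambda>d. card {f. (f, d) \<in> leq E}"
    have "?m d \<le> ?m e" if "(d, e) \<in> leq E" for d
      using card_principal_less[OF E, of d e] that by (cases "d = e") (auto simp: lt_def)
    then obtain d where d: "(d, e) \<in> leq E" "d \<notin> u" and
      max: "\<And>d'. (d', e) \<in> leq E \<Longrightarrow> d' \<notin> u \<Longrightarrow> ?m d' \<le> ?m d"
      using ex_has_greatest_nat[of "\<lambda>d. (d, e) \<in> leq E \<and> d \<notin> u" e' ?m "Suc (?m e)"] e e'
      by (auto simp: less_Suc_eq_le)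
    then have "lt E d e" using e by (auto simp: lt_def)
    then obtain c where c: "immediate_cause E d c" "(c, e) \<in> leq E"
      using ex_immediate_cause[OF E] by blast
    then have "c \<in> u"
      using max[of c] card_principal_less[OF E, of d c] by (auto simp: immediate_cause_def)
    then show False using imm[OF _ c(1)] d by blast
  qed
qed


section \<open>The orders on configurations\<close>

lemma sub_polI:
  assumes "x \<in> configs E" "y \<in> configs E" "x \<subseteq> y" "\<And>e. e \<in> y \<Longrightarrow> e \<notin> x \<Longrightarrow> pol E e = p"
  shows "(x, y) \<in> sub_pol p E"
  using assms by (simp add: sub_pol_def)

lemma sub_polD:
  assumes "(x, y) \<in> sub_pol p E"
  shows "x \<in> configs E" "y \<in> configs E" "x \<subseteq> y" "e \<in> y \<Longrightarrow> e \<notin> x \<Longrightarrow> pol E e = p"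
  using assms by (auto simp: sub_pol_def)

lemma sub_pol_partial_order: "partial_order_on (configs E) (sub_pol p E)"
proof -
  have "trans (sub_pol p E)"
  proof (rule transI)
    fix x y z assume xy: "(x, y) \<in> sub_pol p E" and yz: "(y, z) \<in> sub_pol p E"
    show "(x, z) \<in> sub_pol p E"
    proof (rule sub_polI[OF sub_polD(1)[OF xy] sub_polD(2)[OF yz]])
      show "x \<subseteq> z" using sub_polD(3)[OF xy] sub_polD(3)[OF yz] by blast
      show "pol E e = p" if "e \<in> z" "e \<notin> x" for e
        using that sub_polD(4)[OF xy] sub_polD(4)[OF yz] by (cases "e \<in> y") simp_all
    qed
  qed
  moreover have "antisym (sub_pol p E)" by (rule antisymI, rule subset_antisym) (simp_all add: sub_pol_def)
  ultimately show ?thesis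
    by (auto simp: partial_order_on_def preorder_on_def refl_on_def sub_pol_def)
qed

lemma sub_pol_converse_partial_order: "partial_order_on (configs E) ((sub_pol p E)\<inverse>)"
  using sub_pol_partial_order[of E p]
  by (auto simp: partial_order_on_def preorder_on_def refl_on_def)

lemma configs_Int:
  assumes "event_structure E" "x \<in> configs E" "y \<in> configs E"
  shows "x \<inter> y \<in> configs E"
  by (rule configs_subset[OF Con_subset[OF assms(1)] assms(2)]) (use configsD(4)[OF assms(2)] configsD(4)[OF assms(3)] in auto)

text \<open>An event of \<open>x\<close> and \<open>y\<close> outside \<open>z\<close> would be both
  negative and positive. Hence the middle of a Scott step is determined by its ends, which lets
  lifts be compared through their middles.\<close>

lemma scott_middle:
  assumes "(z, x) \<in> sub_pol Neg E" "(z, y) \<in> sub_pol Pos E"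
  shows "z = x \<inter> y"
proof -
  have "e \<in> z" if e: "e \<in> x" "e \<in> y" for e
  proof (rule ccontr)
    assume "e \<notin> z"
    then have "pol E e = Neg" "pol E e = Pos"
      using sub_polD(4)[OF assms(1) e(1)] sub_polD(4)[OF assms(2) e(2)] by simp_all
    then show False by simp
  qed
  moreover have "z \<subseteq> x" "z \<subseteq> y" using assms by (simp_all add: sub_pol_def)
  ultimately show ?thesis by blast
qed

lemma scott_orderI:
  "(z, x) \<in> sub_pol Neg E \<Longrightarrow> (z, y) \<in> sub_pol Pos E \<Longrightarrow> (x, y) \<in> scott_order E"
  unfolding scott_order_def using sub_polD(1) by fast

lemma scott_orderE:
  assumes "(x, y) \<in> scott_order E"
  obtains z where "(z, x) \<in> sub_pol Neg E" "(z, y) \<in> sub_pol Pos E"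
  using assms unfolding scott_order_def by fast

lemma sub_pol_refl: "x \<in> configs E \<Longrightarrow> (x, x) \<in> sub_pol p E"
  by (simp add: sub_pol_def)

text \<open>The intersection is the only possible middle, so it can be eliminated; transitivity and
  antisymmetry then become pointwise polarity checks.\<close>

lemma scott_order_iff:
  assumes "event_structure E"
  shows "(x, y) \<in> scott_order E \<longleftrightarrow>
    x \<in> configs E \<and> y \<in> configs E \<and> (\<forall>e\<in>x - y. pol E e = Neg) \<and> (\<forall>e\<in>y - x. pol E e = Pos)"
    (is "?l \<longleftrightarrow> ?r")
proof
  assume ?l
  then obtain z where "(z, x) \<in> sub_pol Neg E" "(z, y) \<in> sub_pol Pos E"
    by (auto simp: scott_order_def)
  then show ?r using scott_middle[of z x E y] by (auto simp: sub_pol_def)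
next
  assume ?r
  then show ?l
    using configs_Int[OF assms, of x y] unfolding scott_order_def sub_pol_def
    by (auto intro!: bexI[of _ "x \<inter> y"])
qed

lemma scott_order_partial_order:
  assumes "event_structure E"
  shows "partial_order_on (configs E) (scott_order E)"
proof -
  note iff = scott_order_iff[OF assms]
  have "x \<subseteq> y" if "(x, y) \<in> scott_order E" "(y, x) \<in> scott_order E" for x y
  proof (rule subsetI, rule ccontr)
    fix e assume "e \<in> x" "e \<notin> y"
    then have "pol E e = Neg" "pol E e = Pos" using that by (simp_all add: iff)
    then show False by simp
  qed
  then have "antisym (scott_order E)" by (intro antisymI subset_antisym)
  moreover have "trans (scott_order E)"
  proof (rule transI)
    fix x y z assume xy: "(x, y) \<in> scott_order E" and yz: "(y, z) \<in> scott_order E"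
    have "pol E e = Neg" if "e \<in> x - z" for e
      using that xy yz by (cases "e \<in> y") (simp_all add: iff)
    moreover have "pol E e = Pos" if "e \<in> z - x" for e
      using that xy yz by (cases "e \<in> y") (simp_all add: iff)
    ultimately show "(x, z) \<in> scott_order E" using xy yz by (simp add: iff)
  qed
  moreover have "refl_on (configs E) (scott_order E)" by (simp add: refl_on_def iff)
  moreover have "scott_order E \<subseteq> configs E \<times> configs E" by (auto simp: iff)
  ultimately show ?thesis by (simp add: partial_order_on_def preorder_on_def)
qed

lemma ex1_unique: "\<exists>!x. P x \<Longrightarrow> P a \<Longrightarrow> P b \<Longrightarrow> a = b"
  by auto

lemma discrete_fibrationI:
  assumes "partial_order_on X r" "partial_order_on Y r'"
    and "\<And>x. x \<in> X \<Longrightarrow> f x \<in> Y"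
    and "\<And>x x'. x \<in> X \<Longrightarrow> x' \<in> X \<Longrightarrow> (x, x') \<in> r \<Longrightarrow> (f x, f x') \<in> r'"
    and "\<And>x y. x \<in> X \<Longrightarrow> y \<in> Y \<Longrightarrow> (y, f x) \<in> r' \<Longrightarrow> \<exists>x'. x' \<in> X \<and> (x', x) \<in> r \<and> f x' = y"
    and "\<And>x x' x''. x \<in> X \<Longrightarrow> x' \<in> X \<Longrightarrow> x'' \<in> X \<Longrightarrow> (x', x) \<in> r \<Longrightarrow> (x'', x) \<in> r \<Longrightarrow>
      f x' = f x'' \<Longrightarrow> x' = x''"
  shows "discrete_fibration X r Y r' f"
  unfolding discrete_fibration_def monotone_on_def
proof (intro conjI ballI impI)
  fix x y assume xy: "x \<in> X" "y \<in> Y" "(y, f x) \<in> r'"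
  then obtain x' where "x' \<in> X" "(x', x) \<in> r" "f x' = y" using assms(5) by blast
  then show "\<exists>!x'. x' \<in> X \<and> (x', x) \<in> r \<and> f x' = y"
    using assms(6)[OF xy(1)] by (intro ex1I[of _ x']) auto
qed (use assms(1-4) in auto)

lemma discrete_fibrationD:
  assumes "discrete_fibration X r Y r' f" "x \<in> X" "y \<in> Y" "(y, f x) \<in> r'"
  obtains x' where "x' \<in> X" "(x', x) \<in> r" "f x' = y"
  using assms unfolding discrete_fibration_def by blast

lemma discrete_fibration_unique:
  assumes "discrete_fibration X r Y r' f" "x \<in> X" "x' \<in> X" "x'' \<in> X"
    "(x', x) \<in> r" "(x'', x) \<in> r" "f x' = f x''"
  shows "x' = x''"
proof -
  have "f x' \<in> Y" "(f x', f x) \<in> r'"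
    using assms unfolding discrete_fibration_def monotone_on_def by blast+
  then have "\<exists>!u. u \<in> X \<and> (u, x) \<in> r \<and> f u = f x'"
    using assms(1,2) unfolding discrete_fibration_def by blast
  then show ?thesis using assms by metis
qed


section \<open>Pre-strategies as fibrations of configurations\<close>

locale pre_strategy_on_game =
  fixes A :: "'a esp" and S :: "'s esp" and \<sigma> :: "'s \<Rightarrow> 'a"
  assumes game: "event_structure A" and pre_strategy: "pre_strategy A S \<sigma>"
begin

lemma source: "event_structure S"
  using pre_strategy by (simp add: pre_strategy_def)

lemma map_config: "x \<in> configs S \<Longrightarrow> \<sigma> ` x \<in> configs A"
  using pre_strategy by (simp add: pre_strategy_def esp_map_def es_map_def)

lemma map_inj: "x \<in> configs S \<Longrightarrow> inj_on \<sigma> x"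
  using pre_strategy by (simp add: pre_strategy_def esp_map_def es_map_def)

lemma map_pol: "s \<in> events S \<Longrightarrow> pol A (\<sigma> s) = pol S s"
  using pre_strategy by (simp add: pre_strategy_def esp_map_def)

lemma map_pol_config: "x \<in> configs S \<Longrightarrow> s \<in> x \<Longrightarrow> pol A (\<sigma> s) = pol S s"
  using map_pol configsD(2) by blast

lemma map_mem_iff:
  assumes "x \<in> configs S" "u \<subseteq> x" "s \<in> x"
  shows "\<sigma> s \<in> \<sigma> ` u \<longleftrightarrow> s \<in> u"
  using inj_on_image_mem_iff[OF map_inj[OF assms(1)] assms(3,2)] .

text \<open>The image of the causes of \<open>s'\<close> is a configuration containing \<sigma> s',
  hence also \<sigma> s. Injectivity on \<open>x\<close> identifies the cause lying over \<sigma> s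
  with \<open>s\<close> itself.\<close>

lemma map_leq_reflect:
  assumes x: "x \<in> configs S" and s: "s \<in> x" "s' \<in> x" and leq: "(\<sigma> s, \<sigma> s') \<in> leq A"
  shows "(s, s') \<in> leq S"
proof -
  have s': "s' \<in> events S" using x s configsD(2) by blast
  let ?d = "{e. (e, s') \<in> leq S}"
  have d: "?d \<in> configs S" by (rule principal_config[OF source s'])
  then have "\<sigma> s \<in> \<sigma> ` ?d"
    using configsD(4)[OF map_config[OF d] _ leq] leq_refl[OF source s'] by blast
  moreover have "?d \<subseteq> x" using configsD(4)[OF x s(2)] by blast
  ultimately show ?thesis using map_mem_iff[OF x _ s(1)] by blast
qed

lemma map_sub_pol:
  assumes "(x, y) \<in> sub_pol p S"
  shows "(\<sigma> ` x, \<sigma> ` y) \<in> sub_pol p A"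
proof (rule sub_polI)
  note xy = sub_polD[OF assms]
  show "\<sigma> ` x \<in> configs A" "\<sigma> ` y \<in> configs A" using map_config xy(1,2) by blast+
  show "\<sigma> ` x \<subseteq> \<sigma> ` y" using xy(3) by blast
  show "pol A a = p" if "a \<in> \<sigma> ` y" "a \<notin> \<sigma> ` x" for a
  proof -
    from that(1) obtain e where e: "e \<in> y" "a = \<sigma> e" by blast
    then have "e \<notin> x" using that(2) by blast
    then show ?thesis using map_pol_config[OF xy(2) e(1)] xy(4) e by simp
  qed
qed

lemma sub_pol_lift:
  assumes "x \<in> configs S" "y \<in> configs S" "x \<subseteq> y" "(\<sigma> ` x, \<sigma> ` y) \<in> sub_pol p A"
  shows "(x, y) \<in> sub_pol p S"
proof (rule sub_polI[OF assms(1-3)])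
  fix e assume e: "e \<in> y" "e \<notin> x"
  then have "\<sigma> e \<in> \<sigma> ` y" "\<sigma> e \<notin> \<sigma> ` x" using map_mem_iff[OF assms(2,3)] by blast+
  then have "pol A (\<sigma> e) = p" by (rule sub_polD(4)[OF assms(4)])
  then show "pol S e = p" using map_pol_config[OF assms(2) e(1)] by simp
qed

lemma map_eqD: "x \<in> configs S \<Longrightarrow> u \<subseteq> x \<Longrightarrow> v \<subseteq> x \<Longrightarrow> \<sigma> ` u = \<sigma> ` v \<Longrightarrow> u = v"
  using inj_on_image_eq_iff[OF map_inj] by blast

section \<open>Lifting properties and the two polarised fibrations\<close>

definition neg_lifting :: bool where
  "neg_lifting \<longleftrightarrow>
     (\<forall>x\<in>configs S. \<forall>y. (\<sigma> ` x, y) \<in> sub_pol Neg A \<longrightarrow>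
        (\<exists>x'. (x, x') \<in> sub_pol Neg S \<and> \<sigma> ` x' = y)) \<and>
     (\<forall>x x' x''. (x, x') \<in> sub_pol Neg S \<longrightarrow> (x, x'') \<in> sub_pol Neg S \<longrightarrow>
        \<sigma> ` x' = \<sigma> ` x'' \<longrightarrow> x' = x'')"

text \<open>There is no uniqueness clause as in \<open>neg_lifting\<close>: subsets of one
  configuration \<open>x\<close> with equal images are equal by injectivity on \<open>x\<close>
  (\<open>map_eqD\<close>). Two negative extensions of \<open>x\<close>, in contrast, need not lie
  in a common configuration.\<close>

definition pos_lifting :: bool where
  "pos_lifting \<longleftrightarrow> (\<forall>x\<in>configs S. \<forall>y. (y, \<sigma> ` x) \<in> sub_pol Pos A \<longrightarrow>
     (\<exists>x'. (x', x) \<in> sub_pol Pos S \<and> \<sigma> ` x' = y))"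

lemma neg_liftingI:
  assumes "\<And>x y. x \<in> configs S \<Longrightarrow> (\<sigma> ` x, y) \<in> sub_pol Neg A \<Longrightarrow>
      \<exists>x'. (x, x') \<in> sub_pol Neg S \<and> \<sigma> ` x' = y"
    and "\<And>x x' x''. (x, x') \<in> sub_pol Neg S \<Longrightarrow> (x, x'') \<in> sub_pol Neg S \<Longrightarrow>
      \<sigma> ` x' = \<sigma> ` x'' \<Longrightarrow> x' = x''"
  shows neg_lifting
  unfolding neg_lifting_def
proof (intro conjI ballI allI impI)
  show "\<exists>x'. (x, x') \<in> sub_pol Neg S \<and> \<sigma> ` x' = y"
    if "x \<in> configs S" "(\<sigma> ` x, y) \<in> sub_pol Neg A" for x y
    by (rule assms(1)[OF that])
  show "x' = x''"
    if "(x, x') \<in> sub_pol Neg S" "(x, x'') \<in> sub_pol Neg S" "\<sigma> ` x' = \<sigma> ` x''" for x x' x''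
    by (rule assms(2)[OF that])
qed

lemma neg_lifting_ex:
  assumes neg_lifting "x \<in> configs S" "(\<sigma> ` x, y) \<in> sub_pol Neg A"
  obtains x' where "(x, x') \<in> sub_pol Neg S" "\<sigma> ` x' = y"
  using conjunct1[OF assms(1)[unfolded neg_lifting_def], rule_format, OF assms(2,3)] that
  by (elim exE conjE)

lemma neg_lifting_unique:
  assumes neg_lifting "(x, x') \<in> sub_pol Neg S" "(x, x'') \<in> sub_pol Neg S" "\<sigma> ` x' = \<sigma> ` x''"
  shows "x' = x''"
  by (rule conjunct2[OF assms(1)[unfolded neg_lifting_def], rule_format, OF assms(2-4)])

lemma pos_lifting_ex:
  assumes pos_lifting "x \<in> configs S" "(y, \<sigma> ` x) \<in> sub_pol Pos A"
  obtains x' where "(x', x) \<in> sub_pol Pos S" "\<sigma> ` x' = y"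
  using assms(1)[unfolded pos_lifting_def, rule_format, OF assms(2,3)] that
  by (elim exE conjE)

lemma neg_fibration_iff:
  "discrete_fibration (configs S) ((sub_pol Neg S)\<inverse>) (configs A) ((sub_pol Neg A)\<inverse>) ((`) \<sigma>) \<longleftrightarrow>
   neg_lifting" (is "?F \<longleftrightarrow> _")
proof
  assume F: ?F
  show neg_lifting
  proof (rule neg_liftingI)
    fix x y assume x: "x \<in> configs S" and y: "(\<sigma> ` x, y) \<in> sub_pol Neg A"
    obtain x' where "(x', x) \<in> (sub_pol Neg S)\<inverse>" "\<sigma> ` x' = y"
      by (rule discrete_fibrationD[OF F x sub_polD(2)[OF y] converseI[OF y]])
    then show "\<exists>x'. (x, x') \<in> sub_pol Neg S \<and> \<sigma> ` x' = y" by (intro exI[of _ x']) simp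
  next
    fix x x' x''
    assume x': "(x, x') \<in> sub_pol Neg S" and x'': "(x, x'') \<in> sub_pol Neg S"
      and eq: "\<sigma> ` x' = \<sigma> ` x''"
    show "x' = x''"
      by (rule discrete_fibration_unique[OF F sub_polD(1)[OF x'] sub_polD(2)[OF x']
            sub_polD(2)[OF x''] converseI[OF x'] converseI[OF x''] eq])
  qed
next
  assume L: neg_lifting
  show ?F
  proof (rule discrete_fibrationI[OF sub_pol_converse_partial_order sub_pol_converse_partial_order])
    show "\<exists>x'. x' \<in> configs S \<and> (x', x) \<in> (sub_pol Neg S)\<inverse> \<and> \<sigma> ` x' = y"
      if x: "x \<in> configs S" and y: "(y, \<sigma> ` x) \<in> (sub_pol Neg A)\<inverse>" for x y
    proof -
      obtain x' where x': "(x, x') \<in> sub_pol Neg S" "\<sigma> ` x' = y"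
        by (rule neg_lifting_ex[OF L x converseD[OF y]])
      show ?thesis using x' sub_polD(2)[OF x'(1)] by (intro exI[of _ x']) simp
    qed
    show "x' = x''"
      if "(x', x) \<in> (sub_pol Neg S)\<inverse>" "(x'', x) \<in> (sub_pol Neg S)\<inverse>" "\<sigma> ` x' = \<sigma> ` x''"
      for x x' x''
      by (rule neg_lifting_unique[OF L converseD[OF that(1)] converseD[OF that(2)] that(3)])
  qed (simp_all add: map_config map_sub_pol)
qed

lemma pos_fibration_iff:
  "discrete_fibration (configs S) (sub_pol Pos S) (configs A) (sub_pol Pos A) ((`) \<sigma>) \<longleftrightarrow>
   pos_lifting" (is "?F \<longleftrightarrow> _")
proof
  assume F: ?F
  show pos_lifting
    unfolding pos_lifting_def
  proof (intro ballI allI impI)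
    fix x y assume x: "x \<in> configs S" and y: "(y, \<sigma> ` x) \<in> sub_pol Pos A"
    obtain x' where "(x', x) \<in> sub_pol Pos S" "\<sigma> ` x' = y"
      by (rule discrete_fibrationD[OF F x sub_polD(1)[OF y] y])
    then show "\<exists>x'. (x', x) \<in> sub_pol Pos S \<and> \<sigma> ` x' = y" by (intro exI[of _ x']) simp
  qed
next
  assume L: pos_lifting
  show ?F
  proof (rule discrete_fibrationI[OF sub_pol_partial_order sub_pol_partial_order])
    show "\<exists>x'. x' \<in> configs S \<and> (x', x) \<in> sub_pol Pos S \<and> \<sigma> ` x' = y"
      if x: "x \<in> configs S" and y: "(y, \<sigma> ` x) \<in> sub_pol Pos A" for x y
    proof -
      obtain x' where x': "(x', x) \<in> sub_pol Pos S" "\<sigma> ` x' = y"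
        by (rule pos_lifting_ex[OF L x y])
      show ?thesis using x' sub_polD(1)[OF x'(1)] by (intro exI[of _ x']) simp
    qed
    show "x' = x''"
      if "x \<in> configs S" "(x', x) \<in> sub_pol Pos S" "(x'', x) \<in> sub_pol Pos S" "\<sigma> ` x' = \<sigma> ` x''"
      for x x' x''
      by (rule map_eqD[OF that(1) sub_polD(3)[OF that(2)] sub_polD(3)[OF that(3)] that(4)])
  qed (simp_all add: map_config map_sub_pol)
qed

section \<open>Lifting properties and the Scott order\<close>

lemma scott_fibration_if_lifting:
  assumes neg: neg_lifting and pos: pos_lifting
  shows "discrete_fibration (configs S) (scott_order S) (configs A) (scott_order A) ((`) \<sigma>)"
proof (rule discrete_fibrationI[OF scott_order_partial_order[OF source] scott_order_partial_order[OF game]])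
  show "\<sigma> ` x \<in> configs A" if "x \<in> configs S" for x
    by (rule map_config[OF that])
  show "(\<sigma> ` x, \<sigma> ` x') \<in> scott_order A" if "(x, x') \<in> scott_order S" for x x'
    using that by (rule scott_orderE) (rule scott_orderI[OF map_sub_pol map_sub_pol])
  show "\<exists>x'. x' \<in> configs S \<and> (x', x) \<in> scott_order S \<and> \<sigma> ` x' = y"
    if x: "x \<in> configs S" and y: "(y, \<sigma> ` x) \<in> scott_order A" for x y
  proof -
    from y obtain w where w: "(w, y) \<in> sub_pol Neg A" "(w, \<sigma> ` x) \<in> sub_pol Pos A"
      by (rule scott_orderE)
    obtain z where z: "(z, x) \<in> sub_pol Pos S" "\<sigma> ` z = w" by (rule pos_lifting_ex[OF pos x w(2)])
    obtain x' where x': "(z, x') \<in> sub_pol Neg S" "\<sigma> ` x' = y"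
      using neg_lifting_ex[OF neg sub_polD(1)[OF z(1)], of y] w(1) z(2) by auto
    show ?thesis
      using sub_polD(2)[OF x'(1)] scott_orderI[OF x'(1) z(1)] x'(2) by (intro exI[of _ x']) simp
  qed
  show "x' = x''"
    if x: "x \<in> configs S" and x': "(x', x) \<in> scott_order S" and x'': "(x'', x) \<in> scott_order S"
      and eq: "\<sigma> ` x' = \<sigma> ` x''" for x x' x''
  proof -
    from x' obtain z where z: "(z, x') \<in> sub_pol Neg S" "(z, x) \<in> sub_pol Pos S"
      by (rule scott_orderE)
    from x'' obtain z' where z': "(z', x'') \<in> sub_pol Neg S" "(z', x) \<in> sub_pol Pos S"
      by (rule scott_orderE)
    \<comment> \<open>Both middles lie over the intersection of the image of \<open>x\<close> with
      the common image of \<open>x'\<close> and \<open>x''\<close>. Inside \<open>x\<close> this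
      makes them equal, and only uniqueness of negative extensions remains.\<close>
    have "\<sigma> ` z = \<sigma> ` z'"
      using scott_middle[OF map_sub_pol[OF z(1)] map_sub_pol[OF z(2)]]
        scott_middle[OF map_sub_pol[OF z'(1)] map_sub_pol[OF z'(2)]] eq by simp
    then have "z = z'" by (rule map_eqD[OF x sub_polD(3)[OF z(2)] sub_polD(3)[OF z'(2)]])
    then show ?thesis using neg_lifting_unique[OF neg z(1) _ eq] z'(1) by simp
  qed
qed

text \<open>A negative extension and a positive restriction are both Scott steps below \<sigma> x.
  The middle of the lifted step lies over the intersection of \<open>y\<close> with \<sigma> x,
  which is \<sigma> x in the first case and \<open>y\<close> in the second; so the lift consists of
  negative steps only, or its middle is already the required restriction.\<close>

lemma lifting_if_scott_fibration:
  assumes F: "discrete_fibration (configs S) (scott_order S) (configs A) (scott_order A) ((`) \<sigma>)"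
  shows neg_lifting pos_lifting
proof -
  have lift: "\<exists>x' z. (z, x') \<in> sub_pol Neg S \<and> (z, x) \<in> sub_pol Pos S \<and> \<sigma> ` x' = y \<and>
      \<sigma> ` z = y \<inter> \<sigma> ` x"
    if x: "x \<in> configs S" and y: "(y, \<sigma> ` x) \<in> scott_order A" for x y
  proof -
    have "y \<in> configs A" using y by (simp add: scott_order_iff[OF game])
    then obtain x' where x': "(x', x) \<in> scott_order S" "\<sigma> ` x' = y"
      using discrete_fibrationD[OF F x _ y] by auto
    from x'(1) obtain z where z: "(z, x') \<in> sub_pol Neg S" "(z, x) \<in> sub_pol Pos S"
      by (rule scott_orderE)
    have "\<sigma> ` z = y \<inter> \<sigma> ` x"
      using scott_middle[OF map_sub_pol[OF z(1)] map_sub_pol[OF z(2)]] x'(2) by simp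
    with z x'(2) show ?thesis by (intro exI conjI)
  qed
  show neg_lifting
  proof (rule neg_liftingI)
    fix x y assume x: "x \<in> configs S" and y: "(\<sigma> ` x, y) \<in> sub_pol Neg A"
    have "(y, \<sigma> ` x) \<in> scott_order A"
      by (rule scott_orderI[OF y sub_pol_refl[OF map_config[OF x]]])
    from lift[OF x this] obtain x' z where z: "(z, x') \<in> sub_pol Neg S" "(z, x) \<in> sub_pol Pos S"
      "\<sigma> ` x' = y" "\<sigma> ` z = y \<inter> \<sigma> ` x" by auto
    have "\<sigma> ` z = \<sigma> ` x" using z(4) sub_polD(3)[OF y] by (simp add: Int_absorb1)
    then have "z = x" using map_eqD[OF x sub_polD(3)[OF z(2)] subset_refl] by simp
    then show "\<exists>x'. (x, x') \<in> sub_pol Neg S \<and> \<sigma> ` x' = y"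
      using z by (intro exI[of _ x']) simp
  next
    fix x x' x''
    assume x': "(x, x') \<in> sub_pol Neg S" and x'': "(x, x'') \<in> sub_pol Neg S"
      and eq: "\<sigma> ` x' = \<sigma> ` x''"
    note x = sub_polD(1)[OF x']
    show "x' = x''"
      by (rule discrete_fibration_unique[OF F x sub_polD(2)[OF x'] sub_polD(2)[OF x'']
            scott_orderI[OF x' sub_pol_refl[OF x]] scott_orderI[OF x'' sub_pol_refl[OF x]] eq])
  qed
  show pos_lifting
    unfolding pos_lifting_def
  proof (intro ballI allI impI)
    fix x y assume x: "x \<in> configs S" and y: "(y, \<sigma> ` x) \<in> sub_pol Pos A"
    have "(y, \<sigma> ` x) \<in> scott_order A"
      by (rule scott_orderI[OF sub_pol_refl[OF sub_polD(1)[OF y]] y])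
    from lift[OF x this] obtain z where z: "(z, x) \<in> sub_pol Pos S" "\<sigma> ` z = y \<inter> \<sigma> ` x" by auto
    have "\<sigma> ` z = y" using z(2) sub_polD(3)[OF y] by (simp add: Int_absorb2)
    then show "\<exists>x'. (x', x) \<in> sub_pol Pos S \<and> \<sigma> ` x' = y"
      using z(1) by (intro exI[of _ z]) simp
  qed
qed

section \<open>Courtesy and receptivity against lifting\<close>

lemma enabled_if_courteous:
  assumes cour: "courteous A S \<sigma>" and x: "x \<in> configs S" and x': "x' \<in> configs S" "x \<subseteq> x'"
    and s: "s \<in> x'" "pol S s = Neg" and a: "insert (\<sigma> s) (\<sigma> ` x) \<in> configs A"
  shows "insert s x \<in> configs S"
proof (rule configs_immediateI[OF source x'(1)])
  show sub: "insert s x \<subseteq> x'" using s x' by simp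
  fix e e' assume e: "e \<in> insert s x" and imm: "immediate_cause S e' e"
  then have leq: "(e', e) \<in> leq S" by (simp add: immediate_cause_def lt_def)
  show "e' \<in> insert s x"
  proof (cases "e = s")
    case False
    then show ?thesis using configsD(4)[OF x _ leq] e by simp
  next
    case True
    \<comment> \<open>Courtesy applies because \<open>s\<close> is negative, whatever the polarity
      of \<open>e'\<close>. The image of \<open>e'\<close> is then a cause of \<sigma> s, and
      injectivity on \<open>x'\<close> brings membership back to \<open>insert s x\<close>.\<close>
    then have "immediate_cause A (\<sigma> e') (\<sigma> s)"
      using cour imm leq_events[OF source leq] s(2) by (simp add: courteous_def)
    then have "\<sigma> e' \<in> insert (\<sigma> s) (\<sigma> ` x)"
      using configsD(4)[OF a, of "\<sigma> s" "\<sigma> e'"] by (simp add: immediate_cause_def lt_def)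
    then have "\<sigma> e' \<in> \<sigma> ` insert s x" by simp
    moreover have "e' \<in> x'" using configsD(4)[OF x'(1) s(1)] leq True by simp
    ultimately show ?thesis using map_mem_iff[OF x'(1) sub] by simp
  qed
qed

text \<open>The only candidate keeps the events of \<open>x\<close> over \<open>y\<close>. It is
  down-closed: a negative immediate cause stays because only positive events were dropped, and a
  positive one falls under courtesy, so that its image is in the down-closed
  \<open>y\<close>.\<close>

lemma pos_lifting_if_courteous:
  assumes cour: "courteous A S \<sigma>"
  shows pos_lifting
  unfolding pos_lifting_def
proof (intro ballI allI impI)
  fix x y assume x: "x \<in> configs S" and y: "(y, \<sigma> ` x) \<in> sub_pol Pos A"
  let ?x' = "{s \<in> x. \<sigma> s \<in> y}"
  have x': "?x' \<in> configs S"
  proof (rule configs_immediateI[OF source x])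
    fix e e' assume e: "e \<in> ?x'" and imm: "immediate_cause S e' e"
    then have leq: "(e', e) \<in> leq S" by (simp add: immediate_cause_def lt_def)
    have e'x: "e' \<in> x" using configsD(4)[OF x _ leq] e by simp
    have "\<sigma> e' \<in> y"
    proof (cases "pol S e'")
      case Neg
      then have "pol A (\<sigma> e') \<noteq> Pos" using map_pol_config[OF x e'x] by simp
      then show ?thesis using sub_polD(4)[OF y imageI[OF e'x]] by fast
    next
      case Pos
      then have "immediate_cause A (\<sigma> e') (\<sigma> e)"
        using cour imm leq_events[OF source leq] by (simp add: courteous_def)
      then show ?thesis
        using configsD(4)[OF sub_polD(1)[OF y], of "\<sigma> e" "\<sigma> e'"] e
        by (simp add: immediate_cause_def lt_def)
    qed
    then show "e' \<in> ?x'" using e'x by simp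
  qed simp
  have eq: "\<sigma> ` ?x' = y" using sub_polD(3)[OF y] by auto
  have "(?x', x) \<in> sub_pol Pos S"
    by (rule sub_pol_lift[OF x' x]) (simp_all only: eq y, simp)
  then show "\<exists>x'. (x', x) \<in> sub_pol Pos S \<and> \<sigma> ` x' = y" using eq by (intro exI conjI)
qed

text \<open>An event of the difference with the fewest causes has all its proper causes in
  \<open>x\<close>.\<close>

lemma ex_minimal_extension:
  assumes x: "x \<in> configs A" and y: "y \<in> configs A" and sub: "x \<subset> y"
  obtains a where "a \<in> y - x" "insert a x \<in> configs A"
proof -
  obtain b where "b \<in> y - x" using sub by blast
  then obtain a where a: "a \<in> y - x" and
    min: "\<And>b. b \<in> y - x \<Longrightarrow> card {e. (e, a) \<in> leq A} \<le> card {e. (e, b) \<in> leq A}"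
    using ex_has_least_nat[of "\<lambda>b. b \<in> y - x" b "\<lambda>d. card {e. (e, d) \<in> leq A}"] by blast
  have "insert a x \<in> configs A"
  proof (rule configs_subset[OF Con_subset[OF game] y])
    show "insert a x \<subseteq> y" using a sub by auto
    fix e e' assume e: "e \<in> insert a x" "(e', e) \<in> leq A"
    show "e' \<in> insert a x"
    proof (rule ccontr)
      assume e': "e' \<notin> insert a x"
      then have ea: "(e', a) \<in> leq A" "e' \<noteq> a" using e configsD(4)[OF x] by auto
      then have "e' \<in> y - x" using e' a configsD(4)[OF y] by blast
      then show False
        using min[of e'] card_principal_less[OF game, of e' a] ea by (auto simp: lt_def)
    qed
  qed
  with a show thesis using that by blast
qed

text \<open>Receptivity yields the next event of the extension uniquely, but uniqueness of one step
  does not give uniqueness of the whole: a rival could reach \<open>y\<close> in another order.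
  Courtesy excludes this.\<close>

lemma neg_lifting_if_courteous_receptive:
  assumes cour: "courteous A S \<sigma>" and rec: "receptive A S \<sigma>"
  shows neg_lifting
proof -
  \<comment> \<open>Existence and uniqueness go through the induction together: the extensions of
    \<open>x\<close> over \<open>y\<close> are shown to be exactly those of
    \<open>insert s x\<close>. Plain inclusion suffices here, since polarities are recovered from
    the images by \<open>sub_pol_lift\<close>.\<close>
  have ex_unique: "\<exists>!x'. x' \<in> configs S \<and> x \<subseteq> x' \<and> \<sigma> ` x' = y"
    if "x \<in> configs S" "(\<sigma> ` x, y) \<in> sub_pol Neg A" for x y
    using that
  proof (induction "card (y - \<sigma> ` x)" arbitrary: x rule: less_induct)
    case less
    note x = less.prems(1)
    note y = sub_polD(2)[OF less.prems(2)] and sub = sub_polD(3)[OF less.prems(2)]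
      and neg = sub_polD(4)[OF less.prems(2)]
    show ?case
    proof (cases "\<sigma> ` x = y")
      case True
      then have "x' = x" if "x' \<in> configs S \<and> x \<subseteq> x' \<and> \<sigma> ` x' = y" for x'
        using map_eqD[of x' x' x] that by simp
      then show ?thesis using True x by (intro ex1I[of _ x]) simp_all
    next
      case False
      then have "\<sigma> ` x \<subset> y" using sub by simp
      then obtain a where a: "a \<in> y - \<sigma> ` x" "insert a (\<sigma> ` x) \<in> configs A"
        by (rule ex_minimal_extension[OF map_config[OF x] y])
      have a_neg: "pol A a = Neg" using neg a(1) by simp
      moreover have "a \<in> events A" using a(1) configsD(2)[OF y] by blast
      moreover have "extends_by A (\<sigma> ` x) a" using a by (simp add: extends_by_def)
      ultimately have "\<exists>!s. s \<in> events S \<and> extends_by S x s \<and> \<sigma> s = a"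
        using rec[unfolded receptive_def, rule_format, OF x] by simp
      then obtain s where s: "s \<in> events S" "extends_by S x s" "\<sigma> s = a" and
        s_unique: "\<forall>s'. s' \<in> events S \<and> extends_by S x s' \<and> \<sigma> s' = a \<longrightarrow> s' = s"
        by (elim ex1E conjE) (rule that)
      have xs: "insert s x \<in> configs S" using s(2) by (simp add: extends_by_def)
      have "y - \<sigma> ` insert s x \<subset> y - \<sigma> ` x" using s(3) a by auto
      then have card: "card (y - \<sigma> ` insert s x) < card (y - \<sigma> ` x)"
        using psubset_card_mono[OF finite_Diff[OF configsD(1)[OF y]]] by simp
      have "(\<sigma> ` insert s x, y) \<in> sub_pol Neg A"
        by (rule sub_polI) (use map_config[OF xs] y s(3) a(1) sub neg in auto)
      from less.hyps[OF card xs this]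
      have IH: "\<exists>!x'. x' \<in> configs S \<and> insert s x \<subseteq> x' \<and> \<sigma> ` x' = y" .
      \<comment> \<open>The event of a rival \<open>x'\<close> over \<open>a\<close> is negative, so
        courtesy enables it already at \<open>x\<close>; receptivity then identifies it with
        \<open>s\<close>.\<close>
      have mem: "s \<in> x'" if x': "x' \<in> configs S" "x \<subseteq> x'" "\<sigma> ` x' = y" for x'
      proof -
        from a(1) x'(3) obtain s' where s': "s' \<in> x'" "\<sigma> s' = a" by blast
        have s'_neg: "pol S s' = Neg" using map_pol_config[OF x'(1) s'(1)] a_neg s'(2) by simp
        have "insert s' x \<in> configs S"
          using enabled_if_courteous[OF cour x x'(1,2) s'(1) s'_neg] s'(2) a(2) by simp
        moreover have "s' \<notin> x" using s'(2) a(1) by blast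
        ultimately have "extends_by S x s'" by (simp add: extends_by_def)
        moreover have "s' \<in> events S" using configsD(2)[OF x'(1)] s'(1) by blast
        ultimately have "s' = s" using s_unique s'(2) by blast
        then show ?thesis using s'(1) by simp
      qed
      have "x' \<in> configs S \<and> x \<subseteq> x' \<and> \<sigma> ` x' = y \<longleftrightarrow>
          x' \<in> configs S \<and> insert s x \<subseteq> x' \<and> \<sigma> ` x' = y" for x'
        using mem[of x'] by auto
      then show ?thesis using IH by simp
    qed
  qed
  show ?thesis
  proof (rule neg_liftingI)
    fix x y assume x: "x \<in> configs S" and y: "(\<sigma> ` x, y) \<in> sub_pol Neg A"
    from ex_unique[OF x y] obtain x' where x': "x' \<in> configs S" "x \<subseteq> x'" "\<sigma> ` x' = y" by (elim ex1E conjE)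
    have "(x, x') \<in> sub_pol Neg S" by (rule sub_pol_lift[OF x x'(1,2)]) (simp add: x' y)
    then show "\<exists>x'. (x, x') \<in> sub_pol Neg S \<and> \<sigma> ` x' = y" using x'(3) by (intro exI conjI)
  next
    fix x x' x''
    assume x': "(x, x') \<in> sub_pol Neg S" and x'': "(x, x'') \<in> sub_pol Neg S"
      and eq: "\<sigma> ` x' = \<sigma> ` x''"
    have "x' \<in> configs S \<and> x \<subseteq> x' \<and> \<sigma> ` x' = \<sigma> ` x'"
      "x'' \<in> configs S \<and> x \<subseteq> x'' \<and> \<sigma> ` x'' = \<sigma> ` x'"
      using sub_polD(2,3)[OF x'] sub_polD(2,3)[OF x''] eq by simp_all
    with ex_unique[OF sub_polD(1)[OF x'] map_sub_pol[OF x']] show "x' = x''" by (rule ex1_unique)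
  qed
qed

text \<open>Lift the extension by the single event \<open>a\<close>. By injectivity the lift adds
  exactly one event to \<open>x\<close>, and any other choice over \<open>a\<close> gives a second
  lift.\<close>

lemma receptive_if_neg_lifting:
  assumes neg: neg_lifting
  shows "receptive A S \<sigma>"
  unfolding receptive_def
proof (intro ballI impI, elim conjE)
  fix x a assume x: "x \<in> configs S" and a: "a \<in> events A" "pol A a = Neg" "extends_by A (\<sigma> ` x) a"
  then have y: "(\<sigma> ` x, insert a (\<sigma> ` x)) \<in> sub_pol Neg A"
    by (intro sub_polI) (auto simp: extends_by_def map_config)
  obtain x' where x': "(x, x') \<in> sub_pol Neg S" "\<sigma> ` x' = insert a (\<sigma> ` x)"
    by (rule neg_lifting_ex[OF neg x y])
  note x'c = sub_polD(2)[OF x'(1)] and sub = sub_polD(3)[OF x'(1)]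
  have "a \<in> \<sigma> ` x'" by (simp add: x'(2))
  then obtain s where s: "s \<in> x'" "\<sigma> s = a" by blast
  have "insert s x = x'"
    using map_eqD[OF x'c _ subset_refl, of "insert s x"] s sub x'(2) by simp
  moreover have "s \<notin> x" using s(2) a(3) by (auto simp: extends_by_def)
  ultimately have ext: "extends_by S x s" using x'c by (simp add: extends_by_def)
  have unique: "s' = s" if s': "extends_by S x s'" "\<sigma> s' = a" for s'
  proof -
    have "insert s' x \<in> configs S" using s'(1) by (simp add: extends_by_def)
    then have "(x, insert s' x) \<in> sub_pol Neg S"
      by (rule sub_pol_lift[OF x]) (use s'(2) y in auto)
    then have "insert s' x = x'"
      by (rule neg_lifting_unique[OF neg _ x'(1)]) (simp add: x'(2) s'(2))
    then show ?thesis using inj_onD[OF map_inj[OF x'c], of s' s] s s'(2) by auto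
  qed
  show "\<exists>!s. s \<in> events S \<and> extends_by S x s \<and> \<sigma> s = a"
  proof (rule ex1I)
    show "s \<in> events S \<and> extends_by S x s \<and> \<sigma> s = a"
      using ext s(2) subsetD[OF configsD(2)[OF x'c] s(1)] by simp
    show "s' = s" if "s' \<in> events S \<and> extends_by S x s' \<and> \<sigma> s' = a" for s'
      using that by (intro unique) simp_all
  qed
qed

text \<open>Suppose \<sigma> s is not below \<sigma> s'. Above \<open>s\<close> the causes of
  \<open>s'\<close> contain only \<open>s\<close> and \<open>s'\<close>, so \<sigma> s is maximal in
  their image and can be removed from it. Lifting turns this into a configuration with
  \<open>s'\<close> but without its cause \<open>s\<close>.\<close>

lemma courteous_if_lifting:
  assumes neg: neg_lifting and pos: pos_lifting
  shows "courteous A S \<sigma>"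
  unfolding courteous_def
proof (intro ballI impI, elim conjE)
  fix s s' assume ev: "s \<in> events S" "s' \<in> events S" and imm: "immediate_cause S s s'"
    and not_neg_pos: "(pol S s, pol S s') \<noteq> (Neg, Pos)"
  let ?x = "{e. (e, s') \<in> leq S}"
  have x: "?x \<in> configs S" by (rule principal_config[OF source ev(2)])
  have ss': "(s, s') \<in> leq S" "s \<noteq> s'" using imm by (auto simp: immediate_cause_def lt_def)
  have mem: "s \<in> ?x" "s' \<in> ?x" using ss' leq_refl[OF source ev(2)] by auto
  have above: "e = s \<or> e = s'" if "(s, e) \<in> leq S" "(e, s') \<in> leq S" for e
    using imm that unfolding immediate_cause_def lt_def by blast
  have xA: "\<sigma> ` ?x \<in> configs A" by (rule map_config[OF x])
  have leq: "(\<sigma> s, \<sigma> s') \<in> leq A"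
  proof (rule ccontr)
    assume nleq: "(\<sigma> s, \<sigma> s') \<notin> leq A"
    have topA: "a = \<sigma> s" if "a \<in> \<sigma> ` ?x" "(\<sigma> s, a) \<in> leq A" for a
    proof -
      from that(1) obtain e where e: "e \<in> ?x" "a = \<sigma> e" by blast
      then have "(s, e) \<in> leq S" using map_leq_reflect[OF x mem(1) e(1)] that(2) by simp
      then show ?thesis using above[of e] e nleq that(2) by auto
    qed
    have w: "\<sigma> ` (?x - {s}) \<in> configs A"
    proof (rule configs_subset[OF Con_subset[OF game] xA])
      fix e e' assume e: "e \<in> \<sigma> ` (?x - {s})" "(e', e) \<in> leq A"
      then have "e' \<in> \<sigma> ` ?x" using configsD(4)[OF xA] by blast
      moreover have "\<sigma> s \<notin> \<sigma> ` (?x - {s})"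
        using map_mem_iff[OF x _ mem(1), of "?x - {s}"] by blast
      then have "e' \<noteq> \<sigma> s" using topA[of e] e by blast
      ultimately show "e' \<in> \<sigma> ` (?x - {s})" by blast
    qed auto
    have no_sub: False if "u \<in> configs S" "u \<subseteq> ?x" "s' \<in> u" "s \<notin> u" for u
      using configsD(4)[OF that(1,3) ss'(1)] that(4) by blast
    show False
    proof (cases "pol S s")
      case Pos
      have "(\<sigma> ` (?x - {s}), \<sigma> ` ?x) \<in> sub_pol Pos A"
        by (rule sub_polI) (use w xA map_pol[OF ev(1)] Pos in auto)
      then obtain u where u: "(u, ?x) \<in> sub_pol Pos S" "\<sigma> ` u = \<sigma> ` (?x - {s})"
        by (rule pos_lifting_ex[OF pos x])
      have "u = ?x - {s}" by (rule map_eqD[OF x sub_polD(3)[OF u(1)] Diff_subset u(2)])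
      then show False using no_sub[OF sub_polD(1,3)[OF u(1)]] mem ss'(2) by blast
    next
      case Neg
      then have Neg': "pol S s' = Neg" using not_neg_pos polarity.exhaust by auto
      \<comment> \<open>With \<open>s\<close> negative, \<open>pos_lifting\<close> cannot remove it.
        As \<open>s'\<close> is now negative too, both are removed and re-added by negative lifting
        in the opposite order, first over \<sigma> s' and then over \<sigma> s.\<close>
      let ?v = "?x - {s, s'}"
      have v: "?v \<in> configs S"
      proof (rule configs_subset[OF Con_subset[OF source] x])
        fix e e' assume e: "e \<in> ?v" "(e', e) \<in> leq S"
        have "e' \<noteq> s" using above[of e] e by auto
        moreover have "e' \<noteq> s'" using leq_antisym[OF source, of e s'] e by auto
        ultimately show "e' \<in> ?v" using e leq_trans[OF source e(2)] by simp
      qed auto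
      have vx: "(\<sigma> ` ?v, \<sigma> ` (?x - {s})) \<in> sub_pol Neg A"
        by (rule sub_polI) (use map_config[OF v] w map_pol[OF ev(2)] Neg' in auto)
      obtain u where u: "(?v, u) \<in> sub_pol Neg S" "\<sigma> ` u = \<sigma> ` (?x - {s})"
        by (rule neg_lifting_ex[OF neg v vx])
      note uc = sub_polD(2)[OF u(1)]
      have ux: "(\<sigma> ` u, \<sigma> ` ?x) \<in> sub_pol Neg A"
        unfolding u(2) by (rule sub_polI) (use w xA map_pol[OF ev(1)] Neg in auto)
      obtain u' where u': "(u, u') \<in> sub_pol Neg S" "\<sigma> ` u' = \<sigma> ` ?x"
        by (rule neg_lifting_ex[OF neg uc ux])
      have "(?v, u') \<in> sub_pol Neg S"
        using sub_pol_partial_order[of S Neg] u(1) u'(1)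
        unfolding partial_order_on_def preorder_on_def by (blast dest: transD)
      moreover have "(?v, ?x) \<in> sub_pol Neg S"
        by (rule sub_polI) (use v x Neg Neg' in auto)
      \<comment> \<open>Uniqueness forces the reordered extension to end in \<open>?x\<close>, so
        the intermediate \<open>u\<close> is \<open>?x\<close> without \<open>s\<close>, which is
        not down-closed.\<close>
      ultimately have "u' = ?x" using u'(2) by (rule neg_lifting_unique[OF neg])
      then have sub: "u \<subseteq> ?x" using sub_polD(3)[OF u'(1)] by simp
      have "u = ?x - {s}" by (rule map_eqD[OF x sub Diff_subset u(2)])
      then show False using no_sub[of u] uc mem ss'(2) by auto
    qed
  qed
  moreover have "\<sigma> s \<noteq> \<sigma> s'" using inj_onD[OF map_inj[OF x] _ mem] ss'(2) by blast
  moreover have False if "lt A (\<sigma> s) b" "lt A b (\<sigma> s')" for b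
  proof -
    from that have "b \<in> \<sigma> ` ?x"
      using configsD(4)[OF xA, of "\<sigma> s'" b] mem by (auto simp: lt_def)
    then obtain e where e: "e \<in> ?x" "b = \<sigma> e" by blast
    then have "(s, e) \<in> leq S" using map_leq_reflect[OF x mem(1) e(1)] that by (simp add: lt_def)
    then show False using above[of e] e that by (auto simp: lt_def)
  qed
  ultimately show "immediate_cause A (\<sigma> s) (\<sigma> s')"
    unfolding immediate_cause_def by (auto simp: lt_def)
qed

end


section \<open>Isomorphisms from configurations\<close>

text \<open>The existence of least configurations replaces the sets of causes and is phrased by
  configurations alone, the form in which the composite is known.\<close>

definition has_principals :: "('e, 'z) es_scheme \<Rightarrow> bool" where
  "has_principals E \<longleftrightarrow>
     (\<forall>e\<in>events E. \<exists>x\<in>configs E. e \<in> x \<and> (\<forall>x'\<in>configs E. e \<in> x' \<longrightarrow> x \<subseteq> x'))"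

lemma event_structure_has_principals: "event_structure E \<Longrightarrow> has_principals E"
  unfolding has_principals_def
proof
  fix e assume E: "event_structure E" and e: "e \<in> events E"
  show "\<exists>x\<in>configs E. e \<in> x \<and> (\<forall>x'\<in>configs E. e \<in> x' \<longrightarrow> x \<subseteq> x')"
  proof (intro bexI[OF _ principal_config[OF E e]] conjI ballI impI subsetI)
    show "e \<in> {e'. (e', e) \<in> leq E}" using leq_refl[OF E e] by simp
    show "e' \<in> x'" if "x' \<in> configs E" "e \<in> x'" "e' \<in> {e'. (e', e) \<in> leq E}" for x' e'
      using configsD(4)[OF that(1,2)] that(3) by simp
  qed
qed

text \<open>The value at \<open>e\<close> is the event over \<sigma> e in the configuration related
  to the least one containing \<open>e\<close>; monotonicity places it in every configuration
  related to one containing \<open>e\<close>. The image of \<open>x\<close> is then a subset of the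
  related \<open>y\<close> with the same image under \<open>\<tau>\<close>, hence all of
  \<open>y\<close>.\<close>

lemma map_of_config_relation:
  fixes E :: "('e, 'z) es_scheme" and F :: "('f, 'y) es_scheme"
    and \<sigma> :: "'e \<Rightarrow> 'a" and \<tau> :: "'f \<Rightarrow> 'a"
  assumes princ: "has_principals E"
    and inj: "\<And>x. x \<in> configs E \<Longrightarrow> inj_on \<sigma> x" "\<And>y. y \<in> configs F \<Longrightarrow> inj_on \<tau> y"
    and dom: "\<And>x y. R x y \<Longrightarrow> y \<in> configs F"
    and total: "\<And>x. x \<in> configs E \<Longrightarrow> \<exists>y. R x y"
    and mono: "\<And>x y x' y'. R x y \<Longrightarrow> R x' y' \<Longrightarrow> x \<subseteq> x' \<Longrightarrow> y \<subseteq> y'"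
    and img: "\<And>x y. R x y \<Longrightarrow> \<tau> ` y = \<sigma> ` x"
  obtains \<phi> where "es_map E F \<phi>" "\<And>e. e \<in> events E \<Longrightarrow> \<tau> (\<phi> e) = \<sigma> e"
    "\<And>x y e. x \<in> configs E \<Longrightarrow> R x y \<Longrightarrow> e \<in> x \<Longrightarrow> \<phi> e \<in> y"
proof -
  have "\<exists>f. \<tau> f = \<sigma> e \<and> (\<forall>x y. x \<in> configs E \<longrightarrow> R x y \<longrightarrow> e \<in> x \<longrightarrow> f \<in> y)"
    if e: "e \<in> events E" for e
  proof -
    from princ[unfolded has_principals_def, rule_format, OF e] obtain p where
      p: "p \<in> configs E" "e \<in> p" and least: "\<And>x'. x' \<in> configs E \<Longrightarrow> e \<in> x' \<Longrightarrow> p \<subseteq> x'" by auto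
    from total[OF p(1)] obtain q where q: "R p q" by auto
    have "\<sigma> e \<in> \<tau> ` q" using img[OF q] p(2) by simp
    then obtain f where f: "f \<in> q" "\<tau> f = \<sigma> e" by auto
    have "f \<in> y" if "x \<in> configs E" "R x y" "e \<in> x" for x y
      using mono[OF q that(2) least[OF that(1,3)]] f(1) by auto
    with f(2) show ?thesis by (intro exI[of _ f]) simp
  qed
  then have "\<forall>e\<in>events E. \<exists>f. \<tau> f = \<sigma> e \<and> (\<forall>x y. x \<in> configs E \<longrightarrow> R x y \<longrightarrow> e \<in> x \<longrightarrow> f \<in> y)"
    by simp
  from bchoice[OF this] obtain \<phi> where
    \<phi>: "\<And>e. e \<in> events E \<Longrightarrow> \<tau> (\<phi> e) = \<sigma> e"
    "\<And>e x y. e \<in> events E \<Longrightarrow> x \<in> configs E \<Longrightarrow> R x y \<Longrightarrow> e \<in> x \<Longrightarrow> \<phi> e \<in> y"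
    by auto
  have mem: "\<phi> e \<in> y" if "x \<in> configs E" "R x y" "e \<in> x" for x y e
    using \<phi>(2)[OF _ that] configsD(2)[OF that(1)] that(3) by auto
  have \<sigma>\<phi>: "(\<lambda>e. \<tau> (\<phi> e)) ` x = \<sigma> ` x" if "x \<in> configs E" for x
    by (rule image_cong[OF refl]) (use \<phi>(1) configsD(2)[OF that] in auto)
  have "es_map E F \<phi>"
    unfolding es_map_def
  proof (intro conjI ballI)
    show "\<phi> ` events E \<subseteq> events F"
    proof
      fix f assume "f \<in> \<phi> ` events E"
      then obtain e where e: "e \<in> events E" "f = \<phi> e" by auto
      from princ[unfolded has_principals_def, rule_format, OF e(1)] obtain p where
        p: "p \<in> configs E" "e \<in> p" by auto
      from total[OF p(1)] obtain q where q: "R p q" by auto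
      show "f \<in> events F"
        using mem[OF p(1) q p(2)] configsD(2)[OF dom[OF q]] e(2) by auto
    qed
    fix x assume x: "x \<in> configs E"
    from total[OF x] obtain y where y: "R x y" by auto
    have sub: "\<phi> ` x \<subseteq> y" using mem[OF x y] by auto
    have "\<tau> ` \<phi> ` x = \<tau> ` y" using \<sigma>\<phi>[OF x] img[OF y] by (simp add: image_image)
    then have "\<phi> ` x = y"
      using inj_on_image_eq_iff[OF inj(2)[OF dom[OF y]] sub subset_refl] by simp
    then show "\<phi> ` x \<in> configs F" using dom[OF y] by simp
    show "inj_on \<phi> x"
    proof (rule inj_onI)
      fix a b assume ab: "a \<in> x" "b \<in> x" "\<phi> a = \<phi> b"
      then have "\<sigma> a = \<sigma> b"
        using \<phi>(1)[OF subsetD[OF configsD(2)[OF x] ab(1)]]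
          \<phi>(1)[OF subsetD[OF configsD(2)[OF x] ab(2)]] by simp
      then show "a = b" using inj_onD[OF inj(1)[OF x]] ab by auto
    qed
  qed
  then show thesis using \<phi>(1) mem by (rule that)
qed

text \<open>The construction is applied in both directions. The round trip of an event stays in a
  configuration containing that event and over the same point, so injectivity makes it the identity.
  Polarities agree because both are read off the common target through \<open>\<pi>\<close>.\<close>

lemma pre_strategy_iso_of_config_relation:
  fixes E :: "'e esp" and F :: "'f esp" and \<sigma> :: "'e \<Rightarrow> 'a" and \<tau> :: "'f \<Rightarrow> 'a"
  assumes princ: "has_principals E" "has_principals F"
    and inj: "\<And>x. x \<in> configs E \<Longrightarrow> inj_on \<sigma> x" "\<And>y. y \<in> configs F \<Longrightarrow> inj_on \<tau> y"
    and pol: "\<And>e. e \<in> events E \<Longrightarrow> pol E e = \<pi> (\<sigma> e)" "\<And>f. f \<in> events F \<Longrightarrow> pol F f = \<pi> (\<tau> f)"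
    and dom: "\<And>x y. R x y \<Longrightarrow> x \<in> configs E \<and> y \<in> configs F"
    and total: "\<And>x. x \<in> configs E \<Longrightarrow> \<exists>y. R x y" "\<And>y. y \<in> configs F \<Longrightarrow> \<exists>x. R x y"
    and order: "\<And>x y x' y'. R x y \<Longrightarrow> R x' y' \<Longrightarrow> x \<subseteq> x' \<longleftrightarrow> y \<subseteq> y'"
    and img: "\<And>x y. R x y \<Longrightarrow> \<tau> ` y = \<sigma> ` x"
  shows "pre_strategy_iso E \<sigma> F \<tau>"
proof -
  obtain \<phi> where \<phi>: "es_map E F \<phi>" "\<And>e. e \<in> events E \<Longrightarrow> \<tau> (\<phi> e) = \<sigma> e"
    "\<And>x y e. x \<in> configs E \<Longrightarrow> R x y \<Longrightarrow> e \<in> x \<Longrightarrow> \<phi> e \<in> y"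
    by (rule map_of_config_relation[of E \<sigma> F \<tau> R])
      (simp_all add: princ inj dom total order img)
  obtain \<psi> where \<psi>: "es_map F E \<psi>" "\<And>f. f \<in> events F \<Longrightarrow> \<sigma> (\<psi> f) = \<tau> f"
    "\<And>y x f. y \<in> configs F \<Longrightarrow> R x y \<Longrightarrow> f \<in> y \<Longrightarrow> \<psi> f \<in> x"
    by (rule map_of_config_relation[of F \<tau> E \<sigma> "\<lambda>y x. R x y"])
      (simp_all add: princ inj dom total order[symmetric] img)
  have \<phi>_ev: "\<phi> e \<in> events F" if "e \<in> events E" for e using \<phi>(1) that by (auto simp: es_map_def)
  have \<psi>_ev: "\<psi> f \<in> events E" if "f \<in> events F" for f using \<psi>(1) that by (auto simp: es_map_def)
  have "\<psi> (\<phi> e) = e" if e: "e \<in> events E" for e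
  proof -
    from princ(1)[unfolded has_principals_def, rule_format, OF e] obtain p where
      p: "p \<in> configs E" "e \<in> p" by auto
    from total(1)[OF p(1)] obtain q where q: "R p q" by auto
    have "\<psi> (\<phi> e) \<in> p" using \<psi>(3)[OF _ q \<phi>(3)[OF p(1) q p(2)]] dom[OF q] by simp
    moreover have "\<sigma> (\<psi> (\<phi> e)) = \<sigma> e" using \<psi>(2)[OF \<phi>_ev[OF e]] \<phi>(2)[OF e] by simp
    ultimately show ?thesis using inj_onD[OF inj(1)[OF p(1)]] p(2) by simp
  qed
  moreover have "\<phi> (\<psi> f) = f" if f: "f \<in> events F" for f
  proof -
    from princ(2)[unfolded has_principals_def, rule_format, OF f] obtain q where
      q: "q \<in> configs F" "f \<in> q" by auto
    from total(2)[OF q(1)] obtain p where p: "R p q" by auto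
    have "\<phi> (\<psi> f) \<in> q" using \<phi>(3)[OF _ p \<psi>(3)[OF q(1) p q(2)]] dom[OF p] by simp
    moreover have "\<tau> (\<phi> (\<psi> f)) = \<tau> f" using \<phi>(2)[OF \<psi>_ev[OF f]] \<psi>(2)[OF f] by simp
    ultimately show ?thesis using inj_onD[OF inj(2)[OF q(1)]] q(2) by simp
  qed
  moreover have "esp_map E F \<phi>" using \<phi>(1,2) \<phi>_ev pol by (simp add: esp_map_def)
  moreover have "esp_map F E \<psi>" using \<psi>(1,2) \<psi>_ev pol by (simp add: esp_map_def)
  ultimately have "esp_iso E F \<phi>" unfolding esp_iso_def by auto
  then show ?thesis using \<phi>(2) unfolding pre_strategy_iso_def by (intro exI[of _ \<phi>]) simp
qed


section \<open>Secured bijections\<close>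

lemma graph_order_subset: "graph_order S T \<theta> \<subseteq> \<theta> \<times> \<theta>"
proof -
  have "{(p, p'). p \<in> \<theta> \<and> p' \<in> \<theta> \<and> (lt S (fst p) (fst p') \<or> lt T (snd p) (snd p'))}\<^sup>+ \<subseteq> \<theta> \<times> \<theta>"
    by (rule trancl_subset_Sigma) auto
  then show ?thesis unfolding graph_order_def by (auto simp: Id_on_def)
qed

lemma graph_order_refl: "p \<in> \<theta> \<Longrightarrow> (p, p) \<in> graph_order S T \<theta>"
  by (simp add: graph_order_def Id_onI)

lemma graph_order_trans:
  "(p, q) \<in> graph_order S T \<theta> \<Longrightarrow> (q, r) \<in> graph_order S T \<theta> \<Longrightarrow> (p, r) \<in> graph_order S T \<theta>"
  unfolding graph_order_def by (auto dest: trancl_trans)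

lemma graph_order_step:
  "p \<in> \<theta> \<Longrightarrow> p' \<in> \<theta> \<Longrightarrow> lt S (fst p) (fst p') \<or> lt T (snd p) (snd p') \<Longrightarrow>
    (p, p') \<in> graph_order S T \<theta>"
  unfolding graph_order_def by (intro UnI2 r_into_trancl) simp

lemma graph_order_mono:
  assumes "\<theta> \<subseteq> \<theta>'"
  shows "graph_order S T \<theta> \<subseteq> graph_order S T \<theta>'"
  unfolding graph_order_def using assms by (intro Un_mono trancl_mono_subset) (auto simp: Id_on_def)

lemma secured_iff: "secured S T \<theta> \<longleftrightarrow> antisym (graph_order S T \<theta>)"
  unfolding secured_def partial_order_on_def preorder_on_def refl_on_def
  using graph_order_subset graph_order_refl by (auto intro!: transI dest: graph_order_trans)

text \<open>A chain is followed backwards from its end in \<open>\<theta>'\<close>; closure under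
  single causes keeps each predecessor inside, so the chain already exists in
  \<open>\<theta>'\<close>.\<close>

lemma graph_order_downward:
  assumes closed: "\<And>p p'. p \<in> \<theta>' \<Longrightarrow> p' \<in> \<theta> \<Longrightarrow>
      lt S (fst p') (fst p) \<or> lt T (snd p') (snd p) \<Longrightarrow> p' \<in> \<theta>'"
    and "(p', p) \<in> graph_order S T \<theta>" "p \<in> \<theta>'"
  shows "(p', p) \<in> graph_order S T \<theta>'"
proof -
  have "p' = p \<or> (p', p) \<in> {(p, p'). p \<in> \<theta> \<and> p' \<in> \<theta> \<and> (lt S (fst p) (fst p') \<or> lt T (snd p) (snd p'))}\<^sup>+"
    using assms(2) unfolding graph_order_def by (auto simp: Id_on_def)
  then show ?thesis
  proof
    assume "p' = p"
    then show ?thesis using assms(3) graph_order_refl by simp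
  next
    assume "(p', p) \<in> {(p, p'). p \<in> \<theta> \<and> p' \<in> \<theta> \<and> (lt S (fst p) (fst p') \<or> lt T (snd p) (snd p'))}\<^sup>+"
    then have "p' \<in> \<theta>' \<and> (p', p) \<in> graph_order S T \<theta>'"
    proof (induction rule: converse_trancl_induct)
      case (base q)
      then have "q \<in> \<theta>'" using closed[OF assms(3)] by simp
      then show ?case using base assms(3) by (auto intro: graph_order_step)
    next
      case (step q r)
      then have "q \<in> \<theta>'" using closed[of r q] by simp
      then have "(q, r) \<in> graph_order S T \<theta>'" using step by (auto intro: graph_order_step)
      then show ?case using \<open>q \<in> \<theta>'\<close> step.IH graph_order_trans[of q r S T \<theta>' p] by simp
    qed
    then show ?thesis by simp
  qed
qed

lemma is_greatest_unique:
  assumes "secured S T \<theta>" "is_greatest S T \<theta> p" "is_greatest S T \<theta> q"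
  shows "p = q"
  using assms unfolding is_greatest_def secured_iff by (meson antisymD)

lemma the_greatest:
  assumes "secured S T \<theta>" "is_greatest S T \<theta> p"
  shows "(THE p. is_greatest S T \<theta> p) = p"
  using assms(2) is_greatest_unique[OF assms(1) _ assms(2)] by (rule the_equality)

text \<open>Heredity of consistency and injectivity on configurations are what the calculus of
  secured bijections rests on; both are checked directly for copycat later.\<close>

locale locally_injective_pair =
  fixes S :: "('s, 'y) es_scheme" and \<sigma> :: "'s \<Rightarrow> 'a"
    and T :: "('t, 'z) es_scheme" and \<tau> :: "'t \<Rightarrow> 'a"
  assumes hereditary: "\<And>X Y. X \<in> Con S \<Longrightarrow> Y \<subseteq> X \<Longrightarrow> Y \<in> Con S"
      "\<And>X Y. X \<in> Con T \<Longrightarrow> Y \<subseteq> X \<Longrightarrow> Y \<in> Con T"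
    and inj: "\<And>x. x \<in> configs S \<Longrightarrow> inj_on \<sigma> x" "\<And>y. y \<in> configs T \<Longrightarrow> inj_on \<tau> y"
begin

abbreviation "B \<equiv> secured_bijections S \<sigma> T \<tau>"

lemma B_cases:
  assumes "\<theta> \<in> B"
  obtains x y where "\<theta> = induced_graph \<sigma> \<tau> x y" "x \<in> configs S" "y \<in> configs T" "\<sigma> ` x = \<tau> ` y"
    "secured S T \<theta>"
  using assms unfolding secured_bijections_def by auto

lemma B_secured: "\<theta> \<in> B \<Longrightarrow> secured S T \<theta>"
  by (erule B_cases) simp

lemma B_single_valued:
  assumes "\<theta> \<in> B" "p \<in> \<theta>" "q \<in> \<theta>" "fst p = fst q \<or> snd p = snd q"
  shows "p = q"
proof -
  from assms(1) obtain x y where \<theta>: "\<theta> = induced_graph \<sigma> \<tau> x y" "x \<in> configs S" "y \<in> configs T"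
    by (rule B_cases)
  have mem: "fst p \<in> x" "snd p \<in> y" "\<sigma> (fst p) = \<tau> (snd p)"
    "fst q \<in> x" "snd q \<in> y" "\<sigma> (fst q) = \<tau> (snd q)"
    using assms(2,3) \<theta>(1) by (auto simp: induced_graph_def)
  have "\<sigma> (fst p) = \<sigma> (fst q)" "\<tau> (snd p) = \<tau> (snd q)" using assms(4) mem by auto
  then have "fst p = fst q" "snd p = snd q"
    using inj_onD[OF inj(1)[OF \<theta>(2)]] inj_onD[OF inj(2)[OF \<theta>(3)]] mem by auto
  then show ?thesis by (rule prod_eqI)
qed

text \<open>The component of \<open>p'\<close> that is a cause lies in a configuration inducing
  \<open>\<theta>'\<close>, so it has a partner there. In the larger bijection
  \<open>\<theta>\<close> a component determines its pair, so this pair is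
  \<open>p'\<close>.\<close>

lemma B_downward_closed:
  assumes "\<theta>' \<in> B" "\<theta> \<in> B" "\<theta>' \<subseteq> \<theta>" "p \<in> \<theta>'" "p' \<in> \<theta>"
    and "lt S (fst p') (fst p) \<or> lt T (snd p') (snd p)"
  shows "p' \<in> \<theta>'"
proof -
  from assms(1) obtain x y where \<theta>': "\<theta>' = induced_graph \<sigma> \<tau> x y" "x \<in> configs S" "y \<in> configs T"
    "\<sigma> ` x = \<tau> ` y"
    by (rule B_cases)
  have p: "fst p \<in> x" "snd p \<in> y" using assms(4) \<theta>'(1) by (auto simp: induced_graph_def)
  have "\<exists>q\<in>\<theta>'. fst q = fst p' \<or> snd q = snd p'"
    using assms(6)
  proof
    assume "lt S (fst p') (fst p)"
    then have s: "fst p' \<in> x" using configsD(4)[OF \<theta>'(2) p(1)] by (simp add: lt_def)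
    then have "\<sigma> (fst p') \<in> \<tau> ` y" using \<theta>'(4) by auto
    then obtain t where "t \<in> y" "\<sigma> (fst p') = \<tau> t" by auto
    then have "(fst p', t) \<in> \<theta>'" using s \<theta>'(1) by (simp add: induced_graph_def)
    then show ?thesis by (rule bexI[rotated]) simp
  next
    assume "lt T (snd p') (snd p)"
    then have t: "snd p' \<in> y" using configsD(4)[OF \<theta>'(3) p(2)] by (simp add: lt_def)
    then have "\<tau> (snd p') \<in> \<sigma> ` x" using \<theta>'(4) by auto
    then obtain s where "s \<in> x" "\<tau> (snd p') = \<sigma> s" by auto
    then have "(s, snd p') \<in> \<theta>'" using t \<theta>'(1) by (simp add: induced_graph_def)
    then show ?thesis by (rule bexI[rotated]) simp
  qed
  then obtain q where q: "q \<in> \<theta>'" "fst q = fst p' \<or> snd q = snd p'" by auto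
  have "q = p'" by (rule B_single_valued[OF assms(2) subsetD[OF assms(3) q(1)] assms(5) q(2)])
  then show ?thesis using q(1) by simp
qed

lemma B_graph_order:
  assumes "\<theta>' \<in> B" "\<theta> \<in> B" "\<theta>' \<subseteq> \<theta>" "p \<in> \<theta>'" "(p', p) \<in> graph_order S T \<theta>"
  shows "(p', p) \<in> graph_order S T \<theta>'"
  by (rule graph_order_downward[OF B_downward_closed[OF assms(1-3)] assms(5,4)])

text \<open>Closure under the steps of either side makes both projections down-closed, hence
  configurations; security passes to subsets because the generated order only shrinks.\<close>

lemma B_subset:
  assumes "\<theta> \<in> B" "\<theta>' \<subseteq> \<theta>"
    and closed: "\<And>p p'. p \<in> \<theta>' \<Longrightarrow> p' \<in> \<theta> \<Longrightarrow>
      lt S (fst p') (fst p) \<or> lt T (snd p') (snd p) \<Longrightarrow> p' \<in> \<theta>'"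
  shows "\<theta>' \<in> B"
proof -
  from assms(1) obtain x y where \<theta>: "\<theta> = induced_graph \<sigma> \<tau> x y" "x \<in> configs S" "y \<in> configs T"
    "\<sigma> ` x = \<tau> ` y" "secured S T \<theta>"
    by (rule B_cases)
  have \<theta>_mem: "p \<in> \<theta> \<longleftrightarrow> fst p \<in> x \<and> snd p \<in> y \<and> \<sigma> (fst p) = \<tau> (snd p)" for p
    using \<theta>(1) by (auto simp: induced_graph_def)
  have eq: "\<theta>' = induced_graph \<sigma> \<tau> (fst ` \<theta>') (snd ` \<theta>')"
  proof (rule set_eqI)
    fix p
    show "p \<in> \<theta>' \<longleftrightarrow> p \<in> induced_graph \<sigma> \<tau> (fst ` \<theta>') (snd ` \<theta>')"
    proof
      assume p: "p \<in> \<theta>'"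
      then have "\<sigma> (fst p) = \<tau> (snd p)" using subsetD[OF assms(2) p] \<theta>_mem[of p] by simp
      then show "p \<in> induced_graph \<sigma> \<tau> (fst ` \<theta>') (snd ` \<theta>')"
        using imageI[OF p, of fst] imageI[OF p, of snd] unfolding induced_graph_def by (cases p) simp
    next
      assume "p \<in> induced_graph \<sigma> \<tau> (fst ` \<theta>') (snd ` \<theta>')"
      then have p: "fst p \<in> fst ` \<theta>'" "snd p \<in> snd ` \<theta>'" "\<sigma> (fst p) = \<tau> (snd p)"
        unfolding induced_graph_def by (cases p; simp)+
      from p(1) obtain q where q: "q \<in> \<theta>'" "fst p = fst q" by auto
      from p(2) obtain r where r: "r \<in> \<theta>'" "snd p = snd r" by auto
      have "p \<in> \<theta>"
        using subsetD[OF assms(2) q(1)] subsetD[OF assms(2) r(1)] q(2) r(2) p(3)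
          \<theta>_mem[of p] \<theta>_mem[of q] \<theta>_mem[of r] by simp
      then have "p = q"
        using B_single_valued[OF assms(1) _ subsetD[OF assms(2) q(1)], of p] q(2) by simp
      then show "p \<in> \<theta>'" using q(1) by simp
    qed
  qed
  have fst_config: "fst ` \<theta>' \<in> configs S"
  proof (rule configs_subset[OF hereditary(1) \<theta>(2)])
    show "fst ` \<theta>' \<subseteq> x" using \<theta>_mem subsetD[OF assms(2)] by (intro image_subsetI) simp
    fix s s' assume "s \<in> fst ` \<theta>'" and leq: "(s', s) \<in> leq S"
    then obtain p where p: "p \<in> \<theta>'" "s = fst p" by auto
    then have "p \<in> \<theta>" using assms(2) by auto
    then have "s' \<in> x" using configsD(4)[OF \<theta>(2) _ leq] p(2) \<theta>_mem[of p] by simp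
    then have "\<sigma> s' \<in> \<tau> ` y" using \<theta>(4) by auto
    then obtain t where "t \<in> y" "\<sigma> s' = \<tau> t" by auto
    then have st: "(s', t) \<in> \<theta>" using \<open>s' \<in> x\<close> \<theta>_mem[of "(s', t)"] by simp
    show "s' \<in> fst ` \<theta>'"
    proof (cases "s' = s")
      case False
      then have "(s', t) \<in> \<theta>'" using closed[OF p(1) st] leq p(2) by (simp add: lt_def)
      then show ?thesis by force
    qed (use p in simp)
  qed simp_all
  have snd_config: "snd ` \<theta>' \<in> configs T"
  proof (rule configs_subset[OF hereditary(2) \<theta>(3)])
    show "snd ` \<theta>' \<subseteq> y" using \<theta>_mem subsetD[OF assms(2)] by (intro image_subsetI) simp
    fix t t' assume "t \<in> snd ` \<theta>'" and leq: "(t', t) \<in> leq T"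
    then obtain p where p: "p \<in> \<theta>'" "t = snd p" by auto
    then have "p \<in> \<theta>" using assms(2) by auto
    then have "t' \<in> y" using configsD(4)[OF \<theta>(3) _ leq] p(2) \<theta>_mem[of p] by simp
    then have "\<tau> t' \<in> \<sigma> ` x" using \<theta>(4) by auto
    then obtain s where "s \<in> x" "\<tau> t' = \<sigma> s" by auto
    then have st: "(s, t') \<in> \<theta>" using \<open>t' \<in> y\<close> \<theta>_mem[of "(s, t')"] by simp
    show "t' \<in> snd ` \<theta>'"
    proof (cases "t' = t")
      case False
      then have "(s, t') \<in> \<theta>'" using closed[OF p(1) st] leq p(2) by (simp add: lt_def)
      then show ?thesis by force
    qed (use p in simp)
  qed simp_all
  have img: "\<sigma> ` fst ` \<theta>' = \<tau> ` snd ` \<theta>'"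
    unfolding image_image using \<theta>_mem subsetD[OF assms(2)] by (intro image_cong refl) simp
  have "secured S T \<theta>'"
    using \<theta>(5) antisym_subset[OF graph_order_mono[OF assms(2), of S T]] unfolding secured_iff by simp
  then have "secured S T (induced_graph \<sigma> \<tau> (fst ` \<theta>') (snd ` \<theta>'))" by (simp only: eq[symmetric])
  with eq fst_config snd_config img show ?thesis
    unfolding secured_bijections_def mem_Collect_eq by (intro exI conjI)
qed

text \<open>The prime generated by \<open>p\<close>: the causal history of \<open>p\<close> inside
  \<open>\<theta>\<close>, thus an event of the interaction.\<close>

abbreviation "prime_below \<theta> p \<equiv> {p'. (p', p) \<in> graph_order S T \<theta>}"

lemma prime_below_B:
  assumes "\<theta> \<in> B" "p \<in> \<theta>"
  shows "prime_below \<theta> p \<in> B"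
proof (rule B_subset[OF assms(1)])
  show "prime_below \<theta> p \<subseteq> \<theta>" using graph_order_subset[of S T \<theta>] by auto
  fix q q' assume q: "q \<in> prime_below \<theta> p" "q' \<in> \<theta>" "lt S (fst q') (fst q) \<or> lt T (snd q') (snd q)"
  have "q \<in> \<theta>" using q(1) graph_order_subset[of S T \<theta>] by auto
  then have "(q', q) \<in> graph_order S T \<theta>" using graph_order_step[OF q(2) _ q(3)] by simp
  then show "q' \<in> prime_below \<theta> p" using q(1) graph_order_trans[of q' q S T \<theta> p] by simp
qed

lemma prime_below_greatest:
  assumes "\<theta> \<in> B" "p \<in> \<theta>"
  shows "is_greatest S T (prime_below \<theta> p) p"
proof -
  have p: "p \<in> prime_below \<theta> p" using graph_order_refl[OF assms(2)] by simp
  have sub: "prime_below \<theta> p \<subseteq> \<theta>" using graph_order_subset[of S T \<theta>] by auto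
  show ?thesis
    unfolding is_greatest_def
    using p B_graph_order[OF prime_below_B[OF assms] assms(1) sub p] by simp
qed

text \<open>The orders of \<open>\<theta>'\<close> and \<open>\<theta>\<close> agree below elements
  of the closed subset \<open>\<theta>'\<close>. Hence the primes inside \<open>\<theta>\<close> are
  exactly the histories of its elements.\<close>

lemma greatest_eq_prime_below:
  assumes "\<theta>' \<in> B" "\<theta> \<in> B" "\<theta>' \<subseteq> \<theta>" "is_greatest S T \<theta>' p"
  shows "\<theta>' = prime_below \<theta> p"
proof
  show "\<theta>' \<subseteq> prime_below \<theta> p"
    using assms(4) graph_order_mono[OF assms(3), of S T] unfolding is_greatest_def by auto
  have p: "p \<in> \<theta>'" using assms(4) by (simp add: is_greatest_def)
  show "prime_below \<theta> p \<subseteq> \<theta>'"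
    using B_graph_order[OF assms(1-3) p] graph_order_subset[of S T \<theta>'] by auto
qed

end


section \<open>Parallel composition and copycat\<close>

lemma vimage_sum_image: "Inl -` (Inl ` x \<union> Inr ` y) = x" "Inr -` (Inl ` x \<union> Inr ` y) = y"
  by auto

lemma sum_image_vimage: "Inl ` (Inl -` z) \<union> Inr ` (Inr -` z) = z"
proof (rule set_eqI)
  show "c \<in> Inl ` (Inl -` z) \<union> Inr ` (Inr -` z) \<longleftrightarrow> c \<in> z" for c
    by (cases c) auto
qed

lemma events_par: "events (E \<parallel> F) = events E <+> events F"
  by (simp add: par_def)

lemma leq_par:
  "(Inl a, Inl a') \<in> leq (E \<parallel> F) \<longleftrightarrow> (a, a') \<in> leq E"
  "(Inr b, Inr b') \<in> leq (E \<parallel> F) \<longleftrightarrow> (b, b') \<in> leq F"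
  "(Inl a, Inr b) \<notin> leq (E \<parallel> F)" "(Inr b, Inl a) \<notin> leq (E \<parallel> F)"
  by (force simp: par_def)+

lemma Con_par: "z \<in> Con (E \<parallel> F) \<longleftrightarrow> Inl -` z \<in> Con E \<and> Inr -` z \<in> Con F"
proof
  assume "z \<in> Con (E \<parallel> F)"
  then obtain x y where "z = Inl ` x \<union> Inr ` y" "x \<in> Con E" "y \<in> Con F"
    by (auto simp: par_def)
  then show "Inl -` z \<in> Con E \<and> Inr -` z \<in> Con F" by (simp only: vimage_sum_image)
next
  assume z: "Inl -` z \<in> Con E \<and> Inr -` z \<in> Con F"
  have "\<exists>x y. z = Inl ` x \<union> Inr ` y \<and> x \<in> Con E \<and> y \<in> Con F"
    using z sum_image_vimage[of z] by (intro exI[of _ "Inl -` z"] exI[of _ "Inr -` z"]) simp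
  then show "z \<in> Con (E \<parallel> F)" by (simp add: par_def)
qed

lemma Con_par_subset:
  assumes "\<And>X Y. X \<in> Con E \<Longrightarrow> Y \<subseteq> X \<Longrightarrow> Y \<in> Con E" "\<And>X Y. X \<in> Con F \<Longrightarrow> Y \<subseteq> X \<Longrightarrow> Y \<in> Con F"
    and "X \<in> Con (E \<parallel> F)" "Y \<subseteq> X"
  shows "Y \<in> Con (E \<parallel> F)"
proof -
  have X: "Inl -` X \<in> Con E" "Inr -` X \<in> Con F" using assms(3) unfolding Con_par by blast+
  have "Inl -` Y \<in> Con E" by (rule assms(1)[OF X(1) vimage_mono[OF assms(4)]])
  moreover have "Inr -` Y \<in> Con F" by (rule assms(2)[OF X(2) vimage_mono[OF assms(4)]])
  ultimately show ?thesis unfolding Con_par ..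
qed

lemma finite_sum_iff: "finite z \<longleftrightarrow> finite (Inl -` z) \<and> finite (Inr -` z)"
proof
  assume "finite (Inl -` z) \<and> finite (Inr -` z)"
  then have "finite (Inl ` (Inl -` z) \<union> Inr ` (Inr -` z))" by (simp del: image_vimage_eq)
  then show "finite z" by (simp only: sum_image_vimage)
qed (simp add: finite_vimageI)

lemma configs_par: "z \<in> configs (E \<parallel> F) \<longleftrightarrow> Inl -` z \<in> configs E \<and> Inr -` z \<in> configs F"
proof -
  have "z \<subseteq> events (E \<parallel> F) \<longleftrightarrow> Inl -` z \<subseteq> events E \<and> Inr -` z \<subseteq> events F"
    (is "?l \<longleftrightarrow> ?r")
  proof
    show "?l \<Longrightarrow> ?r" by (auto simp: events_par)
    assume r: ?r
    show ?l
    proof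
      fix c assume "c \<in> z"
      with r show "c \<in> events (E \<parallel> F)" by (cases c) (auto simp: events_par)
    qed
  qed
  moreover have "(\<forall>e\<in>z. \<forall>e'. (e', e) \<in> leq (E \<parallel> F) \<longrightarrow> e' \<in> z) \<longleftrightarrow>
      (\<forall>e\<in>Inl -` z. \<forall>e'. (e', e) \<in> leq E \<longrightarrow> e' \<in> Inl -` z) \<and>
      (\<forall>e\<in>Inr -` z. \<forall>e'. (e', e) \<in> leq F \<longrightarrow> e' \<in> Inr -` z)" (is "?l \<longleftrightarrow> ?r")
  proof
    show "?l \<Longrightarrow> ?r" by (auto simp: leq_par)
    assume r: ?r
    show ?l
    proof (intro ballI allI impI)
      fix e e' assume "e \<in> z" "(e', e) \<in> leq (E \<parallel> F)"
      with r show "e' \<in> z" by (cases e; cases e') (auto simp: leq_par)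
    qed
  qed
  ultimately show ?thesis
    unfolding configs_def using finite_sum_iff[of z] Con_par[of z E F] by auto
qed

lemma configs_dual: "configs (dual A) = configs A"
  by (simp add: dual_def configs_def)

lemma pol_dual: "pol (dual A) a = Pos \<longleftrightarrow> pol A a = Neg"
  by (cases "pol A a") (simp_all add: dual_def)

lemma configs_empty_game: "configs empty_game = {{}}"
  by (auto simp: empty_game_def configs_def)

section \<open>Configurations of copycat\<close>

definition copycat_step :: "'a esp \<Rightarrow> (('a + 'a) \<times> ('a + 'a)) set" where
  "copycat_step A = leq (dual A \<parallel> A) \<union>
     {(swap_side c, c) | c. c \<in> events (dual A \<parallel> A) \<and> pol (dual A \<parallel> A) c = Pos}"

lemma copycat_leq_eq: "copycat_leq A = (copycat_step A)\<^sup>+"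
  by (simp add: copycat_leq_def copycat_step_def)

lemma events_dual_par: "Inl a \<in> events (dual A \<parallel> A) \<longleftrightarrow> a \<in> events A"
  "Inr a \<in> events (dual A \<parallel> A) \<longleftrightarrow> a \<in> events A"
  by (auto simp: events_par dual_def)

lemma leq_dual: "leq (dual A) = leq A"
  by (simp add: dual_def)

lemma pol_dual_par: "pol (dual A \<parallel> A) (Inl a) = Pos \<longleftrightarrow> pol A a = Neg"
  "pol (dual A \<parallel> A) (Inr a) = pol A a"
  using pol_dual[of A a] by (simp_all add: par_def)

text \<open>Polarity on the left is reversed: a positive event of \<open>A\<close> occurs on the
  left before the right, a negative one on the right before the left.\<close>

lemma copycat_step_cases:
  "(Inl a', Inl a) \<in> copycat_step A \<longleftrightarrow> (a', a) \<in> leq A"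
  "(Inr a', Inr a) \<in> copycat_step A \<longleftrightarrow> (a', a) \<in> leq A"
  "(Inl a', Inr a) \<in> copycat_step A \<longleftrightarrow> a' = a \<and> a \<in> events A \<and> pol A a = Pos"
  "(Inr a', Inl a) \<in> copycat_step A \<longleftrightarrow> a' = a \<and> a \<in> events A \<and> pol A a = Neg"
  unfolding copycat_step_def
  by (auto simp: leq_par leq_dual events_dual_par pol_dual_par elim: swap_side.elims)

lemma copycat_step_leq: "p \<in> copycat_step A \<Longrightarrow> p \<in> copycat_leq A"
  unfolding copycat_leq_eq by (rule r_into_trancl')

lemma copycat_leq_closed:
  assumes closed: "\<And>c c'. c \<in> z \<Longrightarrow> (c', c) \<in> copycat_step A \<Longrightarrow> c' \<in> z"
    and "(c', c) \<in> copycat_leq A" "c \<in> z"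
  shows "c' \<in> z"
  using assms(2) unfolding copycat_leq_eq
  by (induction rule: converse_trancl_induct) (use closed assms(3) in auto)

lemma Con_dual: "Con (dual A) = Con A"
  by (simp add: dual_def)

lemma Con_dual_par_subset:
  assumes "event_structure A" "X \<in> Con (dual A \<parallel> A)" "Y \<subseteq> X"
  shows "Y \<in> Con (dual A \<parallel> A)"
proof (rule Con_par_subset[OF _ _ assms(2,3)])
  show "Y \<in> Con (dual A)" if "X \<in> Con (dual A)" "Y \<subseteq> X" for X Y
    using Con_subset[OF assms(1) that(1)[unfolded Con_dual] that(2)] by (simp add: Con_dual)
qed (rule Con_subset[OF assms(1)])

lemma Con_copycat: "X \<in> Con (copycat A) \<longleftrightarrow> X \<subseteq> events (dual A \<parallel> A) \<and>
    {c'. \<exists>c\<in>X. (c', c) \<in> copycat_leq A} \<in> Con (dual A \<parallel> A)"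
  by (simp add: copycat_def)

lemma Con_copycat_subset:
  assumes A: "event_structure A" and "X \<in> Con (copycat A)" "Y \<subseteq> X"
  shows "Y \<in> Con (copycat A)"
proof -
  have sub: "{c'. \<exists>c\<in>Y. (c', c) \<in> copycat_leq A} \<subseteq> {c'. \<exists>c\<in>X. (c', c) \<in> copycat_leq A}"
    using assms(3) by auto
  have X: "X \<subseteq> events (dual A \<parallel> A)" "{c'. \<exists>c\<in>X. (c', c) \<in> copycat_leq A} \<in> Con (dual A \<parallel> A)"
    using assms(2) unfolding Con_copycat by simp_all
  show ?thesis
    unfolding Con_copycat
    by (intro conjI subset_trans[OF assms(3) X(1)] Con_dual_par_subset[OF A X(2) sub])
qed

text \<open>The two cross conditions say that the right part is below the left part in the Scott
  order. Consistency in copycat concerns the down-closure; as \<open>z\<close> is its own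
  down-closure, it reduces to consistency of the two parts.\<close>

lemma configs_copycat:
  assumes A: "event_structure A"
  shows "z \<in> configs (copycat A) \<longleftrightarrow> Inl -` z \<in> configs A \<and> Inr -` z \<in> configs A \<and>
    (\<forall>a. Inr a \<in> z \<longrightarrow> pol A a = Pos \<longrightarrow> Inl a \<in> z) \<and>
    (\<forall>a. Inl a \<in> z \<longrightarrow> pol A a = Neg \<longrightarrow> Inr a \<in> z)"
    (is "_ \<longleftrightarrow> ?r")
proof
  have par_iff: "z \<in> configs (dual A \<parallel> A) \<longleftrightarrow> Inl -` z \<in> configs A \<and> Inr -` z \<in> configs A"
    by (simp add: configs_par configs_dual)
  have refl: "(c, c) \<in> copycat_leq A" if "c \<in> events (dual A \<parallel> A)" for c
  proof (rule copycat_step_leq)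
    show "(c, c) \<in> copycat_step A"
      using that by (cases c) (simp_all add: copycat_step_cases events_dual_par leq_refl[OF A])
  qed
  {
    assume z: "z \<in> configs (copycat A)"
    have ev: "z \<subseteq> events (dual A \<parallel> A)" using configsD(2)[OF z] by (simp add: copycat_def)
    have closed: "c' \<in> z" if "c \<in> z" "(c', c) \<in> copycat_step A" for c c'
      using configsD(4)[OF z that(1)] copycat_step_leq[OF that(2)] by (simp add: copycat_def)
    have sub: "z \<subseteq> {c'. \<exists>c\<in>z. (c', c) \<in> copycat_leq A}" using refl subsetD[OF ev] by fast
    have "{c'. \<exists>c\<in>z. (c', c) \<in> copycat_leq A} \<in> Con (dual A \<parallel> A)"
      using configsD(3)[OF z] by (simp add: Con_copycat)
    then have "z \<in> Con (dual A \<parallel> A)" using sub by (rule Con_dual_par_subset[OF A])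
    moreover have "c' \<in> z" if "c \<in> z" "(c', c) \<in> leq (dual A \<parallel> A)" for c c'
      by (rule closed[OF that(1)]) (simp add: copycat_step_def that(2))
    ultimately have "z \<in> configs (dual A \<parallel> A)"
      using ev configsD(1)[OF z] unfolding configs_def by simp
    moreover have "Inl a \<in> z" if "Inr a \<in> z" "pol A a = Pos" for a
      using closed[OF that(1), of "Inl a"] that(2) subsetD[OF ev that(1)]
      by (simp add: copycat_step_cases events_dual_par)
    moreover have "Inr a \<in> z" if "Inl a \<in> z" "pol A a = Neg" for a
      using closed[OF that(1), of "Inr a"] that(2) subsetD[OF ev that(1)]
      by (simp add: copycat_step_cases events_dual_par)
    ultimately show ?r using par_iff by simp
  }
  assume r: ?r
  then have z: "z \<in> configs (dual A \<parallel> A)" using par_iff by simp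
  have step: "c' \<in> z" if c: "c \<in> z" "(c', c) \<in> copycat_step A" for c c'
  proof -
    have Inl_closed: "Inl a' \<in> z" if "Inl a \<in> z" "(a', a) \<in> leq A" for a a'
      using configsD(4)[of "Inl -` z" A a a'] r that by simp
    have Inr_closed: "Inr a' \<in> z" if "Inr a \<in> z" "(a', a) \<in> leq A" for a a'
      using configsD(4)[of "Inr -` z" A a a'] r that by simp
    show ?thesis
    proof (cases c)
      case (Inl a)
      note c = c[unfolded Inl]
      show ?thesis
      proof (cases c')
        case (Inl a')
        then show ?thesis using c Inl_closed[OF c(1), of a'] by (simp add: copycat_step_cases)
      next
        case (Inr a')
        then show ?thesis using c r by (simp add: copycat_step_cases)
      qed
    next
      case (Inr a)
      note c = c[unfolded Inr]
      show ?thesis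
      proof (cases c')
        case (Inl a')
        then show ?thesis using c r by (simp add: copycat_step_cases)
      next
        case (Inr a')
        then show ?thesis using c Inr_closed[OF c(1), of a'] by (simp add: copycat_step_cases)
      qed
    qed
  qed
  have closed: "c' \<in> z" if "(c', c) \<in> copycat_leq A" "c \<in> z" for c c'
    using copycat_leq_closed[OF step that] .
  have "{c'. \<exists>c\<in>z. (c', c) \<in> copycat_leq A} = z"
    using closed refl subsetD[OF configsD(2)[OF z]] by fast
  then have "z \<in> Con (copycat A)" using configsD(2,3)[OF z] by (simp add: Con_copycat)
  moreover have "z \<subseteq> events (copycat A)" using configsD(2)[OF z] by (simp add: copycat_def)
  moreover have "c' \<in> z" if "c \<in> z" "(c', c) \<in> leq (copycat A)" for c c'
    using closed[OF _ that(1), of c'] that(2) by (simp add: copycat_def)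
  ultimately show "z \<in> configs (copycat A)"
    using configsD(1)[OF z] unfolding configs_def by simp
qed


section \<open>Interaction with copycat\<close>

context pre_strategy_on_game
begin

text \<open>The summands of the codomain are the empty game, the copy of \<open>A\<close> on which
  \<sigma> meets copycat and which is hidden, and the visible copy of \<open>A\<close>.\<close>

definition target :: "'s + 'a \<Rightarrow> unit + ('a + 'a)" where
  "target = assoc_sum \<circ> map_sum (Inr \<circ> \<sigma>) id"

lemma target_simps [simp]: "target (Inl s) = Inr (Inl (\<sigma> s))" "target (Inr a) = Inr (Inr a)"
  by (simp_all add: target_def)

abbreviation "cc \<equiv> empty_game \<parallel> copycat A"

lemma configs_cc: "z \<in> configs cc \<longleftrightarrow> Inl -` z = {} \<and> Inr -` z \<in> configs (copycat A)"
  by (simp add: configs_par configs_empty_game)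

sublocale locally_injective_pair "S \<parallel> A" target cc "\<lambda>c. c"
proof
  show "Y \<in> Con (S \<parallel> A)" if "X \<in> Con (S \<parallel> A)" "Y \<subseteq> X" for X Y
    by (rule Con_par_subset[OF Con_subset[OF source] Con_subset[OF game] that])
  show "Y \<in> Con cc" if "X \<in> Con cc" "Y \<subseteq> X" for X Y
    by (rule Con_par_subset[OF _ Con_copycat_subset[OF game] that]) (auto simp: empty_game_def)
  show "inj_on target z" if z: "z \<in> configs (S \<parallel> A)" for z
  proof (rule inj_onI)
    fix p q assume pq: "p \<in> z" "q \<in> z" "target p = target q"
    have x: "Inl -` z \<in> configs S" using z by (simp add: configs_par)
    show "p = q"
      using pq inj_onD[OF map_inj[OF x]] by (cases p; cases q) auto
  qed
qed simp

text \<open>Copycat is labelled by the identity, so a secured bijection is the graph of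
  \<open>target\<close> on its left configuration, that is, on a pair \<open>x\<close>,
  \<open>y\<close>.\<close>

definition pair_graph :: "'s set \<Rightarrow> 'a set \<Rightarrow> (('s + 'a) \<times> (unit + ('a + 'a))) set" where
  "pair_graph x y = (\<lambda>p. (p, target p)) ` (Inl ` x \<union> Inr ` y)"

lemma pair_graph_mem:
  "(p, c) \<in> pair_graph x y \<longleftrightarrow> c = target p \<and> (case p of Inl s \<Rightarrow> s \<in> x | Inr a \<Rightarrow> a \<in> y)"
  by (cases p) (auto simp: pair_graph_def)

lemma pair_graph_subset: "pair_graph x y \<subseteq> pair_graph x' y' \<longleftrightarrow> x \<subseteq> x' \<and> y \<subseteq> y'"
proof -
  have "pair_graph x y \<subseteq> pair_graph x' y' \<longleftrightarrow> Inl ` x \<union> Inr ` y \<subseteq> Inl ` x' \<union> (Inr ` y' :: ('s + 'a) set)"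
    unfolding pair_graph_def by (rule inj_image_subset_iff) (simp add: inj_def)
  also have "\<dots> \<longleftrightarrow> x \<subseteq> x' \<and> y \<subseteq> y'" by auto
  finally show ?thesis .
qed

text \<open>By \<open>configs_copycat\<close>, the condition for \<sigma> x on the left and
  \<open>y\<close> on the right to form a configuration of copycat.\<close>

definition compatible :: "'s set \<Rightarrow> 'a set \<Rightarrow> bool" where
  "compatible x y \<longleftrightarrow> x \<in> configs S \<and> (y, \<sigma> ` x) \<in> scott_order A"

lemma compatibleD:
  assumes "compatible x y"
  shows "x \<in> configs S" "y \<in> configs A" "a \<in> y \<Longrightarrow> pol A a = Pos \<Longrightarrow> a \<in> \<sigma> ` x"
    "s \<in> x \<Longrightarrow> pol S s = Neg \<Longrightarrow> \<sigma> s \<in> y" "(y, \<sigma> ` x) \<in> scott_order A"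
proof -
  show x: "x \<in> configs S" "(y, \<sigma> ` x) \<in> scott_order A" using assms by (simp_all add: compatible_def)
  note sc = x(2)[unfolded scott_order_iff[OF game]]
  show "y \<in> configs A" using sc by simp
  show "a \<in> \<sigma> ` x" if "a \<in> y" "pol A a = Pos" using sc that by force
  show "\<sigma> s \<in> y" if "s \<in> x" "pol S s = Neg"
    using sc that map_pol_config[OF x(1) that(1)] by force
qed

lemma compatibleI:
  assumes "x \<in> configs S" "y \<in> configs A" "\<And>a. a \<in> y \<Longrightarrow> pol A a = Pos \<Longrightarrow> a \<in> \<sigma> ` x"
    "\<And>s. s \<in> x \<Longrightarrow> pol S s = Neg \<Longrightarrow> \<sigma> s \<in> y"
  shows "compatible x y"
proof -
  have "pol A e = Neg" if "e \<in> y - \<sigma> ` x" for e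
    using assms(3)[of e] that by (cases "pol A e") auto
  moreover have "pol A e = Pos" if e: "e \<in> \<sigma> ` x - y" for e
  proof -
    from e obtain s where "s \<in> x" "e = \<sigma> s" "\<sigma> s \<notin> y" by auto
    then show ?thesis
      using assms(4)[of s] map_pol_config[OF assms(1), of s] by (cases "pol S s") auto
  qed
  ultimately show ?thesis
    using assms(1,2) map_config[OF assms(1)] by (simp add: compatible_def scott_order_iff[OF game])
qed

section \<open>Absence of deadlocks between a pre-strategy and copycat\<close>

definition causes_in :: "'s set \<Rightarrow> 's \<Rightarrow> nat" where
  "causes_in x s = card {e \<in> x. (e, s) \<in> leq S}"

text \<open>A linearisation of the interaction: each \<open>s\<close> in \<open>x\<close> gets three consecutive ranks, so that its
  copy on the right comes just before it if it is negative and just after it if it is positive.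
  The events of \<open>y\<close> without a counterpart in \<open>x\<close> come last.\<close>

definition rank :: "'s set \<Rightarrow> 'a + 'a \<Rightarrow> nat" where
  "rank x = case_sum (\<lambda>b. 3 * causes_in x (inv_into x \<sigma> b) + 1)
     (\<lambda>a. if a \<in> \<sigma> ` x
       then 3 * causes_in x (inv_into x \<sigma> a) + (case pol A a of Pos \<Rightarrow> 2 | Neg \<Rightarrow> 0)
       else 3 * card x + 3 + card {e. (e, a) \<in> leq A})"

lemma causes_in_less:
  assumes "x \<in> configs S" "s \<in> x" "s' \<in> x" "lt S s s'"
  shows "causes_in x s < causes_in x s'"
  unfolding causes_in_def
proof (rule psubset_card_mono)
  show "finite {e \<in> x. (e, s') \<in> leq S}" using configsD(1)[OF assms(1)] by simp
  have "s' \<in> {e \<in> x. (e, s') \<in> leq S}"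
    using assms(3) leq_refl[OF source subsetD[OF configsD(2)[OF assms(1)] assms(3)]] by simp
  moreover have "s' \<notin> {e \<in> x. (e, s) \<in> leq S}"
    using assms(4) leq_antisym[OF source, of s s'] by (auto simp: lt_def)
  moreover have "{e \<in> x. (e, s) \<in> leq S} \<subseteq> {e \<in> x. (e, s') \<in> leq S}"
    using assms(4) leq_trans[OF source, of _ s s'] by (auto simp: lt_def)
  ultimately show "{e \<in> x. (e, s) \<in> leq S} \<subset> {e \<in> x. (e, s') \<in> leq S}" by auto
qed

lemma causes_in_bound: "x \<in> configs S \<Longrightarrow> causes_in x s \<le> card x"
  unfolding causes_in_def by (rule card_mono) (auto simp: configsD(1))

lemma rank_Inl: "x \<in> configs S \<Longrightarrow> s \<in> x \<Longrightarrow> rank x (Inl (\<sigma> s)) = 3 * causes_in x s + 1"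
  by (simp add: rank_def inv_into_f_f[OF map_inj])

lemma rank_Inr: "x \<in> configs S \<Longrightarrow> s \<in> x \<Longrightarrow>
    rank x (Inr (\<sigma> s)) = 3 * causes_in x s + (case pol A (\<sigma> s) of Pos \<Rightarrow> 2 | Neg \<Rightarrow> 0)"
  by (simp add: rank_def inv_into_f_f[OF map_inj])

lemma rank_Inr_new:
  "a \<notin> \<sigma> ` x \<Longrightarrow> rank x (Inr a) = 3 * card x + 3 + card {e. (e, a) \<in> leq A}"
  by (simp add: rank_def)

lemma lt_reflect:
  assumes "x \<in> configs S" "s \<in> x" "s' \<in> x" "lt A (\<sigma> s) (\<sigma> s')"
  shows "lt S s s'"
  using map_leq_reflect[OF assms(1-3)] assms(4) by (auto simp: lt_def)

text \<open>Membership is proved along with the decrease so that the argument can be iterated down a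
  chain in the transitive closure. A copy step changes the rank by 1 within a block of three; a
  causal step between events over \<open>x\<close> goes to an earlier block.\<close>

lemma rank_copycat_step:
  assumes comp: "compatible x y" and step: "(c', c) \<in> copycat_step A"
    and c: "c \<in> Inl ` \<sigma> ` x \<union> Inr ` y"
  shows "c' \<in> Inl ` \<sigma> ` x \<union> Inr ` y \<and> (c' = c \<or> rank x c' < rank x c)"
proof -
  note x = compatibleD(1)[OF comp] and y = compatibleD(2)[OF comp]
  have sx: "\<sigma> ` x \<in> configs A" by (rule map_config[OF x])
  show ?thesis
  proof (cases c)
    case (Inl b)
    then have "b \<in> \<sigma> ` x" using c by auto
    then obtain s where s: "s \<in> x" "b = \<sigma> s" by auto
    show ?thesis
    proof (cases c')
      case (Inl b')
      then have leq: "(b', b) \<in> leq A" using step \<open>c = Inl b\<close> by (simp add: copycat_step_cases)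
      then have "b' \<in> \<sigma> ` x" using configsD(4)[OF sx] s by auto
      then obtain s' where s': "s' \<in> x" "b' = \<sigma> s'" by auto
      have "c' = c \<or> lt A (\<sigma> s') (\<sigma> s)" using leq s s' Inl \<open>c = Inl b\<close> by (auto simp: lt_def)
      then have "c' = c \<or> causes_in x s' < causes_in x s"
        using lt_reflect[OF x s'(1) s(1)] causes_in_less[OF x s'(1) s(1)] by auto
      then show ?thesis
        using rank_Inl[OF x s'(1)] rank_Inl[OF x s(1)] s s' Inl \<open>c = Inl b\<close> by auto
    next
      case (Inr b')
      then have "b' = b" "pol A b = Neg" using step \<open>c = Inl b\<close> by (simp_all add: copycat_step_cases)
      then show ?thesis
        using rank_Inl[OF x s(1)] rank_Inr[OF x s(1)] compatibleD(4)[OF comp s(1)]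
          map_pol_config[OF x s(1)] s Inr \<open>c = Inl b\<close> by auto
    qed
  next
    case (Inr a)
    then have a: "a \<in> y" using c by auto
    show ?thesis
    proof (cases c')
      case (Inl b')
      then have b': "b' = a" "pol A a = Pos"
        using step \<open>c = Inr a\<close> by (simp_all add: copycat_step_cases)
      then have "a \<in> \<sigma> ` x" using compatibleD(3)[OF comp a] by simp
      then obtain s where s: "s \<in> x" "a = \<sigma> s" by auto
      then show ?thesis
        using rank_Inl[OF x s(1)] rank_Inr[OF x s(1)] b' Inl \<open>c = Inr a\<close> by auto
    next
      case (Inr a')
      then have leq: "(a', a) \<in> leq A" using step \<open>c = Inr a\<close> by (simp add: copycat_step_cases)
      then have a': "a' \<in> y" using configsD(4)[OF y a] by simp
      have "a' = a \<or> rank x (Inr a') < rank x (Inr a)"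
      proof (cases "a' = a")
        case False
        then have lt: "lt A a' a" using leq by (simp add: lt_def)
        have pol_bound: "(case pol A b of Pos \<Rightarrow> 2 | Neg \<Rightarrow> 0) \<le> (2 :: nat)" for b
          by (cases "pol A b") simp_all
        show ?thesis
        proof (cases "a \<in> \<sigma> ` x")
          case True
          then have "a' \<in> \<sigma> ` x" using configsD(4)[OF sx _ leq] by simp
          then obtain s' where s': "s' \<in> x" "a' = \<sigma> s'" by auto
          from True obtain s where s: "s \<in> x" "a = \<sigma> s" by auto
          have "causes_in x s' < causes_in x s"
            using causes_in_less[OF x s'(1) s(1)] lt_reflect[OF x s'(1) s(1)] lt s s' by simp
          then show ?thesis
            using rank_Inr[OF x s'(1)] rank_Inr[OF x s(1)] pol_bound[of a'] s s' by simp
        next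
          \<comment> \<open>Events with a counterpart in \<open>x\<close> have rank at most
            \<open>3 * card x + 2\<close>, so those without one start at
            \<open>3 * card x + 3\<close> and are ordered among themselves by their number of
            causes.\<close>
          case new: False
          show ?thesis
          proof (cases "a' \<in> \<sigma> ` x")
            case True
            then obtain s' where s': "s' \<in> x" "a' = \<sigma> s'" by auto
            then show ?thesis
              using rank_Inr[OF x s'(1)] rank_Inr_new[OF new] causes_in_bound[OF x, of s']
                pol_bound[of a'] by simp
          next
            case False
            then show ?thesis
              using rank_Inr_new[OF new] rank_Inr_new[OF False] card_principal_less[OF game lt] by simp
          qed
        qed
      qed simp
      then show ?thesis using a' Inr \<open>c = Inr a\<close> by auto
    qed
  qed
qed

lemma rank_copycat_leq:
  assumes comp: "compatible x y" and "(c', c) \<in> copycat_leq A" and c: "c \<in> Inl ` \<sigma> ` x \<union> Inr ` y"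
  shows "c' = c \<or> rank x c' < rank x c"
proof -
  have "c' \<in> Inl ` \<sigma> ` x \<union> Inr ` y \<and> (c' = c \<or> rank x c' < rank x c)"
    using assms(2) unfolding copycat_leq_eq
  proof (induction rule: converse_trancl_induct)
    case (base d)
    show ?case by (rule rank_copycat_step[OF comp base c])
  next
    case (step d e)
    then show ?case using rank_copycat_step[OF comp step(1)] by auto
  qed
  then show ?thesis by simp
qed

text \<open>Every generating step strictly raises the rank of the second component, so the generated
  order has no cycles.\<close>

lemma pair_graph_secured:
  assumes comp: "compatible x y"
  shows "secured (S \<parallel> A) cc (pair_graph x y)"
proof -
  note x = compatibleD(1)[OF comp] and y = compatibleD(2)[OF comp]
  let ?rk = "\<lambda>p. rank x (projr (snd p))"
  let ?R = "{(p, p'). p \<in> pair_graph x y \<and> p' \<in> pair_graph x y \<and>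
    (lt (S \<parallel> A) (fst p) (fst p') \<or> lt cc (snd p) (snd p'))}"
  have edge: "?rk p < ?rk p'"
    if p: "p \<in> pair_graph x y" "p' \<in> pair_graph x y"
      and lt: "lt (S \<parallel> A) (fst p) (fst p') \<or> lt cc (snd p) (snd p')" for p p'
  proof -
    obtain q where q: "p = (q, target q)" "q \<in> Inl ` x \<union> Inr ` y" using p(1) by (auto simp: pair_graph_def)
    obtain q' where q': "p' = (q', target q')" "q' \<in> Inl ` x \<union> Inr ` y"
      using p(2) by (auto simp: pair_graph_def)
    have c': "projr (target q') \<in> Inl ` \<sigma> ` x \<union> Inr ` y" using q'(2) by auto
    have Inr_eq: "target r = Inr (projr (target r))" for r by (cases r) simp_all
    from lt show ?thesis
    proof
      assume "lt cc (snd p) (snd p')"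
      then have "lt cc (Inr (projr (target q))) (Inr (projr (target q')))"
        using q(1) q'(1) Inr_eq by simp
      then have cc: "(projr (target q), projr (target q')) \<in> copycat_leq A"
        "projr (target q) \<noteq> projr (target q')"
        by (simp_all add: lt_def leq_par copycat_def)
      show ?thesis using rank_copycat_leq[OF comp cc(1) c'] cc(2) q(1) q'(1) by simp
    next
      assume lt: "lt (S \<parallel> A) (fst p) (fst p')"
      show ?thesis
      proof (cases q')
        \<comment> \<open>Causality of \<open>S\<close> may be stronger than that of
          \<open>A\<close>, so this step need not be visible in copycat; the count of causes in
          \<open>x\<close> handles it.\<close>
        case (Inl s')
        then obtain s where s: "q = Inl s" "lt S s s'"
          using lt q(1) q'(1) by (cases q) (auto simp: lt_def leq_par)
        then have mem: "s \<in> x" "s' \<in> x" using Inl q(2) q'(2) by auto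
        then show ?thesis
          using causes_in_less[OF x mem s(2)] rank_Inl[OF x] s(1) Inl q(1) q'(1) by simp
      next
        case (Inr a')
        then obtain a where a: "q = Inr a" "lt A a a'"
          using lt q(1) q'(1) by (cases q) (auto simp: lt_def leq_par)
        then have "(Inr a, Inr a') \<in> copycat_leq A"
          by (intro copycat_step_leq) (simp add: copycat_step_cases lt_def)
        then show ?thesis
          using rank_copycat_leq[OF comp, of "Inr a" "Inr a'"] c' a Inr q(1) q'(1) by (simp add: lt_def)
      qed
    qed
  qed
  have less: "?rk p < ?rk p'" if "(p, p') \<in> ?R\<^sup>+" for p p'
    using that
  proof (induction rule: trancl_induct)
    case (base q)
    then show ?case using edge[of p q] by simp
  next
    case (step q r)
    then show ?case using edge[of q r] by simp
  qed
  show ?thesis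
    unfolding secured_iff
  proof (rule antisymI)
    fix p q assume pq: "(p, q) \<in> graph_order (S \<parallel> A) cc (pair_graph x y)"
      "(q, p) \<in> graph_order (S \<parallel> A) cc (pair_graph x y)"
    show "p = q"
    proof (rule ccontr)
      assume "p \<noteq> q"
      then have "(p, q) \<in> ?R\<^sup>+" "(q, p) \<in> ?R\<^sup>+" using pq by (auto simp: graph_order_def Id_on_def)
      then show False using less[of p q] less[of q p] by simp
    qed
  qed
qed

lemma induced_graph_target: "induced_graph target (\<lambda>c. c) z (target ` z) = (\<lambda>p. (p, target p)) ` z"
  by (auto simp: induced_graph_def)

lemma target_image_config:
  assumes "x \<in> configs S" "y \<in> configs A"
  shows "target ` (Inl ` x \<union> Inr ` y) \<in> configs cc \<longleftrightarrow> compatible x y"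
proof -
  let ?z = "Inl ` \<sigma> ` x \<union> Inr ` y"
  have mem: "Inl a \<in> ?z \<longleftrightarrow> a \<in> \<sigma> ` x" "Inr a \<in> ?z \<longleftrightarrow> a \<in> y" for a by auto
  have "target ` (Inl ` x \<union> Inr ` y) = Inr ` ?z" by (auto simp: image_Un image_image)
  then have "Inl -` target ` (Inl ` x \<union> Inr ` y) = {}" "Inr -` target ` (Inl ` x \<union> Inr ` y) = ?z"
    by auto
  then have "target ` (Inl ` x \<union> Inr ` y) \<in> configs cc \<longleftrightarrow> ?z \<in> configs (copycat A)"
    by (simp add: configs_cc)
  also have "\<dots> \<longleftrightarrow> (\<forall>a\<in>y. pol A a = Pos \<longrightarrow> a \<in> \<sigma> ` x) \<and> (\<forall>s\<in>x. pol A (\<sigma> s) = Neg \<longrightarrow> \<sigma> s \<in> y)"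
    using assms map_config unfolding configs_copycat[OF game] vimage_sum_image mem by auto
  also have "\<dots> \<longleftrightarrow> compatible x y"
  proof
    assume "(\<forall>a\<in>y. pol A a = Pos \<longrightarrow> a \<in> \<sigma> ` x) \<and> (\<forall>s\<in>x. pol A (\<sigma> s) = Neg \<longrightarrow> \<sigma> s \<in> y)"
    then show "compatible x y"
      by (intro compatibleI[OF assms]) (simp_all add: map_pol_config[OF assms(1)])
  qed (use compatibleD(3,4)[of x y] map_pol_config[OF assms(1)] in auto)
  finally show ?thesis .
qed

text \<open>Security is automatic by \<open>pair_graph_secured\<close>, leaving only the requirement
  that the image under \<open>target\<close> is a configuration of copycat.\<close>

lemma B_iff: "\<theta> \<in> B \<longleftrightarrow> (\<exists>x y. compatible x y \<and> \<theta> = pair_graph x y)"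
proof
  assume "\<theta> \<in> B"
  then obtain X Y where \<theta>: "\<theta> = induced_graph target (\<lambda>c. c) X Y" "X \<in> configs (S \<parallel> A)" "Y \<in> configs cc"
    "target ` X = (\<lambda>c. c) ` Y"
    by (rule B_cases)
  let ?x = "Inl -` X" and ?y = "Inr -` X"
  have X: "X = Inl ` ?x \<union> Inr ` ?y" by (simp only: sum_image_vimage)
  have xy: "?x \<in> configs S" "?y \<in> configs A" using \<theta>(2) by (simp_all add: configs_par)
  have Y: "Y = target ` X" using \<theta>(4) by simp
  have "compatible ?x ?y" using target_image_config[OF xy] \<theta>(3) Y X by simp
  moreover have "\<theta> = pair_graph ?x ?y"
    unfolding \<theta>(1) Y induced_graph_target pair_graph_def X[symmetric] ..
  ultimately show "\<exists>x y. compatible x y \<and> \<theta> = pair_graph x y" by (intro exI conjI)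
next
  assume "\<exists>x y. compatible x y \<and> \<theta> = pair_graph x y"
  then obtain x y where xy: "compatible x y" "\<theta> = pair_graph x y" by auto
  let ?X = "Inl ` x \<union> Inr ` y"
  have "?X \<in> configs (S \<parallel> A)"
    using compatibleD(1,2)[OF xy(1)] unfolding configs_par vimage_sum_image by simp
  moreover have "target ` ?X \<in> configs cc"
    using target_image_config compatibleD(1,2)[OF xy(1)] xy(1) by simp
  moreover have "\<theta> = induced_graph target (\<lambda>c. c) ?X (target ` ?X)"
    by (simp only: xy(2) induced_graph_target pair_graph_def)
  moreover have "secured (S \<parallel> A) cc \<theta>" using pair_graph_secured[OF xy(1)] xy(2) by simp
  ultimately show "\<theta> \<in> B" unfolding secured_bijections_def by (auto intro!: exI)
qed

end


section \<open>Composition with copycat\<close>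

context pre_strategy_on_game
begin

abbreviation "copycat_composite \<equiv> composite empty_game A S (Inr \<circ> \<sigma>) (copycat A) copycat_map"

abbreviation "copycat_composite_map \<equiv> composite_map empty_game A S (Inr \<circ> \<sigma>) (copycat A) copycat_map"

text \<open>\<open>right a\<close> is the visible copy of \<open>a\<close>; \<open>left s\<close> is
  \<open>s\<close> synchronised with the hidden copy of \<sigma> s.\<close>

abbreviation "right a \<equiv> (Inr a, Inr (Inr a))"

abbreviation "left s \<equiv> (Inl s, Inr (Inl (\<sigma> s)))"

definition visible_primes :: "(('s + 'a) \<times> (unit + ('a + 'a))) set set" where
  "visible_primes = {\<theta> \<in> B. \<exists>a. is_greatest (S \<parallel> A) cc \<theta> (right a)}"

lemma interaction_eq:
  "interaction empty_game A S (Inr \<circ> \<sigma>) (copycat A) copycat_map = wedge (S \<parallel> A) target cc (\<lambda>c. c)"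
  "interaction_map empty_game A S (Inr \<circ> \<sigma>) (copycat A) copycat_map =
    wedge_map (S \<parallel> A) target cc (\<lambda>c. c)"
proof -
  have "map_sum id copycat_map = (\<lambda>c :: unit + ('a + 'a). c)"
    unfolding copycat_map_def map_sum.id by (rule id_def)
  then show "interaction empty_game A S (Inr \<circ> \<sigma>) (copycat A) copycat_map = wedge (S \<parallel> A) target cc (\<lambda>c. c)"
    "interaction_map empty_game A S (Inr \<circ> \<sigma>) (copycat A) copycat_map =
      wedge_map (S \<parallel> A) target cc (\<lambda>c. c)"
    unfolding interaction_def interaction_map_def target_def by (simp_all only:)
qed

lemma interaction_map_greatest:
  assumes "\<theta> \<in> B" "is_greatest (S \<parallel> A) cc \<theta> p"
  shows "interaction_map empty_game A S (Inr \<circ> \<sigma>) (copycat A) copycat_map \<theta> = target (fst p)"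
  by (simp add: interaction_eq wedge_map_def the_greatest[OF B_secured[OF assms(1)] assms(2)])

lemma greatest_snd:
  assumes "\<theta> \<in> B" "is_greatest (S \<parallel> A) cc \<theta> p"
  shows "snd p = target (fst p)"
proof -
  have "p \<in> \<theta>" using assms(2) by (simp add: is_greatest_def)
  then show ?thesis using assms(1) unfolding B_iff by (auto simp: pair_graph_def)
qed

lemma composite_events: "events copycat_composite = visible_primes"
proof (rule set_eqI)
  fix \<theta>
  have "\<theta> \<in> events copycat_composite \<longleftrightarrow> \<theta> \<in> B \<and> (\<exists>p. is_greatest (S \<parallel> A) cc \<theta> p) \<and>
      visible (interaction_map empty_game A S (Inr \<circ> \<sigma>) (copycat A) copycat_map \<theta>)"
    by (simp add: composite_def Let_def interaction_eq(1) wedge_def)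
  also have "\<dots> \<longleftrightarrow> \<theta> \<in> visible_primes"
  proof
    assume \<theta>: "\<theta> \<in> B \<and> (\<exists>p. is_greatest (S \<parallel> A) cc \<theta> p) \<and>
      visible (interaction_map empty_game A S (Inr \<circ> \<sigma>) (copycat A) copycat_map \<theta>)"
    then obtain p where p: "is_greatest (S \<parallel> A) cc \<theta> p" by auto
    have "visible (target (fst p))" using \<theta> interaction_map_greatest[OF _ p] by simp
    then obtain a where "fst p = Inr a" by (cases "fst p") auto
    then have "p = right a" using greatest_snd[OF _ p] \<theta> by (simp add: prod_eq_iff)
    then show "\<theta> \<in> visible_primes" using \<theta> p by (auto simp: visible_primes_def)
  next
    assume "\<theta> \<in> visible_primes"
    then obtain a where a: "\<theta> \<in> B" "is_greatest (S \<parallel> A) cc \<theta> (right a)"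
      by (auto simp: visible_primes_def)
    then show "\<theta> \<in> B \<and> (\<exists>p. is_greatest (S \<parallel> A) cc \<theta> p) \<and>
      visible (interaction_map empty_game A S (Inr \<circ> \<sigma>) (copycat A) copycat_map \<theta>)"
      using interaction_map_greatest[OF a] by auto
  qed
  finally show "\<theta> \<in> events copycat_composite \<longleftrightarrow> \<theta> \<in> visible_primes" .
qed

lemma composite_map_greatest:
  assumes "\<theta> \<in> B" "is_greatest (S \<parallel> A) cc \<theta> (right a)"
  shows "copycat_composite_map \<theta> = Inr a"
  by (simp add: composite_map_def interaction_map_greatest[OF assms])

lemma composite_pol:
  assumes "\<theta> \<in> visible_primes"
  shows "pol copycat_composite \<theta> = pol A (projr (copycat_composite_map \<theta>))"
proof -
  from assms obtain a where "\<theta> \<in> B" "is_greatest (S \<parallel> A) cc \<theta> (right a)"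
    by (auto simp: visible_primes_def)
  then have "copycat_composite_map \<theta> = Inr a" by (rule composite_map_greatest)
  then show ?thesis by (simp add: composite_def Let_def par_def)
qed

lemma composite_configs:
  "X \<in> configs copycat_composite \<longleftrightarrow> finite X \<and> X \<subseteq> visible_primes \<and> \<Union>X \<in> B \<and>
    (\<forall>\<theta>\<in>X. \<forall>\<theta>'\<in>visible_primes. \<theta>' \<subseteq> \<theta> \<longrightarrow> \<theta>' \<in> X)"
proof -
  let ?I = "wedge (S \<parallel> A) target cc (\<lambda>c. c)"
  have sub: "visible_primes \<subseteq> events ?I"
    by (auto simp: wedge_def Let_def visible_primes_def)
  have vis: "{p \<in> events ?I. visible (wedge_map (S \<parallel> A) target cc (\<lambda>c. c) p)} = visible_primes"
    using composite_events by (simp add: composite_def Let_def interaction_eq)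
  have leq: "(\<theta>', \<theta>) \<in> leq copycat_composite \<longleftrightarrow> \<theta>' \<in> visible_primes \<and> \<theta> \<in> visible_primes \<and> \<theta>' \<subseteq> \<theta>" for \<theta> \<theta>'
  proof -
    have "(\<theta>', \<theta>) \<in> leq copycat_composite \<longleftrightarrow> (\<theta>', \<theta>) \<in> leq ?I \<and> \<theta>' \<in> visible_primes \<and> \<theta> \<in> visible_primes"
      by (simp add: composite_def Let_def interaction_eq vis)
    also have "(\<theta>', \<theta>) \<in> leq ?I \<longleftrightarrow> \<theta>' \<in> events ?I \<and> \<theta> \<in> events ?I \<and> \<theta>' \<subseteq> \<theta>"
      by (simp add: wedge_def Let_def)
    finally show ?thesis using sub by blast
  qed
  have "X \<in> Con copycat_composite \<longleftrightarrow> X \<in> Con ?I \<and> X \<subseteq> visible_primes"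
    by (simp add: composite_def Let_def interaction_eq vis)
  also have "X \<in> Con ?I \<longleftrightarrow> finite X \<and> X \<subseteq> events ?I \<and> \<Union>X \<in> B"
    by (simp add: wedge_def Let_def)
  finally have Con: "X \<in> Con copycat_composite \<longleftrightarrow> finite X \<and> X \<subseteq> visible_primes \<and> \<Union>X \<in> B"
    using sub by blast
  have "(\<forall>\<theta>\<in>X. \<forall>\<theta>'. (\<theta>', \<theta>) \<in> leq copycat_composite \<longrightarrow> \<theta>' \<in> X) \<longleftrightarrow>
      (\<forall>\<theta>\<in>X. \<forall>\<theta>'\<in>visible_primes. \<theta>' \<subseteq> \<theta> \<longrightarrow> \<theta>' \<in> X)" if "X \<subseteq> visible_primes"
    unfolding leq using subsetD[OF that] by fast
  then show ?thesis
    unfolding configs_def mem_Collect_eq Con composite_events by argo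
qed

section \<open>Hiding, and configurations of the composite as pairs\<close>

definition primes_in :: "(('s + 'a) \<times> (unit + ('a + 'a))) set \<Rightarrow> (('s + 'a) \<times> (unit + ('a + 'a))) set set"
  where "primes_in \<theta> = {q \<in> visible_primes. q \<subseteq> \<theta>}"

definition reach :: "'s set \<Rightarrow> 'a set \<Rightarrow> 's set" where
  "reach x y = {s \<in> x. \<exists>s'\<in>x. (s, s') \<in> leq S \<and> pol S s' = Pos \<and> \<sigma> s' \<in> y}"

lemma reach_subset: "reach x y \<subseteq> x"
  by (auto simp: reach_def)

lemma reachI: "s \<in> x \<Longrightarrow> s' \<in> x \<Longrightarrow> (s, s') \<in> leq S \<Longrightarrow> pol S s' = Pos \<Longrightarrow> \<sigma> s' \<in> y \<Longrightarrow> s \<in> reach x y"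
  by (auto simp: reach_def)

lemma reachE:
  assumes "s \<in> reach x y"
  obtains s' where "s \<in> x" "s' \<in> x" "(s, s') \<in> leq S" "pol S s' = Pos" "\<sigma> s' \<in> y"
  using assms by (auto simp: reach_def)

lemma reach_pos:
  assumes "x \<in> configs S" "s \<in> x" "pol S s = Pos" "\<sigma> s \<in> y"
  shows "s \<in> reach x y"
  by (rule reachI[OF assms(2,2) leq_refl[OF source subsetD[OF configsD(2)[OF assms(1)] assms(2)]] assms(3,4)])

lemma reach_idem: "x \<in> configs S \<Longrightarrow> reach (reach x y) y = reach x y"
proof
  assume x: "x \<in> configs S"
  show "reach x y \<subseteq> reach (reach x y) y"
  proof
    fix s assume s: "s \<in> reach x y"
    then obtain s' where s': "s' \<in> x" "(s, s') \<in> leq S" "pol S s' = Pos" "\<sigma> s' \<in> y" by (rule reachE)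
    show "s \<in> reach (reach x y) y" by (rule reachI[OF s reach_pos[OF x s'(1,3,4)] s'(2-4)])
  qed
qed (rule reach_subset)

lemma reach_config:
  assumes x: "x \<in> configs S"
  shows "reach x y \<in> configs S"
proof (rule configs_subset[OF Con_subset[OF source] x reach_subset])
  fix e e' assume e: "e \<in> reach x y" "(e', e) \<in> leq S"
  from e(1) obtain s' where s': "e \<in> x" "s' \<in> x" "(e, s') \<in> leq S" "pol S s' = Pos" "\<sigma> s' \<in> y"
    by (rule reachE)
  show "e' \<in> reach x y"
    by (rule reachI[OF configsD(4)[OF x s'(1) e(2)] s'(2) leq_trans[OF source e(2) s'(3)] s'(4,5)])
qed

text \<open>A positive event of \<open>y\<close> comes from a positive event of \<open>x\<close>,
  which is retained by \<open>reach\<close> as its own witness; dropping events of \<open>x\<close>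
  can break no other condition.\<close>

lemma reach_compatible:
  assumes comp: "compatible x y"
  shows "compatible (reach x y) y"
proof (rule compatibleI[OF reach_config[OF compatibleD(1)[OF comp]] compatibleD(2)[OF comp]])
  fix a assume a: "a \<in> y" "pol A a = Pos"
  then have "a \<in> \<sigma> ` x" by (rule compatibleD(3)[OF comp])
  then obtain s where s: "s \<in> x" "a = \<sigma> s" by auto
  then have "s \<in> reach x y"
    using reach_pos[OF compatibleD(1)[OF comp] s(1)] map_pol_config[OF compatibleD(1)[OF comp] s(1)] a by simp
  then show "a \<in> \<sigma> ` reach x y" using s(2) by simp
next
  fix s assume "s \<in> reach x y" "pol S s = Neg"
  then show "\<sigma> s \<in> y" using compatibleD(4)[OF comp] subsetD[OF reach_subset] by blast
qed

lemma pair_graph_B: "compatible x y \<Longrightarrow> pair_graph x y \<in> B"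
  unfolding B_iff by blast

lemma right_mem: "right a \<in> pair_graph x y \<longleftrightarrow> a \<in> y"
  by (simp add: pair_graph_mem)

lemma left_mem: "left s \<in> pair_graph x y \<longleftrightarrow> s \<in> x"
  by (simp add: pair_graph_mem)

lemma visible_prime_below:
  assumes "\<theta> \<in> B" "right a \<in> \<theta>"
  shows "prime_below \<theta> (right a) \<in> primes_in \<theta>" "is_greatest (S \<parallel> A) cc (prime_below \<theta> (right a)) (right a)"
proof -
  show gr: "is_greatest (S \<parallel> A) cc (prime_below \<theta> (right a)) (right a)"
    by (rule prime_below_greatest[OF assms])
  then have "prime_below \<theta> (right a) \<in> visible_primes"
    using prime_below_B[OF assms] unfolding visible_primes_def by blast
  then show "prime_below \<theta> (right a) \<in> primes_in \<theta>"
    using graph_order_subset[of "S \<parallel> A" cc \<theta>] unfolding primes_in_def by auto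
qed

lemma primes_in_cases:
  assumes "\<theta> \<in> B" "q \<in> primes_in \<theta>"
  obtains a where "right a \<in> \<theta>" "q = prime_below \<theta> (right a)" "is_greatest (S \<parallel> A) cc q (right a)"
    "q \<in> B"
proof -
  from assms(2) obtain a where a: "q \<in> B" "is_greatest (S \<parallel> A) cc q (right a)" and sub: "q \<subseteq> \<theta>"
    by (auto simp: primes_in_def visible_primes_def)
  have "right a \<in> \<theta>" using a(2) sub by (auto simp: is_greatest_def)
  then show thesis using greatest_eq_prime_below[OF a(1) assms(1) sub a(2)] a(2,1) by (rule that)
qed

text \<open>Only the events of \<open>x\<close> below a visible event survive hiding: a copy on the right lies above
  \<open>s\<close> exactly if some positive \<open>s'\<close> above \<open>s\<close> has been copied.\<close>

lemma Union_primes_in: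
  assumes comp: "compatible x y"
  shows "\<Union>(primes_in (pair_graph x y)) = pair_graph (reach x y) y"
proof
  let ?\<theta> = "pair_graph x y" and ?\<theta>' = "pair_graph (reach x y) y"
  note B = pair_graph_B[OF comp] and B' = pair_graph_B[OF reach_compatible[OF comp]]
  have sub: "?\<theta>' \<subseteq> ?\<theta>" unfolding pair_graph_subset using reach_subset by simp
  show "\<Union>(primes_in ?\<theta>) \<subseteq> ?\<theta>'"
  proof (rule Union_least)
    fix q assume "q \<in> primes_in ?\<theta>"
    then obtain a where a: "right a \<in> ?\<theta>" "q = prime_below ?\<theta> (right a)"
      by (rule primes_in_cases[OF B])
    \<comment> \<open>All visible copies remain in \<open>?\<theta>'\<close>, which is again a
      secured bijection; their histories in \<open>?\<theta>\<close> therefore cannot leave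
      it.\<close>
    have a': "right a \<in> ?\<theta>'" using a(1) by (simp add: right_mem)
    show "q \<subseteq> ?\<theta>'"
      using B_graph_order[OF B' B sub a'] subsetD[OF graph_order_subset[of "S \<parallel> A" cc ?\<theta>']]
      unfolding a(2) by blast
  qed
  show "?\<theta>' \<subseteq> \<Union>(primes_in ?\<theta>)"
  proof
    fix p assume p: "p \<in> ?\<theta>'"
    obtain q where q: "p = (q, target q)" "q \<in> Inl ` reach x y \<union> Inr ` y"
      using p by (auto simp: pair_graph_def)
    have "\<exists>a\<in>y. (p, right a) \<in> graph_order (S \<parallel> A) cc ?\<theta>"
    proof (cases q)
      case (Inr a)
      then have a: "a \<in> y" "p = right a" using q by auto
      then show ?thesis using graph_order_refl[of "right a" ?\<theta>] by (intro bexI[of _ a]) (simp_all add: right_mem)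
    next
      case (Inl s)
      then have s: "s \<in> reach x y" "p = left s" using q by auto
      from s(1) obtain s' where s': "s \<in> x" "s' \<in> x" "(s, s') \<in> leq S" "pol S s' = Pos" "\<sigma> s' \<in> y"
        by (rule reachE)
      have mem: "left s \<in> ?\<theta>" "left s' \<in> ?\<theta>" "right (\<sigma> s') \<in> ?\<theta>"
        using s' by (simp_all add: left_mem right_mem)
      have 1: "(left s, left s') \<in> graph_order (S \<parallel> A) cc ?\<theta>"
      proof (cases "s = s'")
        case True
        then show ?thesis using graph_order_refl[OF mem(2)] by simp
      next
        case False
        then show ?thesis by (intro graph_order_step[OF mem(1,2)]) (simp add: lt_def leq_par s'(3))
      qed
      have "pol A (\<sigma> s') = Pos" "\<sigma> s' \<in> events A"
        using map_pol_config[OF compatibleD(1)[OF comp] s'(2)] s'(4)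
          subsetD[OF configsD(2)[OF compatibleD(2)[OF comp]] s'(5)] by simp_all
      \<comment> \<open>Positivity of \<open>s'\<close> puts its hidden copy before the visible one,
        so the chain runs from \<open>s\<close> through \<open>s'\<close> to a visible
        event.\<close>
      then have "(Inl (\<sigma> s'), Inr (\<sigma> s')) \<in> copycat_leq A"
        by (intro copycat_step_leq) (simp add: copycat_step_cases)
      then have 2: "(left s', right (\<sigma> s')) \<in> graph_order (S \<parallel> A) cc ?\<theta>"
        by (intro graph_order_step[OF mem(2,3)]) (simp add: lt_def leq_par copycat_def)
      show ?thesis using graph_order_trans[OF 1 2] s'(5) s(2) by (intro bexI[of _ "\<sigma> s'"]) simp_all
    qed
    then obtain a where a: "a \<in> y" "(p, right a) \<in> graph_order (S \<parallel> A) cc ?\<theta>" by auto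
    have "right a \<in> ?\<theta>" using a(1) by (simp add: right_mem)
    then show "p \<in> \<Union>(primes_in ?\<theta>)" using visible_prime_below(1)[OF B] a(2) by blast
  qed
qed

lemma finite_pair_graph: "compatible x y \<Longrightarrow> finite (pair_graph x y)"
  unfolding pair_graph_def
  by (intro finite_imageI finite_UnI configsD(1)[OF compatibleD(1)] configsD(1)[OF compatibleD(2)])

lemma primes_in_config:
  assumes comp: "compatible x y"
  shows "primes_in (pair_graph x y) \<in> configs copycat_composite"
  unfolding composite_configs
proof (intro conjI ballI impI)
  have "primes_in (pair_graph x y) \<subseteq> Pow (pair_graph x y)" by (auto simp: primes_in_def)
  then show "finite (primes_in (pair_graph x y))"
    by (rule finite_subset) (simp add: finite_pair_graph[OF comp])
  show "\<Union> (primes_in (pair_graph x y)) \<in> B"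
    unfolding Union_primes_in[OF comp] by (rule pair_graph_B[OF reach_compatible[OF comp]])
qed (auto simp: primes_in_def)

text \<open>A visible prime inside the union is the history of some \<open>right a\<close>, which
  lies in a member \<open>r\<close> of \<open>X\<close>. As \<open>r\<close> is closed it contains
  that history, and \<open>X\<close> is down-closed.\<close>

lemma config_eq_primes_in:
  assumes X: "X \<in> configs copycat_composite"
  shows "X = primes_in (\<Union>X)"
proof
  note X = X[unfolded composite_configs]
  show "X \<subseteq> primes_in (\<Union>X)" using X by (auto simp: primes_in_def)
  show "primes_in (\<Union>X) \<subseteq> X"
  proof
    fix q assume q: "q \<in> primes_in (\<Union>X)"
    from X have B: "\<Union>X \<in> B" by simp
    obtain a where a: "right a \<in> \<Union>X" "q = prime_below (\<Union>X) (right a)"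
      by (rule primes_in_cases[OF B q])
    from a(1) obtain r where r: "r \<in> X" "right a \<in> r" by auto
    have "r \<in> B" using X r(1) by (auto simp: visible_primes_def)
    then have "q \<subseteq> r"
      using B_graph_order[OF _ B Union_upper[OF r(1)] r(2)]
        subsetD[OF graph_order_subset[of "S \<parallel> A" cc r]] unfolding a(2) by blast
    moreover have "q \<in> visible_primes" using q by (simp add: primes_in_def)
    ultimately show "q \<in> X" using X r(1) by blast
  qed
qed

text \<open>A normal form: \<open>X\<close> determines its union, which by
  \<open>Union_primes_in\<close> is the graph of a pair already reduced by
  \<open>reach\<close>.\<close>

lemma composite_config_cases:
  assumes X: "X \<in> configs copycat_composite"
  obtains x y where "compatible x y" "reach x y = x" "X = primes_in (pair_graph x y)"
proof -
  have "\<Union>X \<in> B" using X unfolding composite_configs by simp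
  then obtain x y where xy: "compatible x y" "\<Union>X = pair_graph x y" unfolding B_iff by auto
  have X_eq: "X = primes_in (pair_graph x y)" by (rule config_eq_primes_in[OF X, unfolded xy(2)])
  then have "pair_graph (reach x y) y = pair_graph x y"
    using Union_primes_in[OF xy(1)] xy(2) by simp
  then have "reach x y = x"
    using pair_graph_subset[of "reach x y" y x y] pair_graph_subset[of x y "reach x y" y] by simp
  with xy(1) show thesis using X_eq by (rule that)
qed

lemma primes_in_subset_iff:
  assumes "compatible x y" "reach x y = x" "compatible x' y'" "reach x' y' = x'"
  shows "primes_in (pair_graph x y) \<subseteq> primes_in (pair_graph x' y') \<longleftrightarrow> x \<subseteq> x' \<and> y \<subseteq> y'"
proof
  assume "primes_in (pair_graph x y) \<subseteq> primes_in (pair_graph x' y')"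
  then have "\<Union>(primes_in (pair_graph x y)) \<subseteq> \<Union>(primes_in (pair_graph x' y'))" by (rule Union_mono)
  then have "pair_graph x y \<subseteq> pair_graph x' y'"
    using Union_primes_in[OF assms(1)] Union_primes_in[OF assms(3)] assms(2,4) by simp
  then show "x \<subseteq> x' \<and> y \<subseteq> y'" unfolding pair_graph_subset .
next
  assume "x \<subseteq> x' \<and> y \<subseteq> y'"
  then have "pair_graph x y \<subseteq> pair_graph x' y'" unfolding pair_graph_subset .
  then show "primes_in (pair_graph x y) \<subseteq> primes_in (pair_graph x' y')"
    by (auto simp: primes_in_def)
qed

lemma composite_map_primes_in:
  assumes comp: "compatible x y"
  shows "copycat_composite_map ` primes_in (pair_graph x y) = Inr ` y"
proof
  note B = pair_graph_B[OF comp]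
  show "copycat_composite_map ` primes_in (pair_graph x y) \<subseteq> Inr ` y"
  proof (rule image_subsetI)
    fix q assume "q \<in> primes_in (pair_graph x y)"
    then obtain a where a: "right a \<in> pair_graph x y" "is_greatest (S \<parallel> A) cc q (right a)" "q \<in> B"
      by (rule primes_in_cases[OF B])
    then show "copycat_composite_map q \<in> Inr ` y" using composite_map_greatest[OF a(3,2)] by (simp add: right_mem)
  qed
  show "Inr ` y \<subseteq> copycat_composite_map ` primes_in (pair_graph x y)"
  proof (rule image_subsetI)
    fix a assume "a \<in> y"
    then have a: "right a \<in> pair_graph x y" by (simp add: right_mem)
    have eq: "copycat_composite_map (prime_below (pair_graph x y) (right a)) = Inr a"
      by (rule composite_map_greatest[OF prime_below_B[OF B a] visible_prime_below(2)[OF B a]])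
    show "Inr a \<in> copycat_composite_map ` primes_in (pair_graph x y)"
      using imageI[OF visible_prime_below(1)[OF B a], of copycat_composite_map] by (simp only: eq)
  qed
qed

text \<open>Within one configuration all primes are histories in the same bijection, so each is
  determined by its greatest element and thus by its label.\<close>

lemma composite_map_inj:
  assumes X: "X \<in> configs copycat_composite"
  shows "inj_on copycat_composite_map X"
proof -
  obtain x y where xy: "compatible x y" "X = primes_in (pair_graph x y)"
    using X by (rule composite_config_cases)
  note B = pair_graph_B[OF xy(1)]
  show ?thesis
  proof (rule inj_onI)
    fix p q assume p: "p \<in> X" and q: "q \<in> X" and eq: "copycat_composite_map p = copycat_composite_map q"
    obtain a where a: "p = prime_below (pair_graph x y) (right a)" "is_greatest (S \<parallel> A) cc p (right a)" "p \<in> B"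
      by (rule primes_in_cases[OF B p[unfolded xy(2)]])
    obtain b where b: "q = prime_below (pair_graph x y) (right b)" "is_greatest (S \<parallel> A) cc q (right b)" "q \<in> B"
      by (rule primes_in_cases[OF B q[unfolded xy(2)]])
    have "a = b" using eq composite_map_greatest[OF a(3,2)] composite_map_greatest[OF b(3,2)] by simp
    then show "p = q" using a(1) b(1) by simp
  qed
qed

text \<open>An event \<open>q\<close> is itself a pair graph, so \<open>primes_in q\<close> is a
  configuration; being the set of visible primes below \<open>q\<close>, it is the least one
  containing \<open>q\<close>.\<close>

lemma composite_has_principals: "has_principals copycat_composite"
  unfolding has_principals_def
proof
  fix q assume "q \<in> events copycat_composite"
  then have q: "q \<in> visible_primes" by (simp add: composite_events)
  then have "q \<in> B" by (simp add: visible_primes_def)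
  then obtain x y where "compatible x y" "q = pair_graph x y" unfolding B_iff by auto
  then have "primes_in q \<in> configs copycat_composite" using primes_in_config by simp
  then show "\<exists>X\<in>configs copycat_composite. q \<in> X \<and> (\<forall>X'\<in>configs copycat_composite. q \<in> X' \<longrightarrow> X \<subseteq> X')"
  proof (rule bexI[rotated], intro conjI ballI impI subsetI)
    show "q \<in> primes_in q" using q by (simp add: primes_in_def)
    show "p \<in> X'" if X': "X' \<in> configs copycat_composite" "q \<in> X'" and p: "p \<in> primes_in q" for X' p
      using X'(1)[unfolded composite_configs] X'(2) p by (auto simp: primes_in_def)
  qed
qed


section \<open>Strategies as families of lifted configurations\<close>

text \<open>\<open>R u x\<close> relates a configuration \<open>u\<close> of \<open>S\<close> to the configuration of the composite that is
  represented by the pair \<open>(x, \<sigma> ` u)\<close>.\<close>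

definition composite_relation :: "('s set \<Rightarrow> 's set \<Rightarrow> bool) \<Rightarrow> bool" where
  "composite_relation R \<longleftrightarrow>
     (\<forall>u x. R u x \<longrightarrow> u \<in> configs S \<and> compatible x (\<sigma> ` u) \<and> reach x (\<sigma> ` u) = x) \<and>
     (\<forall>u\<in>configs S. \<exists>x. R u x) \<and>
     (\<forall>x y. compatible x y \<longrightarrow> reach x y = x \<longrightarrow> (\<exists>u. R u x \<and> \<sigma> ` u = y)) \<and>
     (\<forall>u x u' x'. R u x \<longrightarrow> R u' x' \<longrightarrow> (u \<subseteq> u' \<longleftrightarrow> x \<subseteq> x' \<and> \<sigma> ` u \<subseteq> \<sigma> ` u'))"

lemma composite_relationD:
  assumes "composite_relation R"
  shows "R u x \<Longrightarrow> u \<in> configs S" "R u x \<Longrightarrow> compatible x (\<sigma> ` u)" "R u x \<Longrightarrow> reach x (\<sigma> ` u) = x"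
    "u \<in> configs S \<Longrightarrow> \<exists>x. R u x"
    "compatible x y \<Longrightarrow> reach x y = x \<Longrightarrow> \<exists>u. R u x \<and> \<sigma> ` u = y"
    "R u x \<Longrightarrow> R u' x' \<Longrightarrow> u \<subseteq> u' \<longleftrightarrow> x \<subseteq> x' \<and> \<sigma> ` u \<subseteq> \<sigma> ` u'"
  using assms unfolding composite_relation_def by simp_all

lemma strategy_iff: "strategy A S \<sigma> \<longleftrightarrow> (\<exists>R. composite_relation R)"
proof
  assume "strategy A S \<sigma>"
  then obtain \<phi> where iso: "esp_iso copycat_composite S \<phi>" and \<phi>: "\<And>p. p \<in> events copycat_composite \<Longrightarrow> Inr (\<sigma> (\<phi> p)) = copycat_composite_map p"
    unfolding strategy_def pre_strategy_iso_def by auto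
  from iso obtain g where g: "es_map copycat_composite S \<phi>" "es_map S copycat_composite g"
    "\<And>p. p \<in> events copycat_composite \<Longrightarrow> g (\<phi> p) = p" "\<And>s. s \<in> events S \<Longrightarrow> \<phi> (g s) = s"
    unfolding esp_iso_def esp_map_def by auto
  have \<phi>_config: "\<phi> ` X \<in> configs S" if "X \<in> configs copycat_composite" for X
    using g(1) that by (simp add: es_map_def)
  have g_config: "g ` u \<in> configs copycat_composite" if "u \<in> configs S" for u
    using g(2) that by (simp add: es_map_def)
  have g\<phi>: "g ` \<phi> ` X = X" if "X \<in> configs copycat_composite" for X
    using g(3) configsD(2)[OF that] by (force simp: image_image)
  have \<phi>g: "\<phi> ` g ` u = u" if "u \<in> configs S" for u
    using g(4) configsD(2)[OF that] by (force simp: image_image)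
  have \<sigma>\<phi>: "Inr ` \<sigma> ` \<phi> ` X = copycat_composite_map ` X" if "X \<in> configs copycat_composite" for X
    unfolding image_image using \<phi> subsetD[OF configsD(2)[OF that]] by (intro image_cong refl) simp
  have \<sigma>\<phi>_primes: "\<sigma> ` \<phi> ` primes_in (pair_graph x y) = y" if "compatible x y" for x y
  proof -
    have "Inr ` \<sigma> ` \<phi> ` primes_in (pair_graph x y) = (Inr ` y :: (unit + 'a) set)"
      using \<sigma>\<phi>[OF primes_in_config[OF that]] composite_map_primes_in[OF that] by simp
    then show ?thesis by (simp add: inj_image_eq_iff)
  qed
  \<comment> \<open>The isomorphism commutes with the maps to \<open>A\<close>, so the second
    component of the pair representing \<open>u\<close> must be the image of \<open>u\<close>; only
    \<open>x\<close> has to be recorded.\<close>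
  let ?R = "\<lambda>u x. compatible x (\<sigma> ` u) \<and> reach x (\<sigma> ` u) = x \<and> u = \<phi> ` primes_in (pair_graph x (\<sigma> ` u))"
  have "composite_relation ?R"
    unfolding composite_relation_def
  proof (intro conjI allI ballI impI)
    fix u x assume R: "?R u x"
    then show "compatible x (\<sigma> ` u)" "reach x (\<sigma> ` u) = x" by simp_all
    show "u \<in> configs S" using R \<phi>_config primes_in_config by metis
  next
    fix u assume u: "u \<in> configs S"
    obtain x y where xy: "compatible x y" "reach x y = x" "g ` u = primes_in (pair_graph x y)"
      using g_config[OF u] by (rule composite_config_cases)
    have u_eq: "u = \<phi> ` primes_in (pair_graph x y)" using \<phi>g[OF u] xy(3) by simp
    then have "\<sigma> ` u = y" using \<sigma>\<phi>_primes[OF xy(1)] by simp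
    then show "\<exists>x. ?R u x" using xy u_eq by (intro exI[of _ x]) simp
  next
    fix x y assume xy: "compatible x y" "reach x y = x"
    then show "\<exists>u. ?R u x \<and> \<sigma> ` u = y"
      using \<sigma>\<phi>_primes[OF xy(1)] by (intro exI[of _ "\<phi> ` primes_in (pair_graph x y)"]) simp
  next
    fix u x u' x' assume R: "?R u x" "?R u' x'"
    let ?X = "primes_in (pair_graph x (\<sigma> ` u))" and ?X' = "primes_in (pair_graph x' (\<sigma> ` u'))"
    have u: "u = \<phi> ` ?X" "u' = \<phi> ` ?X'" using R by blast+
    have X: "?X \<in> configs copycat_composite" "?X' \<in> configs copycat_composite" using R primes_in_config by blast+
    have "u \<subseteq> u' \<longleftrightarrow> ?X \<subseteq> ?X'"
    proof
      assume "u \<subseteq> u'"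
      then have "\<phi> ` ?X \<subseteq> \<phi> ` ?X'" using u by simp
      then have "g ` \<phi> ` ?X \<subseteq> g ` \<phi> ` ?X'" by (rule image_mono)
      then show "?X \<subseteq> ?X'" unfolding g\<phi>[OF X(1)] g\<phi>[OF X(2)] .
    next
      assume "?X \<subseteq> ?X'"
      then have "\<phi> ` ?X \<subseteq> \<phi> ` ?X'" by (rule image_mono)
      then show "u \<subseteq> u'" using u by simp
    qed
    also have "\<dots> \<longleftrightarrow> x \<subseteq> x' \<and> \<sigma> ` u \<subseteq> \<sigma> ` u'"
      by (rule primes_in_subset_iff) (use R in simp_all)
    finally show "u \<subseteq> u' \<longleftrightarrow> x \<subseteq> x' \<and> \<sigma> ` u \<subseteq> \<sigma> ` u'" .
  qed
  then show "\<exists>R. composite_relation R" by (rule exI[of composite_relation])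
next
  assume "\<exists>R. composite_relation R"
  then obtain R where cr: "composite_relation R" by auto
  note R = composite_relationD(1)[OF cr] and comp = composite_relationD(2)[OF cr]
    and reach = composite_relationD(3)[OF cr] and total = composite_relationD(4)[OF cr]
    and onto = composite_relationD(5)[OF cr] and order = composite_relationD(6)[OF cr]
  let ?Q = "\<lambda>X u. \<exists>x. R u x \<and> X = primes_in (pair_graph x (\<sigma> ` u))"
  show "strategy A S \<sigma>"
    unfolding strategy_def
  \<comment> \<open>All labels lie in the \<open>Inr\<close> summand, the other one being the empty
    game, so \<open>projr\<close> gives access to the polarity in \<open>A\<close>.\<close>
  proof (rule pre_strategy_iso_of_config_relation[of copycat_composite S copycat_composite_map "Inr \<circ> \<sigma>" "pol A \<circ> projr" ?Q])
    show "has_principals copycat_composite" by (rule composite_has_principals)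
    show "has_principals S" by (rule event_structure_has_principals[OF source])
    show "inj_on copycat_composite_map X" if "X \<in> configs copycat_composite" for X by (rule composite_map_inj[OF that])
    show "inj_on (Inr \<circ> \<sigma>) u" if "u \<in> configs S" for u
      using map_inj[OF that] by (rule comp_inj_on) simp
    show "pol copycat_composite p = (pol A \<circ> projr) (copycat_composite_map p)" if "p \<in> events copycat_composite" for p
      using composite_pol that by (simp add: composite_events)
    show "pol S s = (pol A \<circ> projr) ((Inr \<circ> \<sigma>) s)" if "s \<in> events S" for s
      using map_pol[OF that] by simp
    show "X \<in> configs copycat_composite \<and> u \<in> configs S" if "?Q X u" for X u
    proof -
      from that obtain x where x: "R u x" "X = primes_in (pair_graph x (\<sigma> ` u))" by auto
      show ?thesis using R[OF x(1)] primes_in_config[OF comp[OF x(1)]] x(2) by simp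
    qed
    show "\<exists>u. ?Q X u" if "X \<in> configs copycat_composite" for X
    proof -
      from that obtain x y where xy: "compatible x y" "reach x y = x" "X = primes_in (pair_graph x y)"
        by (rule composite_config_cases)
      obtain u where "R u x" "\<sigma> ` u = y" using onto[OF xy(1,2)] by auto
      then show ?thesis using xy(3) by auto
    qed
    show "\<exists>X. ?Q X u" if "u \<in> configs S" for u
      using total[OF that] by auto
    show "X \<subseteq> X' \<longleftrightarrow> u \<subseteq> u'" if Q: "?Q X u" "?Q X' u'" for X u X' u'
    proof -
      from Q(1) obtain x where x: "R u x" "X = primes_in (pair_graph x (\<sigma> ` u))" by auto
      from Q(2) obtain x' where x': "R u' x'" "X' = primes_in (pair_graph x' (\<sigma> ` u'))" by auto
      show ?thesis
        unfolding x(2) x'(2) order[OF x(1) x'(1)]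
        by (rule primes_in_subset_iff) (use comp reach x(1) x'(1) in simp_all)
    qed
    show "(Inr \<circ> \<sigma>) ` u = copycat_composite_map ` X" if "?Q X u" for X u
    proof -
      from that obtain x where x: "R u x" "X = primes_in (pair_graph x (\<sigma> ` u))" by auto
      show ?thesis using composite_map_primes_in[OF comp[OF x(1)]] x(2) by (simp add: image_image)
    qed
  qed
qed

text \<open>In terms of pairs, a negative extension changes the second component and leaves
  \<open>x\<close> alone, while a positive restriction shrinks the second component and then trims
  \<open>x\<close> by \<open>reach\<close>. Comparison of pairs gives back the inclusions in
  \<open>S\<close>.\<close>

lemma lifting_if_strategy:
  assumes "strategy A S \<sigma>"
  shows neg_lifting pos_lifting
proof -
  from assms obtain R where cr: "composite_relation R" unfolding strategy_iff by auto
  note R = composite_relationD(1)[OF cr] and comp = composite_relationD(2)[OF cr]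
    and reach = composite_relationD(3)[OF cr] and total = composite_relationD(4)[OF cr]
    and onto = composite_relationD(5)[OF cr] and order = composite_relationD(6)[OF cr]
  show neg_lifting
  proof (rule neg_liftingI)
    fix u y assume u: "u \<in> configs S" and y: "(\<sigma> ` u, y) \<in> sub_pol Neg A"
    obtain x where x: "R u x" using total[OF u] by auto
    note comp = comp[OF x] and reach = reach[OF x]
    note xc = compatibleD(1)[OF comp]
    have comp': "compatible x y"
    proof (rule compatibleI[OF xc sub_polD(2)[OF y]])
      fix a assume a: "a \<in> y" "pol A a = Pos"
      then have "a \<in> \<sigma> ` u" using sub_polD(4)[OF y a(1)] by auto
      then show "a \<in> \<sigma> ` x" using a(2) by (rule compatibleD(3)[OF comp])
    next
      fix s assume "s \<in> x" "pol S s = Neg"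
      then show "\<sigma> s \<in> y" using compatibleD(4)[OF comp] subsetD[OF sub_polD(3)[OF y]] by simp
    qed
    have "x \<subseteq> reach x y"
    proof
      fix s assume "s \<in> x"
      then have "s \<in> reach x (\<sigma> ` u)" using reach by simp
      then show "s \<in> reach x y"
        by (rule reachE) (rule reachI, use subsetD[OF sub_polD(3)[OF y]] in simp_all)
    qed
    then have "reach x y = x" using reach_subset by auto
    then obtain u' where u': "R u' x" "\<sigma> ` u' = y" using onto[OF comp'] by auto
    have "u \<subseteq> u'" using order[OF x u'(1)] u'(2) sub_polD(3)[OF y] by simp
    then have "(u, u') \<in> sub_pol Neg S"
      using sub_pol_lift[OF u R[OF u'(1)]] u'(2) y by simp
    then show "\<exists>u'. (u, u') \<in> sub_pol Neg S \<and> \<sigma> ` u' = y" using u'(2) by (intro exI conjI)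
  next
    fix u u' u'' assume u': "(u, u') \<in> sub_pol Neg S" and u'': "(u, u'') \<in> sub_pol Neg S"
      and eq: "\<sigma> ` u' = \<sigma> ` u''"
    obtain x where x: "R u x" using total[OF sub_polD(1)[OF u']] by auto
    note comp_x = comp[OF x]
    \<comment> \<open>A negative extension cannot enlarge \<open>x\<close>: every event of
      \<open>z\<close> is below a positive one whose image is in that of \<open>v\<close>, hence
      already in that of \<open>u\<close>, and compatibility finds it in \<open>x\<close>.\<close>
    have same: "R v x" if v: "(u, v) \<in> sub_pol Neg S" for v
    proof -
      obtain z where z: "R v z" using total[OF sub_polD(2)[OF v]] by auto
      note comp_z = comp[OF z] and reach_z = reach[OF z]
      have xz: "x \<subseteq> z" using order[OF x z] sub_polD(3)[OF v] by simp
      have "z \<subseteq> x"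
      proof
        fix s assume "s \<in> z"
        then have "s \<in> reach z (\<sigma> ` v)" using reach_z by simp
        then obtain s' where s': "s' \<in> z" "(s, s') \<in> leq S" "pol S s' = Pos" "\<sigma> s' \<in> \<sigma> ` v" by (rule reachE)
        have pos: "pol A (\<sigma> s') = Pos"
          using map_pol_config[OF compatibleD(1)[OF comp_z] s'(1)] s'(3) by simp
        then have "\<sigma> s' \<in> \<sigma> ` u" using sub_polD(4)[OF map_sub_pol[OF v] s'(4)] by auto
        then have "\<sigma> s' \<in> \<sigma> ` x" using pos by (rule compatibleD(3)[OF comp_x])
        then have "s' \<in> x" using map_mem_iff[OF compatibleD(1)[OF comp_z] xz s'(1)] by simp
        then show "s \<in> x" using configsD(4)[OF compatibleD(1)[OF comp_x] _ s'(2)] by simp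
      qed
      then have "z = x" using xz by simp
      then show ?thesis using z by simp
    qed
    show "u' = u''"
      using order[OF same[OF u'] same[OF u'']] order[OF same[OF u''] same[OF u']] eq by simp
  qed
  show pos_lifting
    unfolding pos_lifting_def
  proof (intro ballI allI impI)
    fix u y assume u: "u \<in> configs S" and y: "(y, \<sigma> ` u) \<in> sub_pol Pos A"
    obtain x where x: "R u x" using total[OF u] by auto
    note comp_x = comp[OF x]
    note xc = compatibleD(1)[OF comp_x]
    have comp': "compatible x y"
    proof (rule compatibleI[OF xc sub_polD(1)[OF y]])
      fix a assume a: "a \<in> y" "pol A a = Pos"
      show "a \<in> \<sigma> ` x" by (rule compatibleD(3)[OF comp_x subsetD[OF sub_polD(3)[OF y] a(1)] a(2)])
    next
      fix s assume s: "s \<in> x" "pol S s = Neg"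
      have "pol A (\<sigma> s) = Neg" using map_pol_config[OF xc s(1)] s(2) by simp
      then show "\<sigma> s \<in> y" using sub_polD(4)[OF y compatibleD(4)[OF comp_x s]] by auto
    qed
    \<comment> \<open>Events of \<open>x\<close> whose positive witnesses were all removed from
      \<open>y\<close> no longer survive hiding, so the representing pair has
      \<open>reach x y\<close> as first component.\<close>
    obtain u' where u': "R u' (reach x y)" "\<sigma> ` u' = y"
      using onto[OF reach_compatible[OF comp'] reach_idem[OF xc]] by auto
    have "u' \<subseteq> u" using order[OF u'(1) x] u'(2) sub_polD(3)[OF y] reach_subset by simp
    then have "(u', u) \<in> sub_pol Pos S"
      using sub_pol_lift[OF R[OF u'(1)] u] u'(2) y by simp
    then show "\<exists>u'. (u', u) \<in> sub_pol Pos S \<and> \<sigma> ` u' = y" using u'(2) by (intro exI conjI)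
  qed
qed

text \<open>\<open>?D u\<close> differs from \<open>u\<close> only by negative events, so
  \<open>u\<close> is the unique negative extension of \<open>?D u\<close> with its image. This
  makes the pair of \<open>?D u\<close> and that image a faithful code for \<open>u\<close>.\<close>

lemma strategy_if_lifting:
  assumes neg: neg_lifting and pos: pos_lifting
  shows "strategy A S \<sigma>"
proof -
  have cour: "courteous A S \<sigma>" by (rule courteous_if_lifting[OF neg pos])
  let ?D = "\<lambda>u. reach u (\<sigma> ` u)"
  have comp: "compatible u (\<sigma> ` u)" if "u \<in> configs S" for u
    by (rule compatibleI[OF that map_config[OF that]]) auto
  have D_pos: "s \<in> ?D u" if "u \<in> configs S" "s \<in> u" "pol S s = Pos" for u s
    using reach_pos[OF that] that(2) by simp
  have D_sub: "(?D u, u) \<in> sub_pol Neg S" if u: "u \<in> configs S" for u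
  proof (rule sub_polI[OF reach_config[OF u] u reach_subset])
    fix e assume "e \<in> u" "e \<notin> ?D u"
    then show "pol S e = Neg" using D_pos[OF u, of e] by (cases "pol S e") simp_all
  qed
  let ?R = "\<lambda>u x. u \<in> configs S \<and> x = ?D u"
  have onto: "\<exists>u. ?R u x \<and> \<sigma> ` u = y" if xy: "compatible x y" and reach: "reach x y = x" for x y
  proof -
    note xc = compatibleD(1)[OF xy]
    from compatibleD(5)[OF xy] obtain w where w: "(w, y) \<in> sub_pol Neg A" "(w, \<sigma> ` x) \<in> sub_pol Pos A"
      by (rule scott_orderE)
    obtain z where z: "(z, x) \<in> sub_pol Pos S" "\<sigma> ` z = w" by (rule pos_lifting_ex[OF pos xc w(2)])
    have w_eq: "w = y \<inter> \<sigma> ` x" by (rule scott_middle[OF w])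
    \<comment> \<open>The positive restriction \<open>z\<close> keeps each positive witness required
      by \<open>reach\<close>, since its image is in \<open>y\<close>; down-closure then keeps all
      of \<open>x\<close>. Thus \<open>y\<close> extends \<sigma> x by negative events only.\<close>
    have "x \<subseteq> z"
    proof
      fix s assume "s \<in> x"
      then have "s \<in> reach x y" using reach by simp
      then obtain s' where s': "s' \<in> x" "(s, s') \<in> leq S" "\<sigma> s' \<in> y" by (rule reachE)
      then have "\<sigma> s' \<in> \<sigma> ` z" using z(2) w_eq by simp
      then have "s' \<in> z" using map_mem_iff[OF xc sub_polD(3)[OF z(1)] s'(1)] by simp
      then show "s \<in> z" using configsD(4)[OF sub_polD(1)[OF z(1)] _ s'(2)] by simp
    qed
    then have "z = x" using sub_polD(3)[OF z(1)] by simp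
    then have "(\<sigma> ` x, y) \<in> sub_pol Neg A" using w(1) z(2) by simp
    then obtain u where u: "(x, u) \<in> sub_pol Neg S" "\<sigma> ` u = y" by (rule neg_lifting_ex[OF neg xc])
    note uc = sub_polD(2)[OF u(1)]
    have "?D u = x"
    proof
      show "?D u \<subseteq> x"
      proof
        fix s assume "s \<in> ?D u"
        then obtain s' where s': "s' \<in> u" "(s, s') \<in> leq S" "pol S s' = Pos" by (rule reachE)
        then have "s' \<in> x" using sub_polD(4)[OF u(1) s'(1)] by auto
        then show "s \<in> x" using configsD(4)[OF xc _ s'(2)] by simp
      qed
      show "x \<subseteq> ?D u"
      proof
        fix s assume s: "s \<in> x"
        then have "s \<in> reach x y" using reach by simp
        then obtain s' where s': "s' \<in> x" "(s, s') \<in> leq S" "pol S s' = Pos" by (rule reachE)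
        note xu = subsetD[OF sub_polD(3)[OF u(1)]]
        show "s \<in> ?D u" by (rule reachI[OF xu[OF s] xu[OF s'(1)] s'(2,3) imageI[OF xu[OF s'(1)], of \<sigma>]])
      qed
    qed
    then show ?thesis using uc u(2) by (intro exI[of _ u]) simp
  qed
  have order: "u \<subseteq> u' \<longleftrightarrow> ?D u \<subseteq> ?D u' \<and> \<sigma> ` u \<subseteq> \<sigma> ` u'"
    if u: "u \<in> configs S" and u': "u' \<in> configs S" for u u'
  proof
    assume sub: "u \<subseteq> u'"
    have "?D u \<subseteq> ?D u'"
    proof
      fix s assume "s \<in> ?D u"
      then obtain s' where s': "s \<in> u" "s' \<in> u" "(s, s') \<in> leq S" "pol S s' = Pos" by (rule reachE)
      show "s \<in> ?D u'"
        by (rule reachI[OF subsetD[OF sub s'(1)] subsetD[OF sub s'(2)] s'(3,4) imageI[OF subsetD[OF sub s'(2)], of \<sigma>]])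
    qed
    then show "?D u \<subseteq> ?D u' \<and> \<sigma> ` u \<subseteq> \<sigma> ` u'" using sub by auto
  next
    assume sub: "?D u \<subseteq> ?D u' \<and> \<sigma> ` u \<subseteq> \<sigma> ` u'"
    then have D_u': "?D u \<subseteq> u'" using reach_subset by blast
    \<comment> \<open>The copy of \<open>u\<close> inside \<open>u'\<close>. Once it is a
      configuration, \<open>?v\<close> and \<open>u\<close> are negative extensions of
      \<open>?D u\<close> with equal images, hence equal.\<close>
    let ?v = "{s \<in> u'. \<sigma> s \<in> \<sigma> ` u}"
    have v: "?v \<in> configs S"
    proof (rule configs_immediateI[OF source u'])
      fix e e' assume e: "e \<in> ?v" and imm: "immediate_cause S e' e"
      then have leq: "(e', e) \<in> leq S" by (simp add: immediate_cause_def lt_def)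
      have e'u': "e' \<in> u'" using configsD(4)[OF u' _ leq] e by simp
      have "\<sigma> e' \<in> \<sigma> ` u"
      proof (cases "(pol S e', pol S e) = (Neg, Pos)")
        \<comment> \<open>The one polarity pattern outside courtesy. The event \<open>d\<close> of
          \<open>u\<close> over \<sigma> e is positive, hence in \<open>?D u\<close> and so in
          \<open>u'\<close>, where injectivity equates it with \<open>e\<close>; then
          \<open>e'\<close> is a cause of an event of \<open>u\<close>.\<close>
        case True
        from e obtain d where d: "d \<in> u" "\<sigma> e = \<sigma> d" by auto
        have "pol S d = Pos"
          using map_pol_config[OF u d(1)] map_pol_config[OF u', of e] e d(2) True by simp
        then have "d \<in> u'" using D_pos[OF u d(1)] D_u' by auto
        then have "d = e" using inj_onD[OF map_inj[OF u'], of d e] d(2) e by simp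
        then show ?thesis using configsD(4)[OF u d(1)] leq by simp
      next
        case False
        then have "immediate_cause A (\<sigma> e') (\<sigma> e)"
          using cour imm leq_events[OF source leq] unfolding courteous_def by blast
        then show ?thesis
          using configsD(4)[OF map_config[OF u], of "\<sigma> e" "\<sigma> e'"] e
          by (simp add: immediate_cause_def lt_def)
      qed
      then show "e' \<in> ?v" using e'u' by simp
    qed simp
    have img: "\<sigma> ` ?v = \<sigma> ` u"
    proof
      show "\<sigma> ` u \<subseteq> \<sigma> ` ?v"
      proof
        fix a assume a: "a \<in> \<sigma> ` u"
        then have "a \<in> \<sigma> ` u'" using conjunct2[OF sub] by (rule rev_subsetD)
        then show "a \<in> \<sigma> ` ?v" using a by auto
      qed
    qed auto
    have "?D u \<subseteq> ?v" using D_u' subsetD[OF reach_subset[of u "\<sigma> ` u"]] by auto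
    then have "(?D u, ?v) \<in> sub_pol Neg S"
      by (rule sub_pol_lift[OF reach_config[OF u] v]) (simp only: img map_sub_pol[OF D_sub[OF u]])
    then have "?v = u" using D_sub[OF u] img by (rule neg_lifting_unique[OF neg])
    then show "u \<subseteq> u'" by auto
  qed
  show ?thesis
    unfolding strategy_iff composite_relation_def
  proof (intro exI[of _ ?R] conjI allI impI ballI)
    show "compatible x (\<sigma> ` u)" if "?R u x" for u x
      using reach_compatible[OF comp] that by simp
    show "reach x (\<sigma> ` u) = x" if "?R u x" for u x
      using reach_idem that by simp
    show "\<exists>u. ?R u x \<and> \<sigma> ` u = y" if "compatible x y" "reach x y = x" for x y
      by (rule onto[OF that])
    show "u \<subseteq> u' \<longleftrightarrow> x \<subseteq> x' \<and> \<sigma> ` u \<subseteq> \<sigma> ` u'" if "?R u x" "?R u' x'" for u x u' x'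
      using order that by simp
  qed auto
qed

end

theorem theorem3p20:
  fixes A :: "'a esp" and S :: "'s esp" and \<sigma> :: "'s \<Rightarrow> 'a"
  assumes "event_structure A"
    and "pre_strategy A S \<sigma>"
  shows
    "(strategy A S \<sigma> \<longleftrightarrow>
        discrete_fibration (configs S) ((sub_pol Neg S)\<inverse>) (configs A) ((sub_pol Neg A)\<inverse>) ((`) \<sigma>) \<and>
        discrete_fibration (configs S) (sub_pol Pos S) (configs A) (sub_pol Pos A) ((`) \<sigma>)) \<and>
     (strategy A S \<sigma> \<longleftrightarrow>
        discrete_fibration (configs S) (scott_order S) (configs A) (scott_order A) ((`) \<sigma>)) \<and>
     (strategy A S \<sigma> \<longleftrightarrow> courteous A S \<sigma> \<and> receptive A S \<sigma>)"
proof -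
  interpret pre_strategy_on_game A S \<sigma> by unfold_locales (rule assms)+
  have "strategy A S \<sigma> \<longleftrightarrow> neg_lifting \<and> pos_lifting"
    using lifting_if_strategy strategy_if_lifting by blast
  moreover have "courteous A S \<sigma> \<and> receptive A S \<sigma> \<longleftrightarrow> neg_lifting \<and> pos_lifting"
    using neg_lifting_if_courteous_receptive pos_lifting_if_courteous courteous_if_lifting
      receptive_if_neg_lifting by blast
  moreover have "discrete_fibration (configs S) (scott_order S) (configs A) (scott_order A) ((`) \<sigma>) \<longleftrightarrow>
      neg_lifting \<and> pos_lifting"
    using lifting_if_scott_fibration scott_fibration_if_lifting by blast
  ultimately show ?thesis unfolding neg_fibration_iff pos_fibration_iff by simp
qed

end
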